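(* Let $\lambda,\mu$ be real constants with $\mu>0$ and $2\mu+2\lambda>0$. Let $\theta_m,\theta_M\in(-\pi,\pi)$ with $\theta_M-\theta_m\in(0,\pi)$, $h>0$, and let $\mathcal{C}_h=\{(r\cos\theta,r\sin\theta)^\top:\theta_m<\theta<\theta_M,\ 0<r<h\}\subset\mathbb{R}^2$, $\Gamma_h^+=\{(r\cos\theta_M,r\sin\theta_M)^\top:0<r<h\}$, $\Gamma_h^-=\{(r\cos\theta_m,r\sin\theta_m)^\top:0<r<h\}$. Let $\mathbf{v},\mathbf{w}\in H^1(\mathcal{C}_h)^2$ satisfy $$\begin{cases}\mathcal{L}\mathbf{v}=\mathbf{0},\quad\mathcal{L}\mathbf{w}=\mathbf{0}&\text{in }\mathcal{C}_h,\\ \mathbf{v}-\mathbf{w}=\mathbf{f}_+,\quad \mathcal{T}_\nu\mathbf{v}-\mathcal{T}_\nu\mathbf{w}=\mathbf{g}_+&\text{on }\Gamma_h^+,\\ \mathbf{v}-\mathbf{w}=\mathbf{f}_-,\quad \mathcal{T}_\nu\mathbf{v}-\mathcal{T}_\nu\mathbf{w}=\mathbf{g}_-&\text{on }\Gamma_h^-,\end{cases}$$ with $\mathbf{f}_j\in H^{1/2}(\Gamma_h^j)^2\cap C^{1,\alpha_j}(\Gamma_h^j)^2$ and $\mathbf{g}_j\in H^{-1/2}(\Gamma_h^j)^2\cap C^{\beta_j}(\Gamma_h^j)^2$, where $j=+,-$ and $\alpha_+,\alpha_-,\beta_+,\beta_-\in(0,1)$. Then $$\mathbf{f}_+(\mathbf{0})=\mathbf{f}_-(\mathbf{0}).$$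 Furthermore, if $\nabla\mathbf{f}_j(\mathbf{0})=\mathbf{0}$ for $j=+,-$, then $$\mathbf{g}_+(\mathbf{0})=W\,\mathbf{g}_-(\mathbf{0}),\qquad W=\begin{bmatrix}-\cos(\theta_M-\theta_m)&-\sin(\theta_M-\theta_m)\\-\sin(\theta_M-\theta_m)&\cos(\theta_M-\theta_m)\end{bmatrix}.$$
   Context: Functions are complex vector-valued. $\mathcal{L}\mathbf{u}=\mu\Delta\mathbf{u}+(\lambda+\mu)\nabla(\nabla\cdot\mathbf{u})$ is the two-dimensional Lamé operator, and $\mathcal{T}_\nu\mathbf{u}=\lambda(\nabla\cdot\mathbf{u})\nu+\mu(\nabla\mathbf{u}+\nabla\mathbf{u}^\top)\nu$ is the traction, with $\nu$ the exterior unit normal to $\mathcal{C}_h$ on $\Gamma_h^\pm$, understood in the weak (conormal) sense for $H^1$ solutions. Values $\mathbf{f}_j(\mathbf{0}),\mathbf{g}_j(\mathbf{0})$ at the vertex are the limits along $\Gamma_h^j$, and $\nabla\mathbf{f}_j(\mathbf{0})$ refers to the first-order expansion $\mathbf{f}_j(\mathbf{x})=\mathbf{f}_j(\mathbf{0})+\nabla\mathbf{f}_j(\mathbf{0})\mathbf{x}+O(|\mathbf{x}|^{1+\alpha_j})$ for $\mathbf{x}\in\Gamma_h^j$. *)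

theory Defs
  imports "HOL-Analysis.Analysis" "HOL-Library.Landau_Symbols"
begin

section \<open>Smooth functions and the Lame operator\<close>

text \<open>Real points live in \<open>real^2\<close>, functions take values in \<open>complex^2\<close>. All dual pairings
  below are bilinear (no complex conjugation).\<close>

primrec C_k :: "nat \<Rightarrow> ('a::real_normed_vector \<Rightarrow> 'b::real_normed_vector) \<Rightarrow> bool" where
  "C_k 0 f \<longleftrightarrow> continuous_on UNIV f"
| "C_k (Suc n) f \<longleftrightarrow>
     (\<forall>x. f differentiable (at x)) \<and> (\<forall>v. C_k n (\<lambda>x. frechet_derivative f (at x) v))"

definition smooth :: "('a::real_normed_vector \<Rightarrow> 'b::real_normed_vector) \<Rightarrow> bool" where
  "smooth f \<longleftrightarrow> (\<forall>n. C_k n f)"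

definition supp :: "('a::topological_space \<Rightarrow> 'b::zero) \<Rightarrow> 'a set" where
  "supp f = closure {x. f x \<noteq> 0}"

definition test_function :: "(real^2) set \<Rightarrow> (real^2 \<Rightarrow> 'b::real_normed_vector) \<Rightarrow> bool" where
  "test_function \<Omega> \<phi> \<longleftrightarrow> smooth \<phi> \<and> compact (supp \<phi>) \<and> supp \<phi> \<subseteq> \<Omega>"

definition partial :: "2 \<Rightarrow> (real^2 \<Rightarrow> 'b::real_normed_vector) \<Rightarrow> real^2 \<Rightarrow> 'b" where
  "partial i f x = frechet_derivative f (at x) (axis i 1)"

text \<open>Convention for (classical and weak) Jacobians: row \<open>k\<close>, column \<open>i\<close> holds
  \<open>\<partial>\<^sub>i u\<^sub>k\<close>.\<close>

definition jacobian :: "(real^2 \<Rightarrow> complex^2) \<Rightarrow> real^2 \<Rightarrow> complex^2^2" where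
  "jacobian u x = (\<chi> k i. partial i u x $ k)"

definition divergence :: "(real^2 \<Rightarrow> complex^2) \<Rightarrow> real^2 \<Rightarrow> complex" where
  "divergence u x = (\<Sum>i\<in>UNIV. partial i u x $ i)"

definition gradient :: "(real^2 \<Rightarrow> complex) \<Rightarrow> real^2 \<Rightarrow> complex^2" where
  "gradient p x = (\<chi> i. partial i p x)"

definition laplacian :: "(real^2 \<Rightarrow> complex^2) \<Rightarrow> real^2 \<Rightarrow> complex^2" where
  "laplacian u x = (\<Sum>i\<in>UNIV. partial i (partial i u) x)"

definition lame :: "real \<Rightarrow> real \<Rightarrow> (real^2 \<Rightarrow> complex^2) \<Rightarrow> real^2 \<Rightarrow> complex^2" where
  "lame lam mu u x = mu *\<^sub>R laplacian u x + (lam + mu) *\<^sub>R gradient (divergence u) x"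

text \<open>\<open>\<L>u = 0\<close> in the sense of distributions. Each derivative in \<open>\<L>\<close> is moved to the test
  function; since \<open>\<L>\<close> has order two and a symmetric coefficient tensor, no sign appears and the
  transposed operator is \<open>\<L>\<close> itself.\<close>

definition lame_zero :: "real \<Rightarrow> real \<Rightarrow> (real^2) set \<Rightarrow> (real^2 \<Rightarrow> complex^2) \<Rightarrow> bool" where
  "lame_zero lam mu \<Omega> u \<longleftrightarrow>
     (\<forall>\<phi>. test_function \<Omega> \<phi> \<longrightarrow>
        (LINT x|lebesgue_on \<Omega>. scalar_product (u x) (lame lam mu \<phi> x)) = 0)"


section \<open>Sobolev spaces\<close>

text \<open>Elements of \<open>L\<^sup>2\<close> and \<open>H\<^sup>1\<close> are represented by functions; only the values on the set in
  question, up to null sets, matter.\<close>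

definition L2 :: "'a::euclidean_space set \<Rightarrow> ('a \<Rightarrow> 'b::euclidean_space) set" where
  "L2 S = {u. u \<in> borel_measurable (lebesgue_on S) \<and>
              integrable (lebesgue_on S) (\<lambda>x. (norm (u x))\<^sup>2)}"

definition L2_sq :: "'a::euclidean_space set \<Rightarrow> ('a \<Rightarrow> 'b::euclidean_space) \<Rightarrow> real" where
  "L2_sq S u = (LINT x|lebesgue_on S. (norm (u x))\<^sup>2)"

definition has_weak_jacobian ::
    "(real^2) set \<Rightarrow> (real^2 \<Rightarrow> complex^2) \<Rightarrow> (real^2 \<Rightarrow> complex^2^2) \<Rightarrow> bool" where
  "has_weak_jacobian \<Omega> u D \<longleftrightarrow> D \<in> L2 \<Omega> \<and>
     (\<forall>i. \<forall>\<phi>::real^2 \<Rightarrow> real. test_function \<Omega> \<phi> \<longrightarrow>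
        (LINT x|lebesgue_on \<Omega>. partial i \<phi> x *\<^sub>R u x) =
        - (LINT x|lebesgue_on \<Omega>. \<phi> x *\<^sub>R column i (D x)))"

definition H1 :: "(real^2) set \<Rightarrow> (real^2 \<Rightarrow> complex^2) set" where
  "H1 \<Omega> = {u. u \<in> L2 \<Omega> \<and> (\<exists>D. has_weak_jacobian \<Omega> u D)}"

definition weak_jacobian :: "(real^2) set \<Rightarrow> (real^2 \<Rightarrow> complex^2) \<Rightarrow> real^2 \<Rightarrow> complex^2^2" where
  "weak_jacobian \<Omega> u = (SOME D. has_weak_jacobian \<Omega> u D)"

text \<open>Square of the Sobolev-Slobodeckij norm of \<open>H\<^sup>1\<^sup>/\<^sup>2(I)\<close> for \<open>I \<subseteq> \<real>\<close>.\<close>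

definition H_half_sq :: "real set \<Rightarrow> (real \<Rightarrow> complex^2) \<Rightarrow> ennreal" where
  "H_half_sq I F =
     (\<integral>\<^sup>+r. ennreal ((norm (F r))\<^sup>2) \<partial>lebesgue_on I) +
     (\<integral>\<^sup>+r. (\<integral>\<^sup>+s. ennreal ((norm (F r - F s))\<^sup>2 / (r - s)\<^sup>2) \<partial>lebesgue_on I) \<partial>lebesgue_on I)"

definition H_half :: "real set \<Rightarrow> (real \<Rightarrow> complex^2) set" where
  "H_half I = {F. F \<in> borel_measurable (lebesgue_on I) \<and> H_half_sq I F < \<infinity>}"

definition zero_ext :: "real set \<Rightarrow> (real \<Rightarrow> complex^2) \<Rightarrow> real \<Rightarrow> complex^2" where
  "zero_ext I F r = indicator I r *\<^sub>R F r"

text \<open>A function \<open>G\<close> on \<open>I\<close> belongs to \<open>H\<^sup>-\<^sup>1\<^sup>/\<^sup>2(I)\<close> if integration against \<open>G\<close> is a bounded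
  functional on the space of those \<open>F\<close> whose extension by zero lies in \<open>H\<^sup>1\<^sup>/\<^sup>2(\<real>)\<close>. This is the
  space dual to the one in which the conormal derivative on a part of the boundary is tested.\<close>

definition H_minus_half :: "real set \<Rightarrow> (real \<Rightarrow> complex^2) set" where
  "H_minus_half I = {G. \<exists>C. \<forall>F. zero_ext I F \<in> H_half UNIV \<longrightarrow>
     integrable (lebesgue_on I) (\<lambda>r. scalar_product (G r) (F r)) \<and>
     norm (LINT r|lebesgue_on I. scalar_product (G r) (F r))
       \<le> C * sqrt (enn2real (H_half_sq UNIV (zero_ext I F)))}"


section \<open>The sector and function spaces on its sides\<close>

definition polar :: "real \<Rightarrow> real \<Rightarrow> real^2" where
  "polar \<theta> r = vector [r * cos \<theta>, r * sin \<theta>]"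

definition sector :: "real \<Rightarrow> real \<Rightarrow> real \<Rightarrow> (real^2) set" where
  "sector \<theta>m \<theta>M h = {polar \<theta> r |\<theta> r. \<theta>m < \<theta> \<and> \<theta> < \<theta>M \<and> 0 < r \<and> r < h}"

definition side :: "real \<Rightarrow> real \<Rightarrow> (real^2) set" where
  "side \<theta> h = {polar \<theta> r |r. 0 < r \<and> r < h}"

text \<open>For fixed \<open>\<theta>\<close>, \<open>polar \<theta>\<close> is the arclength parametrization of \<open>side \<theta> h\<close> by
  \<open>{0<..<h}\<close>; it is an isometry, so Sobolev and Hoelder classes, as well as boundary
  integrals, are those of the pulled-back function.\<close>

definition H_half_side :: "real \<Rightarrow> real \<Rightarrow> (real^2 \<Rightarrow> complex^2) set" where
  "H_half_side \<theta> h = {f. (\<lambda>r. f (polar \<theta> r)) \<in> H_half {0<..<h}}"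

definition H_minus_half_side :: "real \<Rightarrow> real \<Rightarrow> (real^2 \<Rightarrow> complex^2) set" where
  "H_minus_half_side \<theta> h = {g. (\<lambda>r. g (polar \<theta> r)) \<in> H_minus_half {0<..<h}}"

definition holder_on :: "real \<Rightarrow> 'a::metric_space set \<Rightarrow> ('a \<Rightarrow> 'b::metric_space) \<Rightarrow> bool" where
  "holder_on \<alpha> S f \<longleftrightarrow> (\<exists>C. \<forall>x\<in>S. \<forall>y\<in>S. dist (f x) (f y) \<le> C * dist x y powr \<alpha>)"

definition C_holder_side :: "real \<Rightarrow> real \<Rightarrow> real \<Rightarrow> (real^2 \<Rightarrow> complex^2) set" where
  "C_holder_side \<beta> \<theta> h = {g. holder_on \<beta> (side \<theta> h) g}"

definition C1_holder_side :: "real \<Rightarrow> real \<Rightarrow> real \<Rightarrow> (real^2 \<Rightarrow> complex^2) set" where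
  "C1_holder_side \<alpha> \<theta> h = {f. \<exists>F'.
     (\<forall>r\<in>{0<..<h}. ((\<lambda>r. f (polar \<theta> r)) has_vector_derivative F' r) (at r)) \<and>
     holder_on \<alpha> {0<..<h} F'}"

text \<open>Value at the vertex: limit along the side. It exists for functions in the two Hoelder
  classes above.\<close>

definition vertex_value :: "real \<Rightarrow> real \<Rightarrow> (real^2 \<Rightarrow> complex^2) \<Rightarrow> complex^2" where
  "vertex_value \<theta> h f = Lim (at 0 within side \<theta> h) f"

text \<open>\<open>A\<close> can serve as the gradient of \<open>f\<close> at the vertex:
  \<open>f(x) = f(0) + A x + O(\<bar>x\<bar>\<^sup>1\<^sup>+\<^sup>\<alpha>)\<close> along the side. The expansion determines \<open>A\<close> only in the
  direction of the side, hence a relation; \<open>\<nabla>f(0) = 0\<close> means that it holds with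
  \<open>A = 0\<close>.\<close>

definition has_vertex_gradient ::
    "real \<Rightarrow> real \<Rightarrow> real \<Rightarrow> (real^2 \<Rightarrow> complex^2) \<Rightarrow> complex^2^2 \<Rightarrow> bool" where
  "has_vertex_gradient \<alpha> \<theta> h f A \<longleftrightarrow>
     (\<lambda>x. norm (f x - vertex_value \<theta> h f - A *v (\<chi> i. complex_of_real (x $ i))))
       \<in> O[at 0 within side \<theta> h](\<lambda>x. norm x powr (1 + \<alpha>))"


section \<open>Trace and conormal derivative on a side\<close>

text \<open>The trace is the closure, in \<open>H\<^sup>1(\<Omega>) \<times> L\<^sup>2\<close> of the side, of the restriction map on
  functions that are smooth up to the boundary.\<close>

definition has_trace_on_side ::
    "(real^2) set \<Rightarrow> real \<Rightarrow> real \<Rightarrow> (real^2 \<Rightarrow> complex^2) \<Rightarrow> (real^2 \<Rightarrow> complex^2) \<Rightarrow> bool" where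
  "has_trace_on_side \<Omega> \<theta> h u f \<longleftrightarrow>
     u \<in> H1 \<Omega> \<and> (\<lambda>r. f (polar \<theta> r)) \<in> L2 {0<..<h} \<and>
     (\<exists>U. (\<forall>n::nat. smooth (U n)) \<and>
        (\<lambda>n. L2_sq \<Omega> (\<lambda>x. U n x - u x)) \<longlonglongrightarrow> 0 \<and>
        (\<lambda>n. L2_sq \<Omega> (\<lambda>x. jacobian (U n) x - weak_jacobian \<Omega> u x)) \<longlonglongrightarrow> 0 \<and>
        (\<lambda>n. L2_sq {0<..<h} (\<lambda>r. U n (polar \<theta> r) - f (polar \<theta> r))) \<longlonglongrightarrow> 0)"

text \<open>\<open>\<sigma>(u) = \<lambda>(\<nabla>\<cdot>u) I + \<mu>(\<nabla>u + \<nabla>u\<^sup>T)\<close>, so that \<open>\<T>\<^sub>\<nu>u = \<sigma>(u) \<nu>\<close> and \<open>\<L>u\<close> is the divergence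
  of \<open>\<sigma>(u)\<close>.\<close>

definition stress :: "real \<Rightarrow> real \<Rightarrow> complex^2^2 \<Rightarrow> complex^2^2" where
  "stress lam mu D = mat (complex_of_real lam * trace D) + mu *\<^sub>R (D + transpose D)"

definition contraction :: "complex^2^2 \<Rightarrow> complex^2^2 \<Rightarrow> complex" where
  "contraction A B = (\<Sum>k\<in>UNIV. \<Sum>i\<in>UNIV. A $ k $ i * B $ k $ i)"

text \<open>Weak traction. By Green's formula with exterior unit normal \<open>\<nu>\<close>,
  \<open>\<integral>\<^bsub>\<partial>\<Omega>\<^esub> \<T>\<^sub>\<nu>u \<cdot> \<phi> = \<integral>\<^bsub>\<Omega>\<^esub> \<sigma>(u) : \<nabla>\<phi> + \<integral>\<^bsub>\<Omega>\<^esub> \<L>u \<cdot> \<phi>\<close>; for \<open>u \<in> H\<^sup>1\<close> with \<open>\<L>u = 0\<close> the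
  first term on the right defines \<open>\<T>\<^sub>\<nu>u\<close>. On the part \<open>\<Gamma>\<close> of the boundary, \<open>\<phi>\<close> ranges over
  smooth functions vanishing near \<open>\<partial>\<Omega> - \<Gamma>\<close>.\<close>

definition traction :: "real \<Rightarrow> real \<Rightarrow> (real^2) set \<Rightarrow> (real^2 \<Rightarrow> complex^2) \<Rightarrow>
    (real^2 \<Rightarrow> complex^2) \<Rightarrow> complex" where
  "traction lam mu \<Omega> u \<phi> =
     (LINT x|lebesgue_on \<Omega>. contraction (stress lam mu (weak_jacobian \<Omega> u x)) (jacobian \<phi> x))"

definition boundary_test_function ::
    "(real^2) set \<Rightarrow> (real^2) set \<Rightarrow> (real^2 \<Rightarrow> complex^2) \<Rightarrow> bool" where
  "boundary_test_function \<Omega> \<Gamma> \<phi> \<longleftrightarrow> smooth \<phi> \<and> supp \<phi> \<inter> frontier \<Omega> \<subseteq> \<Gamma>"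

text \<open>Functionals on boundary test functions, and the functional given by a function \<open>g\<close> on a
  side; equality of distributions on the side.\<close>

definition side_pairing ::
    "real \<Rightarrow> real \<Rightarrow> (real^2 \<Rightarrow> complex^2) \<Rightarrow> (real^2 \<Rightarrow> complex^2) \<Rightarrow> complex" where
  "side_pairing \<theta> h g \<phi> =
     (LINT r|lebesgue_on {0<..<h}. scalar_product (g (polar \<theta> r)) (\<phi> (polar \<theta> r)))"

definition equal_on_side :: "(real^2) set \<Rightarrow> real \<Rightarrow> real \<Rightarrow>
    ((real^2 \<Rightarrow> complex^2) \<Rightarrow> complex) \<Rightarrow> ((real^2 \<Rightarrow> complex^2) \<Rightarrow> complex) \<Rightarrow> bool" where
  "equal_on_side \<Omega> \<theta> h S T \<longleftrightarrow>
     (\<forall>\<phi>. boundary_test_function \<Omega> (side \<theta> h) \<phi> \<longrightarrow> S \<phi> = T \<phi>)"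

end

theory Submission
  imports Defs "HOL-Computational_Algebra.Polynomial"
begin

text \<open>
  Let \<open>u = v - w\<close>, and let \<open>d\<close> be the direction of the bisector of the sector. For \<open>\<zeta> = d \<plusminus> i d\<^sup>\<bottom>\<close>,
  a complex vector with \<open>\<zeta> \<cdot> \<zeta> = 0\<close>, the fields
  \<open>exp(- s \<zeta> \<cdot> x) (a + c s (\<zeta>' \<cdot> x) \<zeta>)\<close>, \<open>\<zeta>'\<close> the conjugate of \<open>\<zeta>\<close>, solve the Lame system
  for \<open>(a, c) = (\<zeta>, 0)\<close> and for \<open>(a, c) = (\<zeta>', (\<lambda> + \<mu>) / (\<lambda> + 3 \<mu>))\<close>. They are entire and, because
  the opening angle is less than \<open>\<pi>\<close>, decay exponentially in the sector away from the vertex as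
  \<open>s \<rightarrow> \<infinity>\<close>. Inserting them into Green's second formula for \<open>u\<close> leaves, up to exponentially small
  terms, only integrals over the two sides, whose leading terms involve the vertex values alone.
  At order \<open>1\<close> the fields with \<open>c = 0\<close> give \<open>f\<^sub>+(0) \<cdot> \<zeta> = f\<^sub>-(0) \<cdot> \<zeta>\<close> for both \<open>\<zeta>\<close>. If the gradients
  vanish, subtract the constant \<open>f(0)\<close> from \<open>u\<close>; at order \<open>1/s\<close> the four fields give four linear
  equations for \<open>g\<^sub>+(0)\<close> and \<open>g\<^sub>-(0)\<close>. Their determinant is nonzero since
  \<open>(\<lambda> + \<mu>) / (\<lambda> + 3 \<mu>) < 1\<close>, so both values are zero, which is stronger than the claimed relation.
\<close>

section \<open>Smooth functions\<close>

text \<open>Two obstacles shape the argument. The weak traction may be tested only with functions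
  that vanish near the rest of the boundary, while the exponential fields do not vanish there. And
  the trace comes with a separate approximating sequence for each side, so integration by parts
  works near one side at a time. Hence each field is multiplied by two cutoffs, one per side, both
  away from the vertex and the arc. Each cutoff is steep across the sector, but their sum depends on
  the bisector coordinate alone, so the steep parts cancel when the two identities are added. What
  remains near the vertex is removed by a limit that uses only square integrability; what remains
  far from it decays faster than every power of s. On each side one is left with a Laplace integral
  whose variable has real part cos \<alpha>. Displacements enter with one power of s more than
  tractions. So they alone determine the leading order, and the traction values become visible only
  if f(x) - f(0) = o(|x|).\<close>

lemma C_k_continuous: "C_k n f \<Longrightarrow> continuous_on UNIV f"
  by (cases n) (auto simp: continuous_on_eq_continuous_within intro!: differentiable_imp_continuous_within)

lemma C_k_Suc_imp: "C_k (Suc n) f \<Longrightarrow> C_k n f"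
proof (induction n arbitrary: f)
  case 0
  then show ?case using C_k_continuous[of "Suc 0" f] by simp
next
  case (Suc n)
  then show ?case by (metis C_k.simps(2))
qed

lemma C_k_const: "C_k n (\<lambda>x. c)"
proof (induction n arbitrary: c)
  case (Suc n)
  have "frechet_derivative (\<lambda>x::'a. c) (at x) v = 0" for x v
    by (simp add: frechet_derivative_const)
  then show ?case using Suc by simp
qed simp

lemma frechet_derivative_eq: "(f has_derivative f') (at x) \<Longrightarrow> frechet_derivative f (at x) = f'"
  by (metis frechet_derivative_at)

lemma C_k_SucI:
  assumes "\<And>x. (f has_derivative f' x) (at x)" "\<And>v. C_k n (\<lambda>x. f' x v)"
  shows "C_k (Suc n) f"
  using assms by (auto simp: frechet_derivative_eq[OF assms(1)] differentiable_def)

lemma C_k_SucD: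
  assumes "C_k (Suc n) f"
  shows "(f has_derivative frechet_derivative f (at x)) (at x)"
    "C_k n (\<lambda>x. frechet_derivative f (at x) v)"
  using assms by (auto simp: frechet_derivative_works)

lemma C_k_add: "C_k n f \<Longrightarrow> C_k n g \<Longrightarrow> C_k n (\<lambda>x. f x + g x)"
proof (induction n arbitrary: f g)
  case 0
  then show ?case by (auto intro: continuous_intros)
next
  case (Suc n)
  show ?case
    by (rule C_k_SucI[OF has_derivative_add[OF C_k_SucD(1)[OF Suc.prems(1)] C_k_SucD(1)[OF Suc.prems(2)]]])
      (intro Suc.IH C_k_SucD(2) Suc.prems)
qed

lemma C_k_bounded_linear_comp: "bounded_linear T \<Longrightarrow> C_k n f \<Longrightarrow> C_k n (\<lambda>x. T (f x))"
proof (induction n arbitrary: f)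
  case 0
  then show ?case by (auto intro: bounded_linear.continuous_on)
next
  case (Suc n)
  show ?case
    by (rule C_k_SucI[OF bounded_linear.has_derivative[OF Suc.prems(1) C_k_SucD(1)[OF Suc.prems(2)]]])
      (intro Suc.IH C_k_SucD(2) Suc.prems)
qed

lemma C_k_linear:
  assumes "bounded_linear T"
  shows "C_k n T"
proof (cases n)
  case 0
  then show ?thesis using linear_continuous_on[OF assms] by simp
next
  case (Suc m)
  then show ?thesis
    using C_k_SucI[of T "\<lambda>_. T" m] bounded_linear_imp_has_derivative[OF assms] C_k_const by blast
qed

lemma C_k_bilinear:
  assumes b: "bounded_bilinear b"
  shows "C_k n f \<Longrightarrow> C_k n g \<Longrightarrow> C_k n (\<lambda>x. b (f x) (g x))"
proof (induction n arbitrary: f g)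
  case 0
  then show ?case by (auto intro: bounded_bilinear.continuous_on[OF b])
next
  case (Suc n)
  show ?case
    by (rule C_k_SucI[OF bounded_bilinear.FDERIV[OF b C_k_SucD(1)[OF Suc.prems(1)] C_k_SucD(1)[OF Suc.prems(2)]]])
      (intro C_k_add Suc.IH C_k_SucD(2) Suc.prems C_k_Suc_imp[OF Suc.prems(1)] C_k_Suc_imp[OF Suc.prems(2)])
qed

lemma C_k_inverse:
  fixes f :: "'a::real_normed_vector \<Rightarrow> real"
  shows "C_k n f \<Longrightarrow> (\<And>x. f x \<noteq> 0) \<Longrightarrow> C_k n (\<lambda>x. inverse (f x))"
proof (induction n arbitrary: f)
  case 0
  then show ?case by (auto intro: continuous_intros)
next
  case (Suc n)
  show ?case
  proof (rule C_k_SucI)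
    show "((\<lambda>x. inverse (f x)) has_derivative
      (\<lambda>h. (-1) * (inverse (f x) * (frechet_derivative f (at x) h * inverse (f x))))) (at x)" for x
      using Deriv.has_derivative_inverse[OF Suc.prems(2) C_k_SucD(1)[OF Suc.prems(1)], of x]
      by (simp add: mult.assoc)
    show "C_k n (\<lambda>x. (-1) * (inverse (f x) * (frechet_derivative f (at x) v * inverse (f x))))" for v
      by (intro C_k_bilinear[OF bounded_bilinear_mult] C_k_const Suc.IH C_k_SucD(2)
            C_k_Suc_imp[OF Suc.prems(1)] Suc.prems)
  qed
qed

text \<open>Only affine functionals are needed inside, because every cutoff depends on a single
  coordinate. The derivative of \<open>f (L x + c)\<close> in direction \<open>v\<close> is the
  constant \<open>L v\<close> times a function of the same kind, so the induction avoids a chain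
  rule of higher order.\<close>

lemma C_k_comp_linear:
  fixes f :: "real \<Rightarrow> 'b::real_normed_vector"
  assumes L: "bounded_linear L"
  shows "C_k n f \<Longrightarrow> C_k n (\<lambda>x. f (L x + c))"
proof (induction n arbitrary: f)
  case 0
  then show ?case
    by (auto intro!: continuous_on_compose2[of UNIV f UNIV] continuous_intros linear_continuous_on[OF L])
next
  case (Suc n)
  have D: "(f has_derivative (\<lambda>h. h *\<^sub>R frechet_derivative f (at x) 1)) (at x)" for x
  proof -
    have "f differentiable (at x)" using Suc.prems by simp
    then have lin: "linear (frechet_derivative f (at x))" by (rule linear_frechet_derivative)
    have "h *\<^sub>R frechet_derivative f (at x) 1 = frechet_derivative f (at x) h" for h
      using linear_scale[OF lin, of h 1, symmetric] by (simp only: real_scaleR_def mult_1_right)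
    then have eq: "(\<lambda>h. h *\<^sub>R frechet_derivative f (at x) 1) = frechet_derivative f (at x)"
      by (rule ext)
    show ?thesis unfolding eq by (rule C_k_SucD(1)[OF Suc.prems(1)])
  qed
  have DL: "((\<lambda>x. L x + c) has_derivative L) (at x)" for x
    using bounded_linear_imp_has_derivative[OF L] by (auto intro!: derivative_eq_intros)
  show ?case
  proof (rule C_k_SucI)
    show "((\<lambda>x. f (L x + c)) has_derivative (\<lambda>h. L h *\<^sub>R frechet_derivative f (at (L x + c)) 1)) (at x)" for x
      using has_derivative_compose[OF DL D] by simp
    show "C_k n (\<lambda>x. L v *\<^sub>R frechet_derivative f (at (L x + c)) 1)" for v
      by (rule C_k_bounded_linear_comp[OF bounded_linear_scaleR_right])
        (rule Suc.IH[OF C_k_SucD(2)[OF Suc.prems]])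
  qed
qed

text \<open>Differentiation in a fixed direction reproduces the exponential up to the constant
  factor \<open>L v\<close>, which closes the induction on the order.\<close>

lemma C_k_exp_linear:
  fixes L :: "'a::real_normed_vector \<Rightarrow> complex"
  assumes L: "bounded_linear L"
  shows "C_k n (\<lambda>x. exp (L x))"
proof (induction n)
  case 0
  then show ?case by (auto intro!: continuous_intros linear_continuous_on[OF L])
next
  case (Suc n)
  show ?case
  proof (rule C_k_SucI)
    show "((\<lambda>x. exp (L x)) has_derivative (\<lambda>h. L h * exp (L x))) (at x)" for x
      using has_derivative_compose[OF bounded_linear_imp_has_derivative[OF L]
          DERIV_exp[unfolded has_field_derivative_def]]
      by (simp add: mult.commute)
    show "C_k n (\<lambda>x. L v * exp (L x))" for v
      by (intro C_k_bilinear[OF bounded_bilinear_mult] C_k_const Suc.IH)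
  qed
qed

lemma C_k_vec:
  assumes "\<And>k. C_k n (\<lambda>x. f x $ k)"
  shows "C_k n (f :: 'a::real_normed_vector \<Rightarrow> complex^2)"
proof -
  have "bounded_linear (\<lambda>z::complex. axis k z :: complex^2)" for k
    by (rule linear_conv_bounded_linear[THEN iffD1])
      (auto intro!: linearI simp: axis_def vec_eq_iff)
  then have "C_k n (\<lambda>x. axis k (f x $ k) :: complex^2)" for k
    by (rule C_k_bounded_linear_comp[OF _ assms])
  from C_k_add[OF this[of 1] this[of 2]]
  have "C_k n (\<lambda>x. axis 1 (f x $ 1) + axis 2 (f x $ 2) :: complex^2)" .
  moreover have "axis 1 (f x $ 1) + axis 2 (f x $ 2) = f x" for x
    by (simp add: vec_eq_iff forall_2 axis_def)
  ultimately show ?thesis by simp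
qed

lemma smooth_const: "smooth (\<lambda>x. c)" by (simp add: smooth_def C_k_const)
lemma smooth_add: "smooth f \<Longrightarrow> smooth g \<Longrightarrow> smooth (\<lambda>x. f x + g x)" by (simp add: smooth_def C_k_add)
lemma smooth_bounded_linear_comp: "bounded_linear T \<Longrightarrow> smooth f \<Longrightarrow> smooth (\<lambda>x. T (f x))"
  by (simp add: smooth_def C_k_bounded_linear_comp)
lemma smooth_linear: "bounded_linear T \<Longrightarrow> smooth T" by (simp add: smooth_def C_k_linear)
lemma smooth_mult: "smooth f \<Longrightarrow> smooth g \<Longrightarrow> smooth (\<lambda>x. f x * g x :: 'b::real_normed_algebra)"
  by (simp add: smooth_def C_k_bilinear bounded_bilinear_mult)
lemma smooth_scaleR: "smooth f \<Longrightarrow> smooth g \<Longrightarrow> smooth (\<lambda>x. f x *\<^sub>R g x)"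
  by (simp add: smooth_def C_k_bilinear bounded_bilinear_scaleR)
lemma smooth_comp_linear:
  "smooth f \<Longrightarrow> bounded_linear L \<Longrightarrow> smooth (\<lambda>x. f (L x + c))" for f :: "real \<Rightarrow> _"
  by (simp add: smooth_def C_k_comp_linear)
lemma smooth_exp_linear: "bounded_linear L \<Longrightarrow> smooth (\<lambda>x. exp (L x :: complex))"
  by (simp add: smooth_def C_k_exp_linear)
lemma smooth_vec: "(\<And>k. smooth (\<lambda>x. f x $ k)) \<Longrightarrow> smooth (f :: _ \<Rightarrow> complex^2)"
  by (simp add: smooth_def C_k_vec)
lemma smooth_continuous: "smooth f \<Longrightarrow> continuous_on UNIV f"
  using C_k_continuous smooth_def by blast
lemma smooth_has_derivative: "smooth f \<Longrightarrow> (f has_derivative frechet_derivative f (at x)) (at x)"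
  using C_k_SucD(1) smooth_def by blast
lemma smooth_frechet: "smooth f \<Longrightarrow> smooth (\<lambda>x. frechet_derivative f (at x) v)"
  using C_k_SucD(2) smooth_def by blast

section \<open>Cutoff functions\<close>

text \<open>The polynomial factor makes the family closed under differentiation, so smoothness of
  exp (-1/t), extended by zero, is an induction on the order with \<open>p\<close>
  arbitrary.\<close>

definition exp_recip :: "real poly \<Rightarrow> real \<Rightarrow> real" where
  "exp_recip p t = (if t > 0 then poly p (1 / t) * exp (- (1 / t)) else 0)"

lemma poly_times_exp_minus_tendsto_0: "((\<lambda>y::real. poly p y * exp (- y)) \<longlongrightarrow> 0) at_top"
proof -
  have "((\<lambda>y::real. \<Sum>i\<le>degree p. coeff p i * (y ^ i / exp y)) \<longlongrightarrow> (\<Sum>i\<le>degree p. coeff p i * 0)) at_top"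
    by (intro tendsto_intros tendsto_power_div_exp_0)
  moreover have "(\<Sum>i\<le>degree p. coeff p i * (y ^ i / exp y)) = poly p y * exp (- y)" for y :: real
    by (simp add: poly_altdef sum_distrib_right exp_minus divide_inverse mult.assoc)
  ultimately show ?thesis by simp
qed

text \<open>With y = 1/t, d/dt is -y^2 d/dy, which turns p(y) exp (-y) into y^2 (p - p')(y) exp
  (-y). At 0 the difference quotient is again of this form and tends to 0.\<close>

lemma exp_recip_has_derivative:
  "(exp_recip p has_field_derivative exp_recip ([:0, 0, 1:] * (p - pderiv p)) t) (at t)"
proof -
  consider "t > 0" | "t < 0" | "t = 0" by linarith
  then show ?thesis
  proof cases
    case 1
    have "((\<lambda>t. poly p (1 / t) * exp (- (1 / t))) has_field_derivative
        exp_recip ([:0, 0, 1:] * (p - pderiv p)) t) (at t)"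
      using 1 by (auto intro!: derivative_eq_intros DERIV_chain2[OF poly_DERIV]
          simp: exp_recip_def field_simps power2_eq_square)
    moreover have "eventually (\<lambda>s. s \<in> {0<..}) (nhds t)"
      using 1 by (intro eventually_nhds_in_open) auto
    ultimately show ?thesis
      by (subst DERIV_cong_ev[OF refl _ refl, of _ "\<lambda>t. poly p (1 / t) * exp (- (1 / t))"])
        (auto elim!: eventually_mono simp: exp_recip_def)
  next
    case 2
    have "eventually (\<lambda>s. s \<in> {..<0}) (nhds t)"
      using 2 by (intro eventually_nhds_in_open) auto
    then show ?thesis using 2
      by (subst DERIV_cong_ev[OF refl _ refl, of _ "\<lambda>t. 0"])
        (auto elim!: eventually_mono simp: exp_recip_def)
  next
    case 3
    have "((\<lambda>h. exp_recip p h / h) \<longlongrightarrow> 0) (at_right 0)"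
    proof -
      \<comment> \<open>Division by \<open>h\<close> multiplies the polynomial by its variable,
        hence \<open>pCons 0 p\<close>.\<close>
      have "((\<lambda>h. poly (pCons 0 p) (inverse h) * exp (- inverse h)) \<longlongrightarrow> 0) (at_right (0::real))"
        by (rule filterlim_compose[OF poly_times_exp_minus_tendsto_0 filterlim_inverse_at_top_right])
      then show ?thesis
        by (rule Lim_transform_eventually)
          (auto simp: eventually_at_filter exp_recip_def field_simps)
    qed
    moreover have "((\<lambda>h. exp_recip p h / h) \<longlongrightarrow> 0) (at_left 0)"
      by (rule Lim_transform_eventually[OF tendsto_const])
        (auto simp: eventually_at_filter exp_recip_def)
    ultimately have "((\<lambda>h. exp_recip p h / h) \<longlongrightarrow> 0) (at 0)"
      by (simp add: filterlim_split_at)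
    then show ?thesis using 3 by (simp add: DERIV_def exp_recip_def)
  qed
qed

lemma smooth_exp_recip: "smooth (exp_recip p)"
proof -
  have "C_k n (exp_recip p)" for n
  proof (induction n arbitrary: p)
    case 0
    show ?case
      by (auto intro!: DERIV_continuous_on exp_recip_has_derivative[THEN DERIV_subset])
  next
    case (Suc n)
    show ?case
    proof (rule C_k_SucI)
      show "(exp_recip p has_derivative (*) (exp_recip ([:0, 0, 1:] * (p - pderiv p)) t)) (at t)" for t
        using exp_recip_has_derivative[of p t] by (simp add: has_field_derivative_def)
      show "C_k n (\<lambda>t. exp_recip ([:0, 0, 1:] * (p - pderiv p)) t * v)" for v
        by (rule C_k_bilinear[OF bounded_bilinear_mult Suc.IH C_k_const])
    qed
  qed
  then show ?thesis by (simp add: smooth_def)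
qed

text \<open>The symmetric quotient is chosen for \<open>step (1 - t) = 1 - step t\<close>, on which
  the splitting of a cutoff between the two sides rests.\<close>

definition step :: "real \<Rightarrow> real" where
  "step t = exp_recip 1 t / (exp_recip 1 t + exp_recip 1 (1 - t))"

lemma exp_recip_1: "exp_recip 1 t = (if t > 0 then exp (- (1 / t)) else 0)"
  by (simp add: exp_recip_def)

lemma step_denominator_pos: "exp_recip 1 t + exp_recip 1 (1 - t) > 0"
  by (auto simp: exp_recip_1 intro: add_pos_pos)

lemma step_eq_0: "t \<le> 0 \<Longrightarrow> step t = 0" and step_eq_1: "t \<ge> 1 \<Longrightarrow> step t = 1"
  and step_nonneg: "0 \<le> step t" and step_le_1: "step t \<le> 1"
  using step_denominator_pos[of t] by (auto simp: step_def exp_recip_1)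

lemma smooth_step: "smooth step"
proof -
  have 1: "smooth (\<lambda>t. exp_recip 1 (- t + 1))"
    by (intro smooth_comp_linear smooth_exp_recip bounded_linear_minus bounded_linear_ident)
  have "smooth (\<lambda>t. exp_recip 1 t * inverse (exp_recip 1 t + exp_recip 1 (- t + 1)))"
    unfolding smooth_def
  proof (intro allI C_k_bilinear[OF bounded_bilinear_mult] C_k_inverse C_k_add)
    fix n
    show "C_k n (exp_recip 1)" "C_k n (exp_recip 1)" "C_k n (\<lambda>t. exp_recip 1 (- t + 1))"
      using 1 smooth_exp_recip by (auto simp: smooth_def)
    show "exp_recip 1 t + exp_recip 1 (- t + 1) \<noteq> 0" for t
      using step_denominator_pos[of t] by simp
  qed
  moreover have "step = (\<lambda>t. exp_recip 1 t * inverse (exp_recip 1 t + exp_recip 1 (- t + 1)))"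
    by (simp add: step_def fun_eq_iff divide_inverse)
  ultimately show ?thesis by simp
qed

definition step' :: "real \<Rightarrow> real" where
  "step' t = frechet_derivative step (at t) 1"

lemma smooth_real_DERIV:
  fixes f :: "real \<Rightarrow> real"
  assumes "smooth f"
  shows "(f has_field_derivative frechet_derivative f (at t) 1) (at t)"
proof -
  have d: "(f has_derivative frechet_derivative f (at t)) (at t)"
    by (rule smooth_has_derivative[OF assms])
  then obtain c where "frechet_derivative f (at t) = (\<lambda>x. x * c)"
    using real_bounded_linear[THEN iffD1, OF has_derivative_bounded_linear[OF d]] by blast
  then show ?thesis using d by (simp add: has_field_derivative_def mult_commute_abs)
qed

lemma step_DERIV: "(step has_field_derivative step' t) (at t)"
  unfolding step'_def by (rule smooth_real_DERIV[OF smooth_step])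

lemma smooth_step': "smooth step'"
  unfolding step'_def[abs_def] by (rule smooth_frechet[OF smooth_step])

lemma step'_eq_0:
  assumes "t < 0 \<or> t > 1"
  shows "step' t = 0"
proof -
  have "eventually (\<lambda>s. s \<in> (if t < 0 then {..<0} else {1<..})) (nhds t)"
    using assms by (intro eventually_nhds_in_open) auto
  then have "eventually (\<lambda>s. step s = (if t < 0 then 0 else 1)) (nhds t)"
    by (rule eventually_mono) (auto split: if_splits simp: step_eq_0 step_eq_1)
  then have "(step has_field_derivative 0) (at t)"
    by (subst DERIV_cong_ev[OF refl _ refl]) auto
  then show ?thesis using step_DERIV DERIV_unique by blast
qed

lemma step'_bounded: obtains B where "B > 0" "\<And>t. \<bar>step' t\<bar> \<le> B"
proof -
  have "compact (step' ` {0..1})"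
    by (intro compact_continuous_image continuous_on_subset[OF smooth_continuous[OF smooth_step']]) auto
  from compact_imp_bounded[OF this] obtain B where B: "\<And>t. t \<in> {0..1} \<Longrightarrow> \<bar>step' t\<bar> \<le> B" "B > 0"
    unfolding bounded_pos by force
  have "\<bar>step' t\<bar> \<le> B" for t
    using B step'_eq_0[of t] by (cases "t \<in> {0..1}") auto
  then show ?thesis using that B by blast
qed

section \<open>The divergence theorem near one side\<close>

text \<open>The direction of the side turned by a right angle, counterclockwise for \<sigma> = 1 and
  clockwise for \<sigma> = -1. Thus \<sigma> = 1 gives the exterior normal on the upper side of a
  sector and \<sigma> = -1 on the lower one.\<close>

definition side_normal :: "real \<Rightarrow> real \<Rightarrow> real^2" where
  "side_normal \<sigma> \<theta> = vector [- \<sigma> * sin \<theta>, \<sigma> * cos \<theta>]"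

section \<open>Plane integrals in coordinates adapted to a side\<close>

lemma vector_2_nth: "(vector [a, b] :: 'a::zero^2) $ i = (if i = 1 then a else b)"
  using exhaust_2[of i] by auto

lemma inner_real_2: "(x :: real^2) \<bullet> y = x $ 1 * y $ 1 + x $ 2 * y $ 2"
  by (simp add: inner_vec_def sum_2)

lemma continuous_on_vector_2:
  fixes f g :: "'a::topological_space \<Rightarrow> 'b::{zero,topological_space}"
  assumes "continuous_on S f" "continuous_on S g"
  shows "continuous_on S (\<lambda>x. vector [f x, g x] :: 'b^2)"
proof -
  have "continuous_on S (\<lambda>x. \<chi> i::2. if i = 1 then f x else g x)"
  proof (rule continuous_on_vec_lambda)
    show "continuous_on S (\<lambda>x. if i = 1 then f x else g x)" for i :: 2
      using assms by (cases "i = 1") auto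
  qed
  moreover have "(vector [f x, g x] :: 'b^2) = (\<chi> i. if i = 1 then f x else g x)" for x
    by (simp add: vec_eq_iff vector_2_nth)
  ultimately show ?thesis by simp
qed

text \<open>Transfers plane integrals to the product measure, where Fubini is available.\<close>

lemma distr_lborel_vector_2:
  "distr (lborel :: (real \<times> real) measure) borel (\<lambda>(x, y). vector [x, y] :: real^2) = lborel"
proof (rule lborel_eqI[symmetric])
  have cont: "continuous_on UNIV (\<lambda>(x, y). vector [x, y] :: real^2)"
    unfolding split_beta by (intro continuous_on_vector_2 continuous_intros)
  then have m: "(\<lambda>(x, y). vector [x, y] :: real^2) \<in> borel_measurable lborel"
    by (simp add: borel_measurable_continuous_onI)
  fix l u :: "real^2" assume le: "\<And>b. b \<in> Basis \<Longrightarrow> l \<bullet> b \<le> u \<bullet> b"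
  then have le': "l $ i \<le> u $ i" for i
    by (metis axis_in_Basis_iff cart_eq_inner_axis Basis_real_def insertI1)
  have "(\<lambda>(x, y). vector [x, y] :: real^2) -` box l u = box (l $ 1, l $ 2) (u $ 1, u $ 2)"
  proof -
    have "(vector [a, b] :: real^2) \<in> box l u \<longleftrightarrow> (a, b) \<in> box (l $ 1, l $ 2) (u $ 1, u $ 2)" for a b
      unfolding mem_box_cart by (simp add: mem_box Basis_prod_def vector_2_nth forall_2 ball_Un conj_ac)
    then show ?thesis by auto
  qed
  then have "emeasure (distr lborel borel (\<lambda>(x, y). vector [x, y] :: real^2)) (box l u) =
      emeasure lborel (box (l $ 1, l $ 2) (u $ 1, u $ 2))"
    using m by (subst emeasure_distr) auto
  also have "\<dots> = ennreal ((u $ 1 - l $ 1) * (u $ 2 - l $ 2))"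
  proof -
    have B: "(Basis :: (real \<times> real) set) = {(1, 0), (0, 1)}" by (auto simp: Basis_prod_def)
    have "emeasure lborel (box (l $ 1, l $ 2) (u $ 1, u $ 2)) =
        (\<Prod>b\<in>Basis. ((u $ 1, u $ 2) - (l $ 1, l $ 2)) \<bullet> b)"
      by (rule emeasure_lborel_box) (use le' in \<open>auto simp: B\<close>)
    then show ?thesis by (simp add: B)
  qed
  also have "(u $ 1 - l $ 1) * (u $ 2 - l $ 2) = (\<Prod>b\<in>Basis. (u - l) \<bullet> b)"
  proof -
    have "(\<Prod>b\<in>Basis. (u - l) \<bullet> b) = (\<Prod>i\<in>UNIV. (u - l) $ i)"
      by (rule prod.reindex_bij_witness[of _ "\<lambda>i. axis i 1" axis_index])
        (auto simp: axis_index[symmetric] cart_eq_inner_axis)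
    then show ?thesis by (simp add: prod_2 UNIV_2)
  qed
  finally show "emeasure (distr lborel borel (\<lambda>(x, y). vector [x, y] :: real^2)) (box l u) =
     (\<Prod>b\<in>Basis. (u - l) \<bullet> b)" .
qed simp

lemma distr_lborel_orthogonal:
  fixes f :: "real^'n::{finite,wellorder} \<Rightarrow> real^'n::_"
  assumes f: "orthogonal_transformation f"
  shows "distr lborel borel f = lborel"
proof (rule lborel_eqI[symmetric])
  note bij = orthogonal_transformation_bij[OF f]
  have m: "f \<in> borel_measurable lborel"
    using orthogonal_transformation_linear[OF f]
    by (simp add: borel_measurable_continuous_onI linear_continuous_on linear_conv_bounded_linear)
  fix l u :: "real^'n::_" assume le: "\<And>b. b \<in> Basis \<Longrightarrow> l \<bullet> b \<le> u \<bullet> b"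
  note inv = orthogonal_transformation_inv[OF f]
  have eq: "f -` box l u = inv f ` box l u" by (simp add: bij_vimage_eq_inv_image bij)
  have "f -` box l u \<in> sets lborel"
    using measurable_sets[OF m, of "box l u"] by simp
  moreover have lm: "f -` box l u \<in> lmeasurable"
    unfolding eq by (rule measurable_orthogonal_image[OF inv]) simp
  ultimately have "emeasure lborel (f -` box l u) = measure lebesgue (f -` box l u)"
    using emeasure_eq_measure2[OF lm] by simp
  also have "\<dots> = measure lborel (box l u)"
    unfolding eq by (simp add: measure_orthogonal_image[OF inv])
  also have "\<dots> = (\<Prod>b\<in>Basis. (u - l) \<bullet> b)" using le by simp
  finally show "emeasure (distr lborel borel f) (box l u) = (\<Prod>b\<in>Basis. (u - l) \<bullet> b)"
    using m by (simp add: emeasure_distr)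
qed simp

text \<open>Side direction and normal form an orthonormal basis of either orientation; orthogonal
  maps preserve Lebesgue measure in both cases.\<close>

lemma distr_lborel_frame:
  assumes \<sigma>: "\<sigma>\<^sup>2 = 1"
  shows "distr (lborel :: (real \<times> real) measure) borel (\<lambda>(r, t). polar \<theta> r + t *\<^sub>R side_normal \<sigma> \<theta>) = lborel"
proof -
  define f where "f x = polar \<theta> (x $ 1) + x $ 2 *\<^sub>R side_normal \<sigma> \<theta>" for x :: "real^2"
  have lin: "linear f"
    by (intro linearI) (auto simp: f_def polar_def side_normal_def vec_eq_iff vector_2_nth algebra_simps)
  have "f v \<bullet> f w = v \<bullet> w" for v w
  proof -
    have "f v \<bullet> f w = ((sin \<theta>)\<^sup>2 + (cos \<theta>)\<^sup>2) * (v $ 1 * w $ 1) + \<sigma>\<^sup>2 * ((sin \<theta>)\<^sup>2 + (cos \<theta>)\<^sup>2) * (v $ 2 * w $ 2)"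
      unfolding f_def polar_def side_normal_def inner_real_2
      by (simp add: vector_2_nth power2_eq_square algebra_simps del: sin_cos_squared_add3)
    then show ?thesis by (simp add: inner_real_2 \<sigma>)
  qed
  then have f: "orthogonal_transformation f"
    using lin by (simp add: orthogonal_transformation_def)
  have cont: "continuous_on UNIV (\<lambda>(x, y). vector [x, y] :: real^2)"
    unfolding split_beta by (intro continuous_on_vector_2 continuous_intros)
  have contf: "continuous_on UNIV f"
    using lin by (simp add: linear_continuous_on linear_conv_bounded_linear)
  have eq: "(\<lambda>(r, t). polar \<theta> r + t *\<^sub>R side_normal \<sigma> \<theta>) = f \<circ> (\<lambda>(x, y). vector [x, y])"
    by (auto simp: f_def fun_eq_iff)
  have "distr (lborel :: (real \<times> real) measure) borel (\<lambda>(r, t). polar \<theta> r + t *\<^sub>R side_normal \<sigma> \<theta>) =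
    distr (distr lborel borel (\<lambda>(x, y). vector [x, y])) borel f"
    unfolding eq
    by (subst distr_distr) (use cont contf in \<open>auto simp: borel_measurable_continuous_onI\<close>)
  also have "\<dots> = lborel" by (simp add: distr_lborel_vector_2 distr_lborel_orthogonal[OF f])
  finally show ?thesis .
qed

lemma linear_scaled_sum_2:
  fixes D :: "real^2 \<Rightarrow> 'b::real_vector"
  assumes "linear D" "v = a *\<^sub>R x + b *\<^sub>R y"
  shows "D v = a *\<^sub>R D x + b *\<^sub>R D y"
  using assms by (simp add: linear_add linear_scale)

text \<open>\<open>K\<close> is where test functions may be nonzero. Within \<open>K\<close>, the
  domain coincides with the half plane behind the side, and the boundary line of that half plane
  lies in the open side. So boundary computations can be carried out on a half plane.\<close>

locale side_neighborhood =
  fixes \<Omega> K :: "(real^2) set" and \<theta> \<sigma> h :: real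
  assumes \<sigma>: "\<sigma>\<^sup>2 = 1"
    and open_\<Omega>: "open \<Omega>" and bounded_\<Omega>: "bounded \<Omega>"
    and \<Omega>_subset: "\<Omega> \<subseteq> {x. x \<bullet> side_normal \<sigma> \<theta> < 0}"
    and closed_K: "closed K"
    and K_inside: "K \<inter> {x. x \<bullet> side_normal \<sigma> \<theta> < 0} \<subseteq> \<Omega>"
    and K_boundary: "K \<inter> {x. x \<bullet> side_normal \<sigma> \<theta> = 0} \<subseteq> side \<theta> h"
begin

text \<open>A frontier point in \<open>K\<close> cannot lie strictly inside the half plane, as it
  would then belong to the open set \<open>\<Omega>\<close>. This makes smooth functions vanishing
  off \<open>K\<close> admissible in the weak traction.\<close>

lemma supp_inter_frontier:
  assumes "\<And>x. x \<notin> K \<Longrightarrow> \<phi> x = 0"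
  shows "supp \<phi> \<inter> frontier \<Omega> \<subseteq> side \<theta> h"
proof
  fix x assume x: "x \<in> supp \<phi> \<inter> frontier \<Omega>"
  have "supp \<phi> \<subseteq> K" unfolding supp_def
    by (rule closure_minimal) (use assms closed_K in auto)
  then have "x \<in> K" using x by auto
  have "x \<in> closure \<Omega>" "x \<notin> \<Omega>" using x open_\<Omega> by (auto simp: frontier_def interior_open)
  have "closure \<Omega> \<subseteq> {x. x \<bullet> side_normal \<sigma> \<theta> \<le> 0}"
    using \<Omega>_subset by (intro closure_minimal closed_Collect_le continuous_intros) auto
  then have "x \<bullet> side_normal \<sigma> \<theta> \<le> 0" using \<open>x \<in> closure \<Omega>\<close> by auto
  moreover have "\<not> x \<bullet> side_normal \<sigma> \<theta> < 0"
    using \<open>x \<in> K\<close> \<open>x \<notin> \<Omega>\<close> K_inside by auto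
  ultimately show "x \<in> side \<theta> h" using \<open>x \<in> K\<close> K_boundary by auto
qed

lemma frame_inner_normal:
  "(polar \<theta> r + t *\<^sub>R side_normal \<sigma> \<theta>) \<bullet> side_normal \<sigma> \<theta> = t"
proof -
  have "(polar \<theta> r + t *\<^sub>R side_normal \<sigma> \<theta>) \<bullet> side_normal \<sigma> \<theta> = t * (\<sigma>\<^sup>2 * ((sin \<theta>)\<^sup>2 + (cos \<theta>)\<^sup>2))"
    unfolding inner_real_2 polar_def side_normal_def
    by (simp add: vector_2_nth power2_eq_square algebra_simps del: sin_cos_squared_add3)
  then show ?thesis by (simp add: \<sigma>)
qed

lemma norm_frame: "(norm (polar \<theta> r + t *\<^sub>R side_normal \<sigma> \<theta>))\<^sup>2 = r\<^sup>2 + t\<^sup>2"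
proof -
  have "(norm (polar \<theta> r + t *\<^sub>R side_normal \<sigma> \<theta>))\<^sup>2 =
      ((sin \<theta>)\<^sup>2 + (cos \<theta>)\<^sup>2) * r\<^sup>2 + t\<^sup>2 * (\<sigma>\<^sup>2 * ((sin \<theta>)\<^sup>2 + (cos \<theta>)\<^sup>2))"
    unfolding power2_norm_eq_inner inner_real_2 polar_def side_normal_def
    by (simp add: vector_2_nth power2_eq_square algebra_simps del: sin_cos_squared_add3)
  then show ?thesis by (simp add: \<sigma>)
qed

text \<open>Because \<open>F\<close> vanishes off \<open>K\<close>, the integral over
  \<open>\<Omega>\<close> equals that over the half plane. There Fubini in the rotated frame
  applies: the tangential derivative integrates to zero along each line and the normal derivative to
  the boundary value, so only the normal component of \<open>axis i 1\<close> counts.\<close>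

lemma divergence_theorem:
  fixes F :: "real^2 \<Rightarrow> complex"
  assumes F: "smooth F" and F0: "\<And>x. x \<notin> K \<Longrightarrow> F x = 0"
  shows "(LINT x|lebesgue_on \<Omega>. partial i F x) =
    side_normal \<sigma> \<theta> $ i *\<^sub>R (LINT r|lebesgue_on {0<..<h}. F (polar \<theta> r))"
proof -
  let ?\<nu> = "side_normal \<sigma> \<theta>" and ?\<tau> = "polar \<theta> 1"
  define D where "D v x = frechet_derivative F (at x) v" for v x
  define fr where "fr r t = polar \<theta> r + t *\<^sub>R ?\<nu>" for r t
  define H where "H = {x. x \<bullet> ?\<nu> < 0}"
  have openH: "open H" unfolding H_def by (intro open_Collect_less continuous_intros)
  have DF: "(F has_derivative (\<lambda>v. D v x)) (at x)" for x
    unfolding D_def using smooth_has_derivative[OF F] by simp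
  have contD: "continuous_on UNIV (D v)" for v
    unfolding D_def[abs_def] by (intro smooth_continuous smooth_frechet F)
  \<comment> \<open>The complement of the closed \<open>K\<close> is open, so \<open>F\<close>
    vanishes in a whole neighborhood of such a point, and so does its derivative.\<close>
  have D0: "D v x = 0" if "x \<in> H - \<Omega>" for x v
  proof -
    have "eventually (\<lambda>y. y \<in> - K) (nhds x)"
      using that K_inside closed_K by (intro eventually_nhds_in_open) (auto simp: H_def)
    then have ev: "eventually (\<lambda>y. F y = 0) (nhds x)" by (rule eventually_mono) (simp add: F0)
    have "(F has_derivative (\<lambda>_. 0)) (at x)"
    proof (rule has_derivative_transform_eventually[of "\<lambda>_. 0"])
      show "eventually (\<lambda>y. 0 = F y) (at x)"
        unfolding eventually_at_filter using ev by (rule eventually_mono) simp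
      show "0 = F x" using eventually_nhds_x_imp_x[OF ev] by simp
    qed auto
    from has_derivative_unique[OF DF this] show ?thesis by (rule fun_cong)
  qed
  obtain L where L: "L > 0" "\<And>x. x \<in> \<Omega> \<Longrightarrow> norm x < L"
    using bounded_\<Omega> unfolding bounded_pos_less by auto
  \<comment> \<open>Fubini uses the cutoff by the half plane; by \<open>D0\<close> it agrees with
    the cutoff by the bounded set \<open>\<Omega>\<close>, which gives integrability.\<close>
  define g where "g v x = indicator H x *\<^sub>R D v x" for v x
  have g_eq: "g v x = indicator \<Omega> x *\<^sub>R D v x" for v x
    using D0[of x v] \<Omega>_subset by (auto simp: g_def H_def split: split_indicator)
  have fr_H: "fr r t \<in> H \<longleftrightarrow> t < 0" for r t
    by (simp add: H_def fr_def frame_inner_normal)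
  have fr_\<Omega>: "\<bar>r\<bar> < L \<and> \<bar>t\<bar> < L" if "fr r t \<in> \<Omega>" for r t
  proof -
    have "r\<^sup>2 + t\<^sup>2 < L\<^sup>2"
      using L(2)[OF that] L(1) norm_frame[of r t] by (metis fr_def norm_ge_zero power_strict_mono zero_less_numeral)
    then have "r\<^sup>2 < L\<^sup>2 \<and> t\<^sup>2 < L\<^sup>2" by (smt (verit) zero_le_power2)
    then show ?thesis using L(1) by (metis abs_square_less_1 abs_le_square_iff abs_of_pos not_le)
  qed
  have F0': "F (fr r t) = 0" if "t < 0" "\<bar>r\<bar> \<ge> L \<or> \<bar>t\<bar> \<ge> L" for r t
  proof -
    have "fr r t \<notin> \<Omega>" using fr_\<Omega>[of r t] that by auto
    then show ?thesis using F0 K_inside that(1) fr_H[of r t] by (auto simp: H_def)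
  qed
  have int_g: "integrable lborel (g v)" for v
  proof -
    have "integrable lborel (\<lambda>x. indicator \<Omega> x *\<^sub>R (indicator (cball 0 L) x *\<^sub>R D v x))"
      by (rule integrable_mult_indicator[OF _ borel_integrable_compact])
        (use open_\<Omega> continuous_on_subset[OF contD] in auto)
    moreover have "indicator \<Omega> x *\<^sub>R (indicator (cball 0 L) x *\<^sub>R D v x) = g v x" for x
      using L(2)[of x] by (auto simp: g_eq split: split_indicator)
    ultimately show ?thesis by simp
  qed
  have meas_fr: "(\<lambda>(r, t). fr r t) \<in> borel_measurable (lborel :: (real \<times> real) measure)"
  proof -
    have "continuous_on UNIV (\<lambda>(r, t). fr r t)"
      unfolding fr_def polar_def split_beta by (intro continuous_on_vector_2 continuous_intros)
    then show ?thesis by (simp add: borel_measurable_continuous_onI)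
  qed
  have fubini: "integrable (lborel \<Otimes>\<^sub>M lborel) (\<lambda>(r, t). g v (fr r t))"
      "integral\<^sup>L lborel (g v) = integral\<^sup>L (lborel \<Otimes>\<^sub>M lborel) (\<lambda>(r, t). g v (fr r t))" for v
  proof -
    have "g v \<in> borel_measurable borel" using int_g[of v] by (simp add: integrable_iff_bounded)
    note * = this meas_fr distr_lborel_frame[OF \<sigma>, of \<theta>, folded fr_def]
    show "integrable (lborel \<Otimes>\<^sub>M lborel) (\<lambda>(r, t). g v (fr r t))"
      using int_g[of v] integrable_distr_eq[OF *(2), of "g v"] *
      by (simp add: lborel_prod case_prod_unfold)
    show "integral\<^sup>L lborel (g v) = integral\<^sup>L (lborel \<Otimes>\<^sub>M lborel) (\<lambda>(r, t). g v (fr r t))"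
      using integral_distr[OF *(2), of "g v"] * by (simp add: lborel_prod case_prod_unfold)
  qed
  have fr_der: "((\<lambda>r. fr r t) has_derivative (\<lambda>s. s *\<^sub>R ?\<tau>)) (at r)"
     "((\<lambda>t. fr r t) has_derivative (\<lambda>s. s *\<^sub>R ?\<nu>)) (at t)" for r t
  proof -
    have "fr r t = r *\<^sub>R ?\<tau> + t *\<^sub>R ?\<nu>" for r t
      by (simp add: fr_def polar_def vec_eq_iff vector_2_nth)
    then show "((\<lambda>r. fr r t) has_derivative (\<lambda>s. s *\<^sub>R ?\<tau>)) (at r)"
     "((\<lambda>t. fr r t) has_derivative (\<lambda>s. s *\<^sub>R ?\<nu>)) (at t)"
      by (auto intro!: derivative_eq_intros)
  qed
  have linD: "linear (\<lambda>v. D v x)" for x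
    using has_derivative_linear[OF DF] .
  have vd: "((\<lambda>r. F (fr r t)) has_vector_derivative D ?\<tau> (fr r t)) (at r within S)"
     "((\<lambda>t. F (fr r t)) has_vector_derivative D ?\<nu> (fr r t)) (at t within S)" for r t S
  proof -
    have "((\<lambda>r. F (fr r t)) has_derivative (\<lambda>s. s *\<^sub>R D ?\<tau> (fr r t))) (at r)"
         "((\<lambda>t. F (fr r t)) has_derivative (\<lambda>s. s *\<^sub>R D ?\<nu> (fr r t))) (at t)"
      using has_derivative_compose[OF fr_der(1) DF] has_derivative_compose[OF fr_der(2) DF]
      by (simp_all only: linear_scale[OF linD])
    then show "((\<lambda>r. F (fr r t)) has_vector_derivative D ?\<tau> (fr r t)) (at r within S)"
         "((\<lambda>t. F (fr r t)) has_vector_derivative D ?\<nu> (fr r t)) (at t within S)"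
      unfolding has_vector_derivative_def by (simp_all only: has_derivative_at_withinI)
  qed
  have contfr0: "continuous_on S (\<lambda>r. fr r t)" "continuous_on S (\<lambda>t. fr r t)" for r t S
    using has_derivative_continuous[OF fr_der(1)] has_derivative_continuous[OF fr_der(2)]
    by (simp_all add: continuous_at_imp_continuous_on)
  have contfr: "continuous_on S (\<lambda>r. D v (fr r t))" "continuous_on S (\<lambda>t. D v (fr r t))" for v r t S
    by (rule continuous_on_compose2[OF contD contfr0(1)], simp,
        rule continuous_on_compose2[OF contD contfr0(2)], simp)
  have tangential: "integral\<^sup>L lborel (g ?\<tau>) = 0"
  proof -
    have "(LINT r|lborel. g ?\<tau> (fr r t)) = 0" for t
    proof (cases "t < 0")
      case True
      have "g ?\<tau> (fr r t) = indicator {-L..L} r *\<^sub>R D ?\<tau> (fr r t)" for r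
        using True fr_H[of r t] D0[of "fr r t" ?\<tau>] fr_\<Omega>[of r t]
        by (cases "fr r t \<in> \<Omega>") (auto simp: g_def split: split_indicator)
      moreover have "(LINT r|lborel. indicator {-L..L} r *\<^sub>R D ?\<tau> (fr r t)) = F (fr L t) - F (fr (-L) t)"
        by (rule integral_FTC_Icc) (use L vd(1) contfr(1) in auto)
      moreover have "\<dots> = 0" using F0' True L(1) by simp
      ultimately show ?thesis by simp
    next
      case False
      then show ?thesis using fr_H by (simp add: g_def)
    qed
    then show ?thesis
      using lborel_pair.integral_snd[of "\<lambda>r t. g ?\<tau> (fr r t)"] fubini(1,2)[of ?\<tau>] by simp
  qed
  \<comment> \<open>The parameter is recovered from the point as its inner product with the side
    direction. Hence for \<open>r\<close> outside (0, h), negative \<open>r\<close> included, the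
    point is not on the side and \<open>F\<close> is zero there.\<close>
  have bdry: "indicator {0<..<h} r *\<^sub>R F (polar \<theta> r) = F (polar \<theta> r)" for r
  proof (cases "F (polar \<theta> r) = 0")
    case False
    then have "polar \<theta> r \<in> K" using F0 by blast
    moreover have "polar \<theta> r \<bullet> ?\<nu> = 0" using frame_inner_normal[of r 0] by simp
    ultimately have "polar \<theta> r \<in> side \<theta> h" using K_boundary by auto
    then obtain r' where r': "polar \<theta> r = polar \<theta> r'" "0 < r'" "r' < h"
      by (auto simp: side_def)
    have "r = polar \<theta> r \<bullet> ?\<tau>" for r
      unfolding inner_real_2 polar_def
      by (simp add: vector_2_nth power2_eq_square[symmetric] distrib_left[symmetric] mult.assoc)
    with r' show ?thesis by (metis (mono_tags) greaterThanLessThan_iff indicator_simps(1) scaleR_one)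
  qed simp
  have normal: "integral\<^sup>L lborel (g ?\<nu>) = (LINT r|lebesgue_on {0<..<h}. F (polar \<theta> r))"
  proof -
    have "(LINT t|lborel. g ?\<nu> (fr r t)) = F (polar \<theta> r)" for r
    proof -
      \<comment> \<open>At \<open>t = 0\<close> the open half plane excludes the point while the
        closed interval includes it; the mismatch is a null set.\<close>
      have "g ?\<nu> (fr r t) = indicator {-L..0} t *\<^sub>R D ?\<nu> (fr r t)" if "t \<noteq> 0" for t
        using that fr_H[of r t] D0[of "fr r t" ?\<nu>] fr_\<Omega>[of r t]
        by (cases "fr r t \<in> \<Omega>") (auto simp: g_def split: split_indicator)
      moreover have meas_gfr: "(\<lambda>t. g ?\<nu> (fr r t)) \<in> borel_measurable borel"
        by (rule measurable_compose[OF borel_measurable_continuous_onI[OF contfr0(2)]])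
          (use int_g[of ?\<nu>] in \<open>simp add: integrable_iff_bounded\<close>)
      moreover have meas_D: "(\<lambda>t. D ?\<nu> (fr r t)) \<in> borel_measurable borel"
        by (rule borel_measurable_continuous_onI[OF contfr(2)])
      ultimately have "(LINT t|lborel. g ?\<nu> (fr r t)) = (LINT t|lborel. indicator {-L..0} t *\<^sub>R D ?\<nu> (fr r t))"
        by (intro integral_cong_AE)
          (use AE_lborel_singleton[of "0::real"] meas_gfr meas_D in \<open>auto elim!: eventually_mono\<close>)
      also have "\<dots> = F (fr r 0) - F (fr r (-L))"
        by (rule integral_FTC_Icc) (use L vd(2) contfr(2) in auto)
      also have "\<dots> = F (polar \<theta> r)" using F0'[of "-L" r] L(1) by (simp add: fr_def)
      finally show ?thesis .
    qed
    then have "integral\<^sup>L lborel (g ?\<nu>) = (LINT r|lborel. F (polar \<theta> r))"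
      using lborel_pair.integral_fst'[OF fubini(1)[of ?\<nu>]] fubini(2)[of ?\<nu>] by simp
    also have "\<dots> = (LINT r|lebesgue. F (polar \<theta> r))"
    proof -
      have "continuous_on UNIV (\<lambda>r. F (polar \<theta> r))"
        using continuous_on_compose2[OF smooth_continuous[OF F] contfr0(1)[of UNIV 0]]
        by (simp add: fr_def)
      from borel_measurable_continuous_onI[OF this] show ?thesis
        by (simp add: integral_completion)
    qed
    also have "\<dots> = (LINT r|lebesgue_on {0<..<h}. F (polar \<theta> r))"
      by (subst integral_restrict_space) (auto simp: bdry)
    finally show ?thesis .
  qed
  have "(LINT x|lebesgue_on \<Omega>. partial i F x) = (LINT x|lebesgue. indicator \<Omega> x *\<^sub>R D (axis i 1) x)"
    using open_\<Omega> by (subst integral_restrict_space) (auto simp: D_def partial_def)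
  also have "\<dots> = integral\<^sup>L lborel (g (axis i 1))"
    unfolding g_eq[symmetric]
    by (rule integral_completion) (use int_g[of "axis i 1"] in \<open>simp add: integrable_iff_bounded\<close>)
  \<comment> \<open>The components of a standard basis vector in an orthonormal frame are the
    entries of the frame vectors.\<close>
  also have "g (axis i 1) = (\<lambda>x. ?\<nu> $ i *\<^sub>R g ?\<nu> x + ?\<tau> $ i *\<^sub>R g ?\<tau> x)"
  proof
    fix x
    have "axis i 1 = ?\<nu> $ i *\<^sub>R ?\<nu> + ?\<tau> $ i *\<^sub>R ?\<tau>"
    proof -
      have s2: "\<sigma> * (\<sigma> * z) = z" for z using \<sigma> by (simp add: power2_eq_square flip: mult.assoc)
      have c2: "cos \<theta> * cos \<theta> = 1 - sin \<theta> * sin \<theta>"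
        using sin_cos_squared_add3[of \<theta>] by linarith
      consider "i = 1" | "i = 2" using exhaust_2 by blast
      then show ?thesis
        by cases (simp_all add: vec_eq_iff forall_2 side_normal_def polar_def vector_2_nth axis_def
            s2 c2 mult_ac)
    qed
    from linear_scaled_sum_2[OF linD this, of x]
    show "g (axis i 1) x = ?\<nu> $ i *\<^sub>R g ?\<nu> x + ?\<tau> $ i *\<^sub>R g ?\<tau> x"
      by (simp add: g_def algebra_simps)
  qed
  also have "integral\<^sup>L lborel \<dots> = ?\<nu> $ i *\<^sub>R integral\<^sup>L lborel (g ?\<nu>) + ?\<tau> $ i *\<^sub>R integral\<^sup>L lborel (g ?\<tau>)"
    using int_g by simp
  finally show ?thesis by (simp add: tangential normal)
qed

end

section \<open>Square-integrable functions on bounded sets\<close>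

lemma measurable_lebesgue_on_continuous:
  "continuous_on UNIV q \<Longrightarrow> q \<in> borel_measurable (lebesgue_on S)"
  for q :: "'a::euclidean_space \<Rightarrow> 'b::euclidean_space"
  using borel_measurable_continuous_onI[of q]
  by (intro measurable_restrict_space1 measurable_completion) simp

lemma bounded_on_continuous:
  fixes q :: "'a::euclidean_space \<Rightarrow> 'b::real_normed_vector"
  assumes "continuous_on UNIV q" "bounded S"
  obtains B where "B > 0" "\<And>x. x \<in> S \<Longrightarrow> norm (q x) \<le> B"
proof -
  have "compact (q ` closure S)"
    using assms by (intro compact_continuous_image continuous_on_subset[OF assms(1)]) (auto simp: compact_closure)
  then obtain B where "B > 0" "\<forall>y\<in>q ` closure S. norm y \<le> B"
    using compact_imp_bounded bounded_pos by metis
  then show ?thesis using that[of B] closure_subset[of S] by auto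
qed

lemma L2_diff:
  assumes "u \<in> L2 S" "v \<in> L2 S"
  shows "(\<lambda>x. u x - v x) \<in> L2 S"
proof -
  have "integrable (lebesgue_on S) (\<lambda>x. (norm (u x - v x))\<^sup>2)"
  proof (rule Bochner_Integration.integrable_bound)
    show "integrable (lebesgue_on S) (\<lambda>x. 2 * (norm (u x))\<^sup>2 + 2 * (norm (v x))\<^sup>2)"
      using assms by (auto simp: L2_def)
    show "(\<lambda>x. (norm (u x - v x))\<^sup>2) \<in> borel_measurable (lebesgue_on S)"
      using assms by (auto simp: L2_def)
    have "(norm (a - b))\<^sup>2 \<le> 2 * (norm a)\<^sup>2 + 2 * (norm b)\<^sup>2" for a b :: 'b
    proof -
      have "(norm (a - b))\<^sup>2 \<le> (norm a + norm b)\<^sup>2"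
        by (intro power_mono norm_triangle_ineq4) simp
      also have "\<dots> \<le> 2 * (norm a)\<^sup>2 + 2 * (norm b)\<^sup>2"
        using zero_le_power2[of "norm a - norm b"] by (simp add: power2_eq_square algebra_simps)
      finally show ?thesis .
    qed
    then show "AE x in lebesgue_on S. norm ((norm (u x - v x))\<^sup>2) \<le> norm (2 * (norm (u x))\<^sup>2 + 2 * (norm (v x))\<^sup>2)"
      by (intro AE_I2) (simp add: abs_of_nonneg)
  qed
  then show ?thesis using assms by (auto simp: L2_def)
qed

lemma L2_bounded_linear:
  fixes u :: "'a::euclidean_space \<Rightarrow> 'b::euclidean_space" and T :: "'b \<Rightarrow> 'c::euclidean_space"
  assumes T: "bounded_linear T" and u: "u \<in> L2 S"
  shows "(\<lambda>x. T (u x)) \<in> L2 S"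
proof -
  obtain B where B: "\<And>y. norm (T y) \<le> norm y * B" using bounded_linear.bounded[OF T] by blast
  have m: "(\<lambda>x. T (u x)) \<in> borel_measurable (lebesgue_on S)"
    by (rule measurable_compose[OF _ borel_measurable_continuous_onI[OF linear_continuous_on[OF T]]])
      (use u in \<open>simp add: L2_def\<close>)
  have "integrable (lebesgue_on S) (\<lambda>x. (norm (T (u x)))\<^sup>2)"
  proof (rule Bochner_Integration.integrable_bound)
    show "integrable (lebesgue_on S) (\<lambda>x. (norm (u x))\<^sup>2 * B\<^sup>2)" using u by (auto simp: L2_def)
    show "AE x in lebesgue_on S. norm ((norm (T (u x)))\<^sup>2) \<le> norm ((norm (u x))\<^sup>2 * B\<^sup>2)"
      using power_mono[OF B norm_ge_zero, of _ 2] by (intro AE_I2) (simp add: power_mult_distrib)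
  qed (use m in simp)
  then show ?thesis using m by (simp add: L2_def)
qed

lemma L2_nth: "u \<in> L2 S \<Longrightarrow> (\<lambda>x. u x $ k) \<in> L2 S"
  for u :: "'a::euclidean_space \<Rightarrow> 'b::euclidean_space ^ 'n"
  by (rule L2_bounded_linear[OF bounded_linear_vec_nth])

lemma L2_continuous:
  fixes q :: "'a::euclidean_space \<Rightarrow> 'b::euclidean_space"
  assumes "continuous_on UNIV q" "bounded S" "S \<in> lmeasurable"
  shows "q \<in> L2 S"
proof -
  obtain B where B: "\<And>x. x \<in> S \<Longrightarrow> norm (q x) \<le> B"
    using bounded_on_continuous[OF assms(1,2)] by blast
  have m: "q \<in> borel_measurable (lebesgue_on S)"
    by (rule measurable_lebesgue_on_continuous[OF assms(1)])
  interpret finite_measure "lebesgue_on S"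
    using assms(3) by (rule finite_measure_lebesgue_on)
  have "integrable (lebesgue_on S) (\<lambda>x. (norm (q x))\<^sup>2)"
    using m B assms(3) by (intro integrable_const_bound[where B="B\<^sup>2"])
      (auto simp: power_mono intro!: AE_I2)
  then show ?thesis using m by (simp add: L2_def)
qed

lemma L2_mult_integrable:
  fixes X q :: "'a::euclidean_space \<Rightarrow> complex"
  assumes X: "X \<in> L2 S" and S: "bounded S" "S \<in> lmeasurable" and q: "continuous_on UNIV q"
  shows "integrable (lebesgue_on S) (\<lambda>x. X x * q x)"
proof (rule Bochner_Integration.integrable_bound)
  have "q \<in> L2 S" by (rule L2_continuous[OF q S])
  then show "integrable (lebesgue_on S) (\<lambda>x. (norm (X x))\<^sup>2 + (norm (q x))\<^sup>2)"
    "(\<lambda>x. X x * q x) \<in> borel_measurable (lebesgue_on S)"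
    using X by (auto simp: L2_def)
  have "a * b \<le> a\<^sup>2 + b\<^sup>2" for a b :: real
  proof -
    have "2 * (a * b) \<le> a\<^sup>2 + b\<^sup>2" using sum_squares_bound[of a b] by simp
    moreover have "0 \<le> a\<^sup>2 + b\<^sup>2" by simp
    ultimately show ?thesis by linarith
  qed
  then show "AE x in lebesgue_on S. norm (X x * q x) \<le> norm ((norm (X x))\<^sup>2 + (norm (q x))\<^sup>2)"
    by (intro AE_I2) (simp add: norm_mult abs_of_nonneg)
qed

lemma L2_integrable:
  fixes X :: "'a::euclidean_space \<Rightarrow> complex"
  assumes "X \<in> L2 S" "bounded S" "S \<in> lmeasurable"
  shows "integrable (lebesgue_on S) X"
  using L2_mult_integrable[OF assms, of "\<lambda>_. 1"] by simp

text \<open>Young's inequality with a free weight, the substitute for Cauchy-Schwarz: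
  \<open>t\<close> balances the measure of a set against a squared L2 norm.\<close>

lemma abs_le_add_square:
  assumes "(t::real) > 0" shows "\<bar>x\<bar> \<le> t + x\<^sup>2 / t"
proof -
  have "\<bar>x\<bar> * t \<le> t * t + x\<^sup>2"
  proof -
    have "2 * (\<bar>x\<bar> * t) \<le> t * t + x\<^sup>2" using sum_squares_bound[of "\<bar>x\<bar>" t] by (simp add: power2_eq_square)
    moreover have "0 \<le> \<bar>x\<bar> * t" using assms by simp
    ultimately show ?thesis by linarith
  qed
  then show ?thesis using assms by (simp add: field_simps power2_eq_square)
qed

text \<open>With A the measure of \<open>S\<close> and B a bound for \<open>q\<close> on it, Young's
  inequality bounds the difference by B (t A + d / t), where d is the squared L2 distance. The
  weight t is chosen small first, then n large.\<close>

lemma tendsto_integral_mult_L2: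
  fixes X :: "'a::euclidean_space \<Rightarrow> complex" and Xs :: "nat \<Rightarrow> 'a \<Rightarrow> complex"
  assumes X: "X \<in> L2 S" and Xs: "\<And>n. Xs n \<in> L2 S" and S: "bounded S" "S \<in> lmeasurable"
    and q: "continuous_on UNIV q"
    and lim: "(\<lambda>n. L2_sq S (\<lambda>x. Xs n x - X x)) \<longlonglongrightarrow> 0"
  shows "(\<lambda>n. LINT x|lebesgue_on S. Xs n x * q x) \<longlonglongrightarrow> (LINT x|lebesgue_on S. X x * q x)"
proof -
  let ?I = "\<lambda>X. LINT x|lebesgue_on S. X x * q x"
  let ?d = "\<lambda>n. L2_sq S (\<lambda>x. Xs n x - X x)"
  obtain B where B: "B > 0" "\<And>x. x \<in> S \<Longrightarrow> norm (q x) \<le> B"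
    using bounded_on_continuous[OF q S(1)] by blast
  define A where "A = measure lebesgue S"
  have A: "A \<ge> 0" by (simp add: A_def)
  have bound: "norm (?I (Xs n) - ?I X)
      \<le> B * (t * A + ?d n / t)" if t: "t > 0" for n t
  proof -
    have int: "integrable (lebesgue_on S) (\<lambda>x. (norm (Xs n x - X x))\<^sup>2)"
      using L2_diff[OF Xs X] by (simp add: L2_def)
    interpret finite_measure "lebesgue_on S"
      using S(2) by (rule finite_measure_lebesgue_on)
    have "?I (Xs n) - ?I X =
        (LINT x|lebesgue_on S. (Xs n x - X x) * q x)"
      using L2_mult_integrable[OF X S q] L2_mult_integrable[OF Xs S q] by (simp add: algebra_simps)
    also have "norm \<dots> \<le> (LINT x|lebesgue_on S. B * (t + (norm (Xs n x - X x))\<^sup>2 / t))"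
    proof (rule Bochner_Integration.integral_norm_bound_integral)
      show "integrable (lebesgue_on S) (\<lambda>x. (Xs n x - X x) * q x)"
        by (rule L2_mult_integrable[OF L2_diff[OF Xs X] S q])
      show "integrable (lebesgue_on S) (\<lambda>x. B * (t + (norm (Xs n x - X x))\<^sup>2 / t))"
        using int by simp
      fix x assume "x \<in> space (lebesgue_on S)"
      then have "x \<in> S" by simp
      have "norm ((Xs n x - X x) * q x) \<le> norm (Xs n x - X x) * B"
        using B(2)[OF \<open>x \<in> S\<close>] by (simp add: norm_mult mult_left_mono)
      also have "\<dots> \<le> (t + (norm (Xs n x - X x))\<^sup>2 / t) * B"
        using abs_le_add_square[OF t, of "norm (Xs n x - X x)"] B(1) by (simp add: mult_right_mono)
      finally show "norm ((Xs n x - X x) * q x) \<le> B * (t + (norm (Xs n x - X x))\<^sup>2 / t)"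
        by (simp add: mult.commute)
    qed
    also have "\<dots> = B * (t * A + ?d n / t)"
      using int S(2) by (simp add: L2_sq_def A_def measure_restrict_space fmeasurableD)
    finally show ?thesis .
  qed
  show ?thesis
  proof (rule Lim_null[THEN iffD2], rule tendstoI)
    fix e :: real assume e: "e > 0"
    \<comment> \<open>Makes B t A at most e/2; the summand 1 covers sets of measure zero.\<close>
    define t where "t = e / (2 * B * (A + 1))"
    have t: "t > 0" using e B A by (simp add: t_def)
    have "eventually (\<lambda>n. ?d n < t * e / (2 * B)) sequentially"
      using lim t e B(1) by (intro order_tendstoD(2)) auto
    then show "eventually (\<lambda>n. dist (?I (Xs n) - ?I X) 0 < e) sequentially"
    proof (rule eventually_mono)
      fix n assume n: "?d n < t * e / (2 * B)"
      have "B * (t * A) \<le> B * (t * (A + 1))" using A B(1) t by simp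
      also have "\<dots> = e / 2" using A B(1) by (simp add: t_def)
      finally have "B * (t * A) \<le> e / 2" .
      moreover have "B * (?d n / t) < e / 2"
        using n t B(1) by (simp add: field_simps)
      ultimately show "dist (?I (Xs n) - ?I X) 0 < e"
        using bound[OF t, of n] unfolding distrib_left dist_norm diff_0_right by linarith
    qed
  qed
qed

lemma L2_sq_nth_tendsto:
  fixes X :: "'a::euclidean_space \<Rightarrow> 'b::euclidean_space ^ 'n"
  assumes X: "\<And>n. (\<lambda>x. Xs n x - X x) \<in> L2 S"
    and lim: "(\<lambda>n. L2_sq S (\<lambda>x. Xs n x - X x)) \<longlonglongrightarrow> 0"
  shows "(\<lambda>n. L2_sq S (\<lambda>x. Xs n x $ k - X x $ k)) \<longlonglongrightarrow> 0"
proof (rule tendsto_sandwich[OF _ _ tendsto_const lim])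
  show "eventually (\<lambda>n. 0 \<le> L2_sq S (\<lambda>x. Xs n x $ k - X x $ k)) sequentially"
    by (simp add: L2_sq_def)
  have "L2_sq S (\<lambda>x. Xs n x $ k - X x $ k) \<le> L2_sq S (\<lambda>x. Xs n x - X x)" for n
    unfolding L2_sq_def
  proof (rule integral_mono)
    show "integrable (lebesgue_on S) (\<lambda>x. (norm (Xs n x $ k - X x $ k))\<^sup>2)"
      using L2_nth[OF X[of n], of k] by (simp add: L2_def)
    show "integrable (lebesgue_on S) (\<lambda>x. (norm (Xs n x - X x))\<^sup>2)"
      using X[of n] by (simp add: L2_def)
    show "(norm (Xs n x $ k - X x $ k))\<^sup>2 \<le> (norm (Xs n x - X x))\<^sup>2" for x
    proof (rule power_mono)
      have "norm ((Xs n x - X x) $ k) \<le> norm (Xs n x - X x)" by (rule Finite_Cartesian_Product.norm_nth_le)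
      then show "norm (Xs n x $ k - X x $ k) \<le> norm (Xs n x - X x)" by simp
    qed simp
  qed
  then show "eventually (\<lambda>n. L2_sq S (\<lambda>x. Xs n x $ k - X x $ k) \<le> L2_sq S (\<lambda>x. Xs n x - X x)) sequentially"
    by simp
qed

section \<open>Integration by parts\<close>

lemma smooth_vec_nth: "smooth f \<Longrightarrow> smooth (\<lambda>x. f x $ k)" for f :: "_ \<Rightarrow> 'b::real_normed_vector ^ 'n"
  by (rule smooth_bounded_linear_comp[OF bounded_linear_vec_nth])

lemma smooth_partial: "smooth f \<Longrightarrow> smooth (partial i f)"
  unfolding partial_def[abs_def] by (rule smooth_frechet)

lemma partial_eq: "(f has_derivative f') (at x) \<Longrightarrow> partial i f x = f' (axis i 1)"
  by (simp add: partial_def frechet_derivative_eq)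

lemma partial_nth:
  fixes f :: "real^2 \<Rightarrow> 'b::real_normed_vector ^ 'n"
  assumes "smooth f" shows "partial i f x $ k = partial i (\<lambda>x. f x $ k) x"
  using partial_eq[OF bounded_linear.has_derivative[OF bounded_linear_vec_nth smooth_has_derivative[OF assms]]]
  by (simp add: partial_def)

lemma partial_mult:
  fixes f g :: "real^2 \<Rightarrow> 'b::real_normed_algebra"
  assumes "smooth f" "smooth g"
  shows "partial i (\<lambda>x. f x * g x) x = partial i f x * g x + f x * partial i g x"
  using partial_eq[OF has_derivative_mult[OF smooth_has_derivative[OF assms(1)] smooth_has_derivative[OF assms(2)]]]
  by (simp add: partial_def add.commute)

lemma partial_vanishes:
  assumes "closed K" "\<And>x. x \<notin> K \<Longrightarrow> f x = 0" "x \<notin> K"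
  shows "partial i f x = 0"
proof -
  have "eventually (\<lambda>y. y \<in> - K) (nhds x)"
    using assms by (intro eventually_nhds_in_open) auto
  then have ev: "eventually (\<lambda>y. f y = 0) (nhds x)" by (rule eventually_mono) (simp add: assms)
  have "(f has_derivative (\<lambda>_. 0)) (at x)"
  proof (rule has_derivative_transform_eventually[of "\<lambda>_. 0"])
    show "eventually (\<lambda>y. 0 = f y) (at x)"
      unfolding eventually_at_filter using ev by (rule eventually_mono) simp
  qed (use assms in auto)
  from partial_eq[OF this] show ?thesis .
qed

context side_neighborhood
begin

lemma lmeasurable_\<Omega>: "\<Omega> \<in> lmeasurable"
  using bounded_\<Omega> open_\<Omega> by (simp add: bounded_set_imp_lmeasurable)

lemma continuous_polar: "continuous_on S (polar \<theta>)"
  unfolding polar_def by (intro continuous_on_vector_2 continuous_intros)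

text \<open>For the smooth approximants this is the divergence theorem applied to a component times
  \<open>q\<close>. Each of the three integrals passes to the limit by one of the three L2
  convergences; the one on the side turns the boundary values of the approximants into
  \<open>f\<close>.\<close>

lemma integration_by_parts:
  fixes u f :: "real^2 \<Rightarrow> complex^2" and D :: "real^2 \<Rightarrow> complex^2^2" and q :: "real^2 \<Rightarrow> complex"
  assumes u: "u \<in> L2 \<Omega>" and D: "D \<in> L2 \<Omega>" and f: "(\<lambda>r. f (polar \<theta> r)) \<in> L2 {0<..<h}"
    and U: "\<And>n. smooth (U n)"
    and Uu: "(\<lambda>n. L2_sq \<Omega> (\<lambda>x. U n x - u x)) \<longlonglongrightarrow> 0"
    and UD: "(\<lambda>n. L2_sq \<Omega> (\<lambda>x. jacobian (U n) x - D x)) \<longlonglongrightarrow> 0"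
    and Uf: "(\<lambda>n. L2_sq {0<..<h} (\<lambda>r. U n (polar \<theta> r) - f (polar \<theta> r))) \<longlonglongrightarrow> 0"
    and q: "smooth q" and q0: "\<And>x. x \<notin> K \<Longrightarrow> q x = 0"
  shows "(LINT x|lebesgue_on \<Omega>. D x $ k $ i * q x) =
    side_normal \<sigma> \<theta> $ i *\<^sub>R (LINT r|lebesgue_on {0<..<h}. f (polar \<theta> r) $ k * q (polar \<theta> r))
    - (LINT x|lebesgue_on \<Omega>. u x $ k * partial i q x)"
proof -
  note S = bounded_\<Omega> lmeasurable_\<Omega>
  have I: "bounded {0<..<h}" "{0<..<h} \<in> lmeasurable" by auto
  have Uk: "smooth (\<lambda>x. U n x $ k)" for n by (rule smooth_vec_nth[OF U])
  have L2_U: "U n \<in> L2 \<Omega>" for n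
    by (rule L2_continuous[OF smooth_continuous[OF U] S])
  have L2_Up: "(\<lambda>r. U n (polar \<theta> r)) \<in> L2 {0<..<h}" for n
    by (rule L2_continuous[OF _ I]) (rule continuous_on_compose2[OF smooth_continuous[OF U] continuous_polar], simp)
  have L2_J: "jacobian (U n) \<in> L2 \<Omega>" for n
  proof (rule L2_continuous[OF _ S])
    show "continuous_on UNIV (jacobian (U n))"
      unfolding jacobian_def
      by (intro continuous_on_vec_lambda smooth_continuous smooth_vec_nth smooth_partial U)
  qed
  have qc: "continuous_on UNIV q" "continuous_on UNIV (\<lambda>r. q (polar \<theta> r))" "continuous_on UNIV (partial i q)"
    using smooth_continuous[OF q] smooth_continuous[OF smooth_partial[OF q]]
    by (auto intro: continuous_on_compose2[OF _ continuous_polar])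
  have "(LINT x|lebesgue_on \<Omega>. jacobian (U n) x $ k $ i * q x) =
    side_normal \<sigma> \<theta> $ i *\<^sub>R (LINT r|lebesgue_on {0<..<h}. U n (polar \<theta> r) $ k * q (polar \<theta> r))
    - (LINT x|lebesgue_on \<Omega>. U n x $ k * partial i q x)" for n
  proof -
    have "side_normal \<sigma> \<theta> $ i *\<^sub>R (LINT r|lebesgue_on {0<..<h}. U n (polar \<theta> r) $ k * q (polar \<theta> r)) =
      (LINT x|lebesgue_on \<Omega>. partial i (\<lambda>x. U n x $ k * q x) x)"
      by (rule divergence_theorem[symmetric]) (use q0 in \<open>auto intro: smooth_mult Uk q\<close>)
    also have "\<dots> = (LINT x|lebesgue_on \<Omega>. jacobian (U n) x $ k $ i * q x + U n x $ k * partial i q x)"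
      by (simp add: partial_mult[OF Uk q] jacobian_def partial_nth[OF U])
    also have "\<dots> = (LINT x|lebesgue_on \<Omega>. jacobian (U n) x $ k $ i * q x) + (LINT x|lebesgue_on \<Omega>. U n x $ k * partial i q x)"
      by (intro Bochner_Integration.integral_add L2_mult_integrable[OF _ S] L2_nth L2_J L2_U qc)
    finally show ?thesis by simp
  qed
  moreover have "(\<lambda>n. LINT x|lebesgue_on \<Omega>. jacobian (U n) x $ k $ i * q x) \<longlonglongrightarrow> (LINT x|lebesgue_on \<Omega>. D x $ k $ i * q x)"
  proof (rule tendsto_integral_mult_L2[OF L2_nth[OF L2_nth[OF D]] L2_nth[OF L2_nth[OF L2_J]] S qc(1)])
    have "(\<lambda>n. L2_sq \<Omega> (\<lambda>x. jacobian (U n) x $ k - D x $ k)) \<longlonglongrightarrow> 0"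
      by (rule L2_sq_nth_tendsto[OF L2_diff[OF L2_J D] UD])
    from L2_sq_nth_tendsto[OF L2_diff[OF L2_nth[OF L2_J] L2_nth[OF D]] this]
    show "(\<lambda>n. L2_sq \<Omega> (\<lambda>x. jacobian (U n) x $ k $ i - D x $ k $ i)) \<longlonglongrightarrow> 0" .
  qed
  moreover have "(\<lambda>n. LINT r|lebesgue_on {0<..<h}. U n (polar \<theta> r) $ k * q (polar \<theta> r)) \<longlonglongrightarrow>
    (LINT r|lebesgue_on {0<..<h}. f (polar \<theta> r) $ k * q (polar \<theta> r))"
    by (rule tendsto_integral_mult_L2[OF L2_nth[OF f] L2_nth[OF L2_Up] I qc(2)
          L2_sq_nth_tendsto[OF L2_diff[OF L2_Up f] Uf]])
  moreover have "(\<lambda>n. LINT x|lebesgue_on \<Omega>. U n x $ k * partial i q x) \<longlonglongrightarrow> (LINT x|lebesgue_on \<Omega>. u x $ k * partial i q x)"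
    by (rule tendsto_integral_mult_L2[OF L2_nth[OF u] L2_nth[OF L2_U] S qc(3)
          L2_sq_nth_tendsto[OF L2_diff[OF L2_U u] Uu]])
  ultimately show ?thesis
    by (auto intro!: LIMSEQ_unique[where X="\<lambda>n. LINT x|lebesgue_on \<Omega>. jacobian (U n) x $ k $ i * q x"] tendsto_intros)
qed

text \<open>A function annihilating all real test functions also annihilates smooth functions that do not
  vanish at the side: multiply by a cutoff away from the line through the side.\<close>

lemma integral_eq_0_if_test_functions:
  fixes E q :: "real^2 \<Rightarrow> complex"
  assumes E: "E \<in> L2 \<Omega>"
    and E0: "\<And>\<phi> :: real^2 \<Rightarrow> real. test_function \<Omega> \<phi> \<Longrightarrow> (LINT x|lebesgue_on \<Omega>. \<phi> x *\<^sub>R E x) = 0"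
    and q: "smooth q" and q0: "\<And>x. x \<notin> K \<Longrightarrow> q x = 0"
  shows "(LINT x|lebesgue_on \<Omega>. E x * q x) = 0"
proof -
  note S = bounded_\<Omega> lmeasurable_\<Omega>
  \<comment> \<open>For positive n, this is zero in \<open>\<Omega>\<close> within distance 1/n of
    the line through the side and one beyond distance 2/n.\<close>
  define \<psi> where "\<psi> n x = step (- (real n *\<^sub>R side_normal \<sigma> \<theta> \<bullet> x) + (- 1))" for n and x :: "real^2"
  have sm\<psi>: "smooth (\<psi> n)" for n
    unfolding \<psi>_def
    by (intro smooth_comp_linear smooth_step bounded_linear_minus bounded_linear_inner_right)
  have zero: "(LINT x|lebesgue_on \<Omega>. (\<psi> n x * p x) *\<^sub>R E x) = 0"
    if p: "smooth p" "\<And>x. x \<notin> K \<Longrightarrow> p x = 0" for n and p :: "real^2 \<Rightarrow> real"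
  proof (rule E0)
    \<comment> \<open>\<open>C\<close> keeps away from the line, so \<open>K_inside\<close> places
      it in \<open>\<Omega>\<close>; being closed and bounded it is compact.\<close>
    define C where "C = K \<inter> {x. real n *\<^sub>R side_normal \<sigma> \<theta> \<bullet> x \<le> - 1}"
    have C\<Omega>: "C \<subseteq> \<Omega>"
    proof
      fix x assume x: "x \<in> C"
      then have "real n * (x \<bullet> side_normal \<sigma> \<theta>) < 0" by (simp add: C_def inner_commute)
      then have "x \<bullet> side_normal \<sigma> \<theta> < 0" by (simp add: mult_less_0_iff)
      then show "x \<in> \<Omega>" using x K_inside by (auto simp: C_def)
    qed
    have "closed C" unfolding C_def
      by (intro closed_Int closed_K closed_Collect_le continuous_intros)
    then have "compact C" using C\<Omega> bounded_\<Omega> bounded_subset by (auto simp: compact_eq_bounded_closed)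
    have "\<psi> n x * p x = 0" if "x \<notin> C" for x
    proof (cases "x \<in> K")
      case True
      then show ?thesis using that by (auto simp: C_def \<psi>_def intro!: step_eq_0)
    qed (use p in auto)
    then have "supp (\<lambda>x. \<psi> n x * p x) \<subseteq> C"
      unfolding supp_def using \<open>closed C\<close> by (intro closure_minimal) auto
    moreover have "closed (supp (\<lambda>x. \<psi> n x * p x))" by (simp add: supp_def)
    ultimately have "compact (supp (\<lambda>x. \<psi> n x * p x))"
      using \<open>compact C\<close> by (metis compact_Int_closed inf.absorb_iff2)
    then show "test_function \<Omega> (\<lambda>x. \<psi> n x * p x)"
      using C\<Omega> \<open>supp _ \<subseteq> C\<close> sm\<psi> p(1) by (auto simp: test_function_def intro: smooth_mult)
  qed
  have *: "(LINT x|lebesgue_on \<Omega>. E x * (complex_of_real (\<psi> n x) * q x)) = 0" for n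
  proof -
    \<comment> \<open>The hypothesis covers real test functions only, so a complex \<open>q\<close>
      is split into real and imaginary parts.\<close>
    have sR: "smooth (\<lambda>x. Re (q x))" "smooth (\<lambda>x. Im (q x))"
      by (intro smooth_bounded_linear_comp[OF bounded_linear_Re q] smooth_bounded_linear_comp[OF bounded_linear_Im q])+
    have int: "integrable (lebesgue_on \<Omega>) (\<lambda>x. (\<psi> n x * p x) *\<^sub>R E x)"
      if "smooth p" for p
    proof -
      have "continuous_on UNIV (\<lambda>x. complex_of_real (\<psi> n x * p x))"
        by (intro continuous_on_of_real smooth_continuous smooth_mult sm\<psi> that)
      from L2_mult_integrable[OF E S this] show ?thesis
        by (simp add: scaleR_conv_of_real mult_ac)
    qed
    have "E x * (complex_of_real (\<psi> n x) * q x) =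
        (\<psi> n x * Re (q x)) *\<^sub>R E x + \<i> * ((\<psi> n x * Im (q x)) *\<^sub>R E x)" for x
      by (subst complex_eq[of "q x"]) (simp add: scaleR_conv_of_real algebra_simps)
    then have "(LINT x|lebesgue_on \<Omega>. E x * (complex_of_real (\<psi> n x) * q x)) =
        (LINT x|lebesgue_on \<Omega>. (\<psi> n x * Re (q x)) *\<^sub>R E x + \<i> * ((\<psi> n x * Im (q x)) *\<^sub>R E x))"
      by (simp only:)
    also have "\<dots> = (LINT x|lebesgue_on \<Omega>. (\<psi> n x * Re (q x)) *\<^sub>R E x) +
        \<i> * (LINT x|lebesgue_on \<Omega>. (\<psi> n x * Im (q x)) *\<^sub>R E x)"
      using int[OF sR(1)] int[OF sR(2)]
      by (subst Bochner_Integration.integral_add) (auto simp del: mult_scaleR_right)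
    finally show ?thesis using zero[OF sR(1)] zero[OF sR(2)] q0 by simp
  qed
  have "(\<lambda>n. LINT x|lebesgue_on \<Omega>. E x * (complex_of_real (\<psi> n x) * q x)) \<longlonglongrightarrow> (LINT x|lebesgue_on \<Omega>. E x * q x)"
  proof (rule integral_dominated_convergence[where w="\<lambda>x. norm (E x * q x)"])
    have "integrable (lebesgue_on \<Omega>) (\<lambda>x. E x * q x)"
      by (rule L2_mult_integrable[OF E S smooth_continuous[OF q]])
    then show "(\<lambda>x. E x * q x) \<in> borel_measurable (lebesgue_on \<Omega>)"
      "integrable (lebesgue_on \<Omega>) (\<lambda>x. norm (E x * q x))" by auto
    show "(\<lambda>x. E x * (complex_of_real (\<psi> n x) * q x)) \<in> borel_measurable (lebesgue_on \<Omega>)" for n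
      by (rule borel_measurable_integrable, rule L2_mult_integrable[OF E S])
        (intro continuous_intros continuous_on_of_real smooth_continuous q sm\<psi>)
    show "AE x in lebesgue_on \<Omega>. norm (E x * (complex_of_real (\<psi> n x) * q x)) \<le> norm (E x * q x)" for n
      using step_nonneg step_le_1
      by (intro AE_I2) (simp add: norm_mult \<psi>_def mult_left_le mult_left_le_one_le mult_left_mono)
    show "AE x in lebesgue_on \<Omega>. (\<lambda>n. E x * (complex_of_real (\<psi> n x) * q x)) \<longlonglongrightarrow> E x * q x"
    proof (rule AE_I2)
      fix x assume "x \<in> space (lebesgue_on \<Omega>)"
      then have "side_normal \<sigma> \<theta> \<bullet> x < 0" using \<Omega>_subset by (auto simp: inner_commute)
      then obtain N :: nat where N: "real N * (- (side_normal \<sigma> \<theta> \<bullet> x)) > 2"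
        using reals_Archimedean3[of "- (side_normal \<sigma> \<theta> \<bullet> x)"] by auto
      have "eventually (\<lambda>n. E x * (complex_of_real (\<psi> n x) * q x) = E x * q x) sequentially"
        using eventually_ge_at_top[of N]
      proof (rule eventually_mono)
        fix n assume "N \<le> n"
        then have "real N * (- (side_normal \<sigma> \<theta> \<bullet> x)) \<le> real n * (- (side_normal \<sigma> \<theta> \<bullet> x))"
          using \<open>side_normal \<sigma> \<theta> \<bullet> x < 0\<close> by (intro mult_right_mono) auto
        then have "\<psi> n x = 1" using N by (auto simp: \<psi>_def intro!: step_eq_1)
        then show "E x * (complex_of_real (\<psi> n x) * q x) = E x * q x" by simp
      qed
      then show "(\<lambda>n. E x * (complex_of_real (\<psi> n x) * q x)) \<longlonglongrightarrow> E x * q x"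
        by (rule tendsto_eventually)
    qed
  qed
  then show ?thesis unfolding * by (simp add: LIMSEQ_const_iff)
qed

end

section \<open>Square integrability of products and of the stress\<close>

lemma L2_mult_continuous:
  fixes X q :: "'a::euclidean_space \<Rightarrow> complex"
  assumes X: "X \<in> L2 S" and S: "bounded S" and q: "continuous_on UNIV q"
  shows "(\<lambda>x. X x * q x) \<in> L2 S"
proof -
  obtain B where B: "B > 0" "\<And>x. x \<in> S \<Longrightarrow> norm (q x) \<le> B"
    using bounded_on_continuous[OF q S] by blast
  have m: "(\<lambda>x. X x * q x) \<in> borel_measurable (lebesgue_on S)"
    using X measurable_lebesgue_on_continuous[OF q] by (auto simp: L2_def)
  have "integrable (lebesgue_on S) (\<lambda>x. (norm (X x * q x))\<^sup>2)"
  proof (rule Bochner_Integration.integrable_bound)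
    show "integrable (lebesgue_on S) (\<lambda>x. B\<^sup>2 * (norm (X x))\<^sup>2)"
      using X by (simp add: L2_def)
    show "AE x in lebesgue_on S. norm ((norm (X x * q x))\<^sup>2) \<le> norm (B\<^sup>2 * (norm (X x))\<^sup>2)"
    proof (rule AE_I2)
      fix x assume "x \<in> space (lebesgue_on S)"
      then have "norm (X x * q x) \<le> B * norm (X x)"
        using mult_left_mono[OF B(2) norm_ge_zero[of "X x"], of x] by (simp add: norm_mult mult.commute)
      then have "(norm (X x * q x))\<^sup>2 \<le> (B * norm (X x))\<^sup>2" by (intro power_mono) auto
      then show "norm ((norm (X x * q x))\<^sup>2) \<le> norm (B\<^sup>2 * (norm (X x))\<^sup>2)"
        by (simp add: power_mult_distrib)
    qed
  qed (use m in simp)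
  then show ?thesis using m by (simp add: L2_def)
qed

lemma L2_uminus: "u \<in> L2 S \<Longrightarrow> (\<lambda>x. - u x) \<in> L2 S"
  by (simp add: L2_def)

lemma L2_add:
  assumes "u \<in> L2 S" "v \<in> L2 S"
  shows "(\<lambda>x. u x + v x) \<in> L2 S"
  using L2_diff[OF assms(1) L2_uminus[OF assms(2)]] by simp

lemma L2_cmult: "u \<in> L2 S \<Longrightarrow> (\<lambda>x. c * u x) \<in> L2 S" for c :: complex
  by (auto simp: L2_def norm_mult power_mult_distrib)

lemma stress_nth:
  "stress lam mu A $ k $ i = (if k = i then complex_of_real lam * (A $ 1 $ 1 + A $ 2 $ 2) else 0) + complex_of_real mu * (A $ k $ i + A $ i $ k)"
  by (simp add: stress_def mat_def trace_def sum_2 transpose_def scaleR_conv_of_real[where 'a=complex])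

text \<open>Symmetry of the elasticity tensor. It moves the stress from the weak Jacobian to the
  smooth field in Green's second formula.\<close>

lemma contraction_stress: "contraction (stress lam mu A) B = contraction A (stress lam mu B)"
  by (simp add: contraction_def sum_2 stress_nth algebra_simps)

lemma L2_stress:
  assumes "A \<in> L2 S"
  shows "(\<lambda>x. stress lam mu (A x) $ k $ i) \<in> L2 S"
proof -
  note L = L2_nth[OF L2_nth[OF assms]]
  have "(\<lambda>x. of_real lam * (A x $ 1 $ 1 + A x $ 2 $ 2)) \<in> L2 S"
    "(\<lambda>x. of_real mu * (A x $ k $ i + A x $ i $ k)) \<in> L2 S"
    by (intro L2_cmult L2_add L)+
  then show ?thesis unfolding stress_nth by (cases "k = i") (auto intro: L2_add)
qed

lemma smooth_of_real: "smooth f \<Longrightarrow> smooth (\<lambda>x. complex_of_real (f x))"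
  by (rule smooth_bounded_linear_comp[OF bounded_linear_of_real])

lemma partial_of_real:
  "smooth f \<Longrightarrow> partial i (\<lambda>x. complex_of_real (f x)) x = complex_of_real (partial i f x)"
  using partial_eq[OF bounded_linear.has_derivative[OF bounded_linear_of_real smooth_has_derivative]]
  by (simp add: partial_def)

text \<open>Reduces stress integrals to those of single entries, so that a relation known entrywise
  for Jacobians passes to stresses.\<close>

lemma integral_stress:
  fixes A :: "'a::euclidean_space \<Rightarrow> complex^2^2"
  assumes A: "A \<in> L2 S" and S: "bounded S" "S \<in> lmeasurable" and q: "continuous_on UNIV q"
  shows "(LINT x|lebesgue_on S. stress lam mu (A x) $ k $ i * q x) =
    (if k = i then complex_of_real lam * ((LINT x|lebesgue_on S. A x $ 1 $ 1 * q x) + (LINT x|lebesgue_on S. A x $ 2 $ 2 * q x)) else 0)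
     + complex_of_real mu * ((LINT x|lebesgue_on S. A x $ k $ i * q x) + (LINT x|lebesgue_on S. A x $ i $ k * q x))"
proof -
  have int: "integrable (lebesgue_on S) (\<lambda>x. A x $ a $ b * q x)" for a b
    by (rule L2_mult_integrable[OF L2_nth[OF L2_nth[OF A]] S q])
  have "stress lam mu (A x) $ k $ i * q x =
    (if k = i then of_real lam else 0) * (A x $ 1 $ 1 * q x + A x $ 2 $ 2 * q x)
    + of_real mu * (A x $ k $ i * q x + A x $ i $ k * q x)" for x
    by (simp add: stress_nth algebra_simps)
  then show ?thesis by (simp add: int del: distrib_left_numeral)
qed

lemma integral_mult_contraction:
  assumes "\<And>k i. integrable M (\<lambda>x. A x $ k $ i * (w x * B x $ k $ i))"
  shows "(LINT x|M. w x * contraction (A x) (B x)) =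
    (\<Sum>k\<in>UNIV. \<Sum>i\<in>UNIV. LINT x|M. A x $ k $ i * (w x * B x $ k $ i))"
proof -
  have "w x * contraction (A x) (B x) = (\<Sum>k\<in>UNIV. \<Sum>i\<in>UNIV. A x $ k $ i * (w x * B x $ k $ i))" for x
    by (simp add: contraction_def sum_2 algebra_simps)
  then show ?thesis using assms by (simp add: Bochner_Integration.integral_sum)
qed

context side_neighborhood
begin

text \<open>Green's second formula for \<open>u\<close> and \<open>u0\<close>, localized by
  \<omega>. The traction is tested with \<omega> times \<open>u0\<close>. The part of the gradient
  that falls on \<open>u0\<close> becomes, by symmetry of the elasticity tensor, \<open>D\<close>
  against \<omega> times the stress of \<open>u0\<close>, and is integrated by parts. That stress is
  divergence free, so only derivatives of \<omega> survive in the interior.\<close>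

lemma side_identity:
  fixes u f g u0 :: "real^2 \<Rightarrow> complex^2" and Dv Dw D :: "real^2 \<Rightarrow> complex^2^2" and \<omega> :: "real^2 \<Rightarrow> real"
  assumes L2: "u \<in> L2 \<Omega>" "Dv \<in> L2 \<Omega>" "Dw \<in> L2 \<Omega>" "D \<in> L2 \<Omega>"
    and L2_f: "(\<lambda>r. f (polar \<theta> r)) \<in> L2 {0<..<h}" and L2_g: "(\<lambda>r. g (polar \<theta> r)) \<in> L2 {0<..<h}"
    and U: "\<And>n. smooth (U n)"
    and Uu: "(\<lambda>n. L2_sq \<Omega> (\<lambda>x. U n x - u x)) \<longlonglongrightarrow> 0"
    and UD: "(\<lambda>n. L2_sq \<Omega> (\<lambda>x. jacobian (U n) x - D x)) \<longlonglongrightarrow> 0"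
    and Uf: "(\<lambda>n. L2_sq {0<..<h} (\<lambda>r. U n (polar \<theta> r) - f (polar \<theta> r))) \<longlonglongrightarrow> 0"
    and weak: "\<And>k i \<phi>. test_function \<Omega> \<phi> \<Longrightarrow>
      (LINT x|lebesgue_on \<Omega>. \<phi> x *\<^sub>R ((Dv x - Dw x - D x) $ k $ i)) = 0"
    and trac: "\<And>\<phi>. boundary_test_function \<Omega> (side \<theta> h) \<phi> \<Longrightarrow>
      (LINT x|lebesgue_on \<Omega>. contraction (stress lam mu (Dv x)) (jacobian \<phi> x)) -
      (LINT x|lebesgue_on \<Omega>. contraction (stress lam mu (Dw x)) (jacobian \<phi> x)) = side_pairing \<theta> h g \<phi>"
    and u0: "smooth u0"
    and div0: "\<And>k x. (\<Sum>i\<in>UNIV. partial i (\<lambda>x. stress lam mu (jacobian u0 x) $ k $ i) x) = 0"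
    and \<omega>: "smooth \<omega>" "\<And>x. x \<notin> K \<Longrightarrow> \<omega> x = 0"
  shows "(LINT x|lebesgue_on \<Omega>. (\<Sum>k\<in>UNIV. \<Sum>i\<in>UNIV.
       (stress lam mu (D x) $ k $ i * u0 x $ k - u x $ k * stress lam mu (jacobian u0 x) $ k $ i) * of_real (partial i \<omega> x))) =
    (LINT r|lebesgue_on {0<..<h}. (scalar_product (g (polar \<theta> r)) (u0 (polar \<theta> r)) -
       (\<Sum>k\<in>UNIV. \<Sum>i\<in>UNIV. f (polar \<theta> r) $ k * stress lam mu (jacobian u0 (polar \<theta> r)) $ k $ i * of_real (side_normal \<sigma> \<theta> $ i)))
       * of_real (\<omega> (polar \<theta> r)))"
proof -
  note S = bounded_\<Omega> lmeasurable_\<Omega>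
  have I: "bounded {0<..<h}" "{0<..<h} \<in> lmeasurable" by auto
  define \<phi> where "\<phi> x = \<omega> x *\<^sub>R u0 x" for x
  define w where "w x = complex_of_real (\<omega> x)" for x
  define Q where "Q x = stress lam mu (jacobian u0 x)" for x
  have sw: "smooth w" unfolding w_def by (rule smooth_of_real[OF \<omega>(1)])
  have s\<phi>: "smooth \<phi>" unfolding \<phi>_def by (rule smooth_scaleR[OF \<omega>(1) u0])
  have su0: "smooth (\<lambda>x. u0 x $ k)" for k by (rule smooth_vec_nth[OF u0])
  have J: "jacobian u0 x $ k $ i = partial i (\<lambda>x. u0 x $ k) x" for k i x
    by (simp add: jacobian_def partial_nth[OF u0])
  have sJ: "smooth (\<lambda>x. jacobian u0 x $ k $ i)" for k i
    unfolding J by (rule smooth_partial[OF su0])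
  have sQ: "smooth (\<lambda>x. Q x $ k $ i)" for k i
  proof -
    have "smooth (\<lambda>x. of_real lam * (jacobian u0 x $ 1 $ 1 + jacobian u0 x $ 2 $ 2))"
      "smooth (\<lambda>x. of_real mu * (jacobian u0 x $ k $ i + jacobian u0 x $ i $ k))"
      by (intro smooth_mult smooth_const smooth_add sJ)+
    then show ?thesis unfolding Q_def stress_nth by (cases "k = i") (auto intro: smooth_add smooth_const)
  qed
  have pw: "partial i w x = of_real (partial i \<omega> x)" for i x
    unfolding w_def by (rule partial_of_real[OF \<omega>(1)])
  have J\<phi>: "jacobian \<phi> x $ k $ i = partial i w x * u0 x $ k + w x * jacobian u0 x $ k $ i" for x k i
  proof -
    have "jacobian \<phi> x $ k $ i = partial i (\<lambda>x. \<phi> x $ k) x"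
      by (simp add: jacobian_def partial_nth[OF s\<phi>])
    also have "(\<lambda>x. \<phi> x $ k) = (\<lambda>x. w x * u0 x $ k)"
      by (simp add: \<phi>_def w_def fun_eq_iff scaleR_conv_of_real[where 'a=complex])
    finally show ?thesis by (simp add: partial_mult[OF sw su0] J)
  qed
  have sJ\<phi>: "smooth (\<lambda>x. jacobian \<phi> x $ k $ i)" for k i
    unfolding J\<phi> by (intro smooth_add smooth_mult smooth_partial sw su0 sJ)
  have w0: "w x = 0" "partial i w x = 0" if "x \<notin> K" for x i
  proof -
    show "w x = 0" using \<omega>(2)[OF that] by (simp add: w_def)
    show "partial i w x = 0" using partial_vanishes[OF closed_K \<omega>(2) that, where i=i] by (simp add: pw)
  qed
  have bt: "boundary_test_function \<Omega> (side \<theta> h) \<phi>"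
    unfolding boundary_test_function_def
    using s\<phi> supp_inter_frontier[of \<phi>] \<omega>(2) by (auto simp: \<phi>_def)
  have con: "continuous_on UNIV (\<lambda>x. jacobian \<phi> x $ k $ i)" "continuous_on UNIV (\<lambda>x. partial i w x * u0 x $ k)"
    "continuous_on UNIV (\<lambda>x. w x * jacobian u0 x $ k $ i)" "continuous_on UNIV (\<lambda>x. w x * Q x $ k $ i)"
    "continuous_on UNIV (\<lambda>x. partial i w x * Q x $ k $ i)" "continuous_on UNIV (\<lambda>x. w x * u0 x $ k)"
    for k i
    by (intro smooth_continuous sJ\<phi> smooth_mult smooth_partial sw su0 sJ sQ)+
  have contr: "(LINT x|lebesgue_on \<Omega>. contraction (stress lam mu (A x)) (jacobian \<phi> x)) =
      (\<Sum>k\<in>UNIV. \<Sum>i\<in>UNIV. LINT x|lebesgue_on \<Omega>. stress lam mu (A x) $ k $ i * jacobian \<phi> x $ k $ i)"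
    if "A \<in> L2 \<Omega>" for A
    unfolding contraction_def
    by (subst Bochner_Integration.integral_sum;
        intro sum.cong refl Bochner_Integration.integral_sum Bochner_Integration.integrable_sum
          L2_mult_integrable[OF L2_stress[OF that] S con(1)])
  \<comment> \<open>The weak Jacobians are linked only as distributions, while \<open>q\<close> need
    not vanish at the side; hence the passage to test functions that reach the side.\<close>
  have E: "(LINT x|lebesgue_on \<Omega>. Dv x $ a $ b * q x) - (LINT x|lebesgue_on \<Omega>. Dw x $ a $ b * q x) =
      (LINT x|lebesgue_on \<Omega>. D x $ a $ b * q x)"
    if q: "smooth q" "\<And>x. x \<notin> K \<Longrightarrow> q x = 0" for a b q
  proof -
    have "(LINT x|lebesgue_on \<Omega>. (Dv x - Dw x - D x) $ a $ b * q x) = 0"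
      by (rule integral_eq_0_if_test_functions[OF _ weak q])
        (intro L2_nth L2_diff L2)
    then show ?thesis
      using L2_mult_integrable[OF L2_nth[OF L2_nth[OF L2(2)]] S smooth_continuous[OF q(1)]]
        L2_mult_integrable[OF L2_nth[OF L2_nth[OF L2(3)]] S smooth_continuous[OF q(1)]]
        L2_mult_integrable[OF L2_nth[OF L2_nth[OF L2(4)]] S smooth_continuous[OF q(1)]]
      by (simp add: left_diff_distrib)
  qed
  have E': "(LINT x|lebesgue_on \<Omega>. stress lam mu (Dv x) $ k $ i * jacobian \<phi> x $ k $ i) -
     (LINT x|lebesgue_on \<Omega>. stress lam mu (Dw x) $ k $ i * jacobian \<phi> x $ k $ i) =
     (LINT x|lebesgue_on \<Omega>. stress lam mu (D x) $ k $ i * jacobian \<phi> x $ k $ i)" for k i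
  proof -
    have j0: "jacobian \<phi> x $ k $ i = 0" if "x \<notin> K" for x using w0[OF that] by (simp add: J\<phi>)
    have e: "(LINT x|lebesgue_on \<Omega>. D x $ a $ b * jacobian \<phi> x $ k $ i) =
        (LINT x|lebesgue_on \<Omega>. Dv x $ a $ b * jacobian \<phi> x $ k $ i)
        - (LINT x|lebesgue_on \<Omega>. Dw x $ a $ b * jacobian \<phi> x $ k $ i)" for a b
      using E[OF sJ\<phi> j0, of a b] by simp
    show ?thesis
      unfolding integral_stress[OF L2(2) S con(1)] integral_stress[OF L2(3) S con(1)]
        integral_stress[OF L2(4) S con(1)] e
      by (simp add: algebra_simps)
  qed
  have "side_pairing \<theta> h g \<phi> = (\<Sum>k\<in>UNIV. \<Sum>i\<in>UNIV. LINT x|lebesgue_on \<Omega>. stress lam mu (D x) $ k $ i * jacobian \<phi> x $ k $ i)"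
    unfolding trac[OF bt, symmetric] contr[OF L2(2)] contr[OF L2(3)] sum_subtractf[symmetric] E' ..
  also have "\<dots> = (\<Sum>k\<in>UNIV. \<Sum>i\<in>UNIV. LINT x|lebesgue_on \<Omega>. stress lam mu (D x) $ k $ i * (partial i w x * u0 x $ k))
     + (\<Sum>k\<in>UNIV. \<Sum>i\<in>UNIV. LINT x|lebesgue_on \<Omega>. stress lam mu (D x) $ k $ i * (w x * jacobian u0 x $ k $ i))"
    unfolding J\<phi> distrib_left
    by (subst Bochner_Integration.integral_add)
      (intro L2_mult_integrable[OF L2_stress[OF L2(4)] S con(2)] L2_mult_integrable[OF L2_stress[OF L2(4)] S con(3)] | simp add: sum.distrib)+
  also have "(\<Sum>k\<in>UNIV. \<Sum>i\<in>UNIV. LINT x|lebesgue_on \<Omega>. stress lam mu (D x) $ k $ i * (w x * jacobian u0 x $ k $ i)) =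
     (LINT x|lebesgue_on \<Omega>. w x * contraction (stress lam mu (D x)) (jacobian u0 x))"
    by (rule integral_mult_contraction[symmetric]) (rule L2_mult_integrable[OF L2_stress[OF L2(4)] S con(3)])
  also have "\<dots> = (LINT x|lebesgue_on \<Omega>. w x * contraction (D x) (Q x))"
    by (simp only: contraction_stress Q_def)
  also have "\<dots> = (\<Sum>k\<in>UNIV. \<Sum>i\<in>UNIV. LINT x|lebesgue_on \<Omega>. D x $ k $ i * (w x * Q x $ k $ i))"
    by (rule integral_mult_contraction) (rule L2_mult_integrable[OF L2_nth[OF L2_nth[OF L2(4)]] S con(4)])
  also have "\<dots> = (\<Sum>k\<in>UNIV. \<Sum>i\<in>UNIV.
      side_normal \<sigma> \<theta> $ i *\<^sub>R (LINT r|lebesgue_on {0<..<h}. f (polar \<theta> r) $ k * (w (polar \<theta> r) * Q (polar \<theta> r) $ k $ i)))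
     - (\<Sum>k\<in>UNIV. \<Sum>i\<in>UNIV. LINT x|lebesgue_on \<Omega>. u x $ k * partial i (\<lambda>x. w x * Q x $ k $ i) x)"
  proof -
    have "(LINT x|lebesgue_on \<Omega>. D x $ k $ i * (w x * Q x $ k $ i)) =
      side_normal \<sigma> \<theta> $ i *\<^sub>R (LINT r|lebesgue_on {0<..<h}. f (polar \<theta> r) $ k * (w (polar \<theta> r) * Q (polar \<theta> r) $ k $ i))
     - (LINT x|lebesgue_on \<Omega>. u x $ k * partial i (\<lambda>x. w x * Q x $ k $ i) x)" for k i
      by (rule integration_by_parts[OF L2(1,4) L2_f U Uu UD Uf smooth_mult[OF sw sQ]]) (simp add: w0)
    then show ?thesis by (simp add: sum_subtractf)
  qed
  \<comment> \<open>The other term of the product rule contains the divergence of row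
    \<open>k\<close> of the stress of \<open>u0\<close>, which is zero by
    \<open>div0\<close>.\<close>
  also have "(\<Sum>k\<in>UNIV. \<Sum>i\<in>UNIV. LINT x|lebesgue_on \<Omega>. u x $ k * partial i (\<lambda>x. w x * Q x $ k $ i) x) =
    (\<Sum>k\<in>UNIV. \<Sum>i\<in>UNIV. LINT x|lebesgue_on \<Omega>. u x $ k * (partial i w x * Q x $ k $ i))"
  proof (rule sum.cong[OF refl])
    fix k :: 2
    have "(\<Sum>i\<in>UNIV. LINT x|lebesgue_on \<Omega>. u x $ k * partial i (\<lambda>x. w x * Q x $ k $ i) x) =
      (LINT x|lebesgue_on \<Omega>. (\<Sum>i\<in>UNIV. u x $ k * partial i (\<lambda>x. w x * Q x $ k $ i) x))"
      by (intro Bochner_Integration.integral_sum[symmetric] L2_mult_integrable[OF L2_nth[OF L2(1)] S]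
          smooth_continuous smooth_partial smooth_mult sw sQ)
    also have "(\<lambda>x. \<Sum>i\<in>UNIV. u x $ k * partial i (\<lambda>x. w x * Q x $ k $ i) x) =
      (\<lambda>x. \<Sum>i\<in>UNIV. u x $ k * (partial i w x * Q x $ k $ i))"
    proof
      fix x
      have "(\<Sum>i\<in>UNIV. u x $ k * partial i (\<lambda>x. w x * Q x $ k $ i) x) =
         (\<Sum>i\<in>UNIV. u x $ k * (partial i w x * Q x $ k $ i)) + u x $ k * w x * (\<Sum>i\<in>UNIV. partial i (\<lambda>x. Q x $ k $ i) x)"
        by (simp add: partial_mult[OF sw sQ] sum_2 algebra_simps)
      then show "(\<Sum>i\<in>UNIV. u x $ k * partial i (\<lambda>x. w x * Q x $ k $ i) x) =
         (\<Sum>i\<in>UNIV. u x $ k * (partial i w x * Q x $ k $ i))"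
        using div0[of k x] by (simp add: Q_def)
    qed
    also have "(LINT x|lebesgue_on \<Omega>. (\<Sum>i\<in>UNIV. u x $ k * (partial i w x * Q x $ k $ i))) =
      (\<Sum>i\<in>UNIV. LINT x|lebesgue_on \<Omega>. u x $ k * (partial i w x * Q x $ k $ i))"
      by (intro Bochner_Integration.integral_sum L2_mult_integrable[OF L2_nth[OF L2(1)] S con(5)])
    finally show "(\<Sum>i\<in>UNIV. LINT x|lebesgue_on \<Omega>. u x $ k * partial i (\<lambda>x. w x * Q x $ k $ i) x) =
      (\<Sum>i\<in>UNIV. LINT x|lebesgue_on \<Omega>. u x $ k * (partial i w x * Q x $ k $ i))" .
  qed
  finally have id: "side_pairing \<theta> h g \<phi> -
     (\<Sum>k\<in>UNIV. \<Sum>i\<in>UNIV.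
      side_normal \<sigma> \<theta> $ i *\<^sub>R (LINT r|lebesgue_on {0<..<h}. f (polar \<theta> r) $ k * (w (polar \<theta> r) * Q (polar \<theta> r) $ k $ i))) =
    (\<Sum>k\<in>UNIV. \<Sum>i\<in>UNIV. LINT x|lebesgue_on \<Omega>. stress lam mu (D x) $ k $ i * (partial i w x * u0 x $ k))
     - (\<Sum>k\<in>UNIV. \<Sum>i\<in>UNIV. LINT x|lebesgue_on \<Omega>. u x $ k * (partial i w x * Q x $ k $ i))"
    by (simp add: algebra_simps)
  have conI: "continuous_on UNIV (\<lambda>r. w (polar \<theta> r) * Q (polar \<theta> r) $ k $ i)"
    "continuous_on UNIV (\<lambda>r. w (polar \<theta> r) * u0 (polar \<theta> r) $ k)" for k i
    using continuous_on_compose2[OF con(4) continuous_polar] continuous_on_compose2[OF con(6) continuous_polar]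
    by auto
  have "(LINT x|lebesgue_on \<Omega>. (\<Sum>k\<in>UNIV. \<Sum>i\<in>UNIV.
       (stress lam mu (D x) $ k $ i * u0 x $ k - u x $ k * stress lam mu (jacobian u0 x) $ k $ i) * of_real (partial i \<omega> x))) =
     (LINT x|lebesgue_on \<Omega>. (\<Sum>k\<in>UNIV. \<Sum>i\<in>UNIV. stress lam mu (D x) $ k $ i * (partial i w x * u0 x $ k)
        - u x $ k * (partial i w x * Q x $ k $ i)))"
    by (simp add: pw Q_def algebra_simps)
  also have "\<dots> = (\<Sum>k\<in>UNIV. \<Sum>i\<in>UNIV. (LINT x|lebesgue_on \<Omega>. stress lam mu (D x) $ k $ i * (partial i w x * u0 x $ k))
        - (LINT x|lebesgue_on \<Omega>. u x $ k * (partial i w x * Q x $ k $ i)))"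
    using L2_mult_integrable[OF L2_stress[OF L2(4)] S con(2)] L2_mult_integrable[OF L2_nth[OF L2(1)] S con(5)]
    by (simp add: Bochner_Integration.integral_sum)
  also have "\<dots> = side_pairing \<theta> h g \<phi> -
     (\<Sum>k\<in>UNIV. \<Sum>i\<in>UNIV.
      side_normal \<sigma> \<theta> $ i *\<^sub>R (LINT r|lebesgue_on {0<..<h}. f (polar \<theta> r) $ k * (w (polar \<theta> r) * Q (polar \<theta> r) $ k $ i)))"
    unfolding id by (simp add: sum_subtractf)
  also have "side_pairing \<theta> h g \<phi> = (LINT r|lebesgue_on {0<..<h}. (\<Sum>k\<in>UNIV. g (polar \<theta> r) $ k * (w (polar \<theta> r) * u0 (polar \<theta> r) $ k)))"
    by (simp add: side_pairing_def scalar_product_def \<phi>_def w_def scaleR_conv_of_real[where 'a=complex])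
  also have "\<dots> - (\<Sum>k\<in>UNIV. \<Sum>i\<in>UNIV.
      side_normal \<sigma> \<theta> $ i *\<^sub>R (LINT r|lebesgue_on {0<..<h}. f (polar \<theta> r) $ k * (w (polar \<theta> r) * Q (polar \<theta> r) $ k $ i))) =
    (LINT r|lebesgue_on {0<..<h}. (\<Sum>k\<in>UNIV. g (polar \<theta> r) $ k * (w (polar \<theta> r) * u0 (polar \<theta> r) $ k)) -
     (\<Sum>k\<in>UNIV. \<Sum>i\<in>UNIV. side_normal \<sigma> \<theta> $ i *\<^sub>R (f (polar \<theta> r) $ k * (w (polar \<theta> r) * Q (polar \<theta> r) $ k $ i))))"
    using L2_mult_integrable[OF L2_nth[OF L2_f] I conI(1)] L2_mult_integrable[OF L2_nth[OF L2_g] I conI(2)]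
    by (simp add: Bochner_Integration.integral_sum)
  also have "\<dots> = (LINT r|lebesgue_on {0<..<h}. (scalar_product (g (polar \<theta> r)) (u0 (polar \<theta> r)) -
       (\<Sum>k\<in>UNIV. \<Sum>i\<in>UNIV. f (polar \<theta> r) $ k * stress lam mu (jacobian u0 (polar \<theta> r)) $ k $ i * of_real (side_normal \<sigma> \<theta> $ i)))
       * of_real (\<omega> (polar \<theta> r)))"
    by (simp add: scalar_product_def sum_2 w_def Q_def scaleR_conv_of_real[where 'a=complex] algebra_simps)
  finally show ?thesis .
qed

end

section \<open>The sector\<close>

lemma step_reflect: "step (1 - t) = 1 - step t"
  using step_denominator_pos[of t] by (simp add: step_def field_simps)

section \<open>Coordinates along and across a direction, and the sector in them\<close>

definition along :: "real \<Rightarrow> real^2 \<Rightarrow> real" where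
  "along \<theta> x = x \<bullet> polar \<theta> 1"

definition across :: "real \<Rightarrow> real^2 \<Rightarrow> real" where
  "across \<theta> x = x \<bullet> side_normal 1 \<theta>"

lemma along_eq: "along \<theta> x = x $ 1 * cos \<theta> + x $ 2 * sin \<theta>"
  and across_eq: "across \<theta> x = x $ 2 * cos \<theta> - x $ 1 * sin \<theta>"
  by (simp_all add: along_def across_def inner_real_2 polar_def side_normal_def vector_2_nth)

lemma along_polar: "along \<theta> (polar (\<theta> + \<beta>) r) = r * cos \<beta>"
  and across_polar: "across \<theta> (polar (\<theta> + \<beta>) r) = r * sin \<beta>"
proof -
  have "along \<theta> (polar (\<theta> + \<beta>) r) = r * cos (\<theta> + \<beta> - \<theta>)"
    unfolding cos_diff by (simp add: along_eq polar_def vector_2_nth algebra_simps)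
  then show "along \<theta> (polar (\<theta> + \<beta>) r) = r * cos \<beta>" by simp
  have "across \<theta> (polar (\<theta> + \<beta>) r) = r * sin (\<theta> + \<beta> - \<theta>)"
    unfolding sin_diff by (simp add: across_eq polar_def vector_2_nth algebra_simps)
  then show "across \<theta> (polar (\<theta> + \<beta>) r) = r * sin \<beta>" by simp
qed

lemma vec_2_eqI_coords:
  assumes "along \<theta> x = along \<theta> y" "across \<theta> x = across \<theta> y"
  shows "x = y"
proof -
  have *: "z $ 1 = along \<theta> z * cos \<theta> - across \<theta> z * sin \<theta> \<and> z $ 2 = along \<theta> z * sin \<theta> + across \<theta> z * cos \<theta>" for z
  proof -
    have "along \<theta> z * cos \<theta> - across \<theta> z * sin \<theta> = z $ 1 * ((sin \<theta>)\<^sup>2 + (cos \<theta>)\<^sup>2)"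
      "along \<theta> z * sin \<theta> + across \<theta> z * cos \<theta> = z $ 2 * ((sin \<theta>)\<^sup>2 + (cos \<theta>)\<^sup>2)"
      by (simp_all add: along_eq across_eq power2_eq_square algebra_simps del: sin_cos_squared_add3)
    then show ?thesis by simp
  qed
  show ?thesis using *[of x] *[of y] assms by (simp add: vec_eq_iff forall_2)
qed

lemma norm_coords: "(norm x)\<^sup>2 = (along \<theta> x)\<^sup>2 + (across \<theta> x)\<^sup>2"
proof -
  have "(along \<theta> x)\<^sup>2 + (across \<theta> x)\<^sup>2 = ((sin \<theta>)\<^sup>2 + (cos \<theta>)\<^sup>2) * (x $ 1 * x $ 1 + x $ 2 * x $ 2)"
    by (simp add: along_eq across_eq power2_eq_square algebra_simps del: sin_cos_squared_add3)
  then show ?thesis by (simp add: power2_norm_eq_inner inner_real_2)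
qed

lemma norm_polar: "norm (polar \<theta> r) = \<bar>r\<bar>"
proof -
  have "(norm (polar \<theta> r))\<^sup>2 = \<bar>r\<bar>\<^sup>2"
    using norm_coords[of "polar \<theta> r" \<theta>] along_polar[of \<theta> 0 r] across_polar[of \<theta> 0 r] by simp
  then show ?thesis by (metis abs_ge_zero norm_ge_zero power2_eq_iff_nonneg)
qed

lemma inner_side_normal:
  assumes "\<sigma> \<in> {1, -1}"
  shows "x \<bullet> side_normal \<sigma> (\<theta> + \<sigma> * \<alpha>) = \<sigma> * cos \<alpha> * across \<theta> x - sin \<alpha> * along \<theta> x"
  using assms
  by (auto simp: inner_real_2 side_normal_def vector_2_nth along_eq across_eq sin_add cos_add sin_diff cos_diff algebra_simps)

text \<open>Here \<theta>0 is the direction of the bisector and \<alpha> half the opening angle. The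
  bound \<alpha> < pi / 2 makes the bisector coordinate comparable to the distance from the vertex
  within the sector.\<close>

locale convex_sector =
  fixes \<theta>0 \<alpha> h :: real
  assumes \<alpha>: "0 < \<alpha>" "\<alpha> < pi / 2" and h: "0 < h"
begin

definition \<Omega> :: "(real^2) set" where "\<Omega> = sector (\<theta>0 - \<alpha>) (\<theta>0 + \<alpha>) h"

abbreviation "x1 \<equiv> along \<theta>0"
abbreviation "x2 \<equiv> across \<theta>0"

text \<open>In the closed sector |x| cos \<alpha> is at most the bisector coordinate. Cutoffs
  supported where that coordinate is at most 2 \<delta> therefore stay within |x| <= h/2, away from
  the arc.\<close>

definition \<delta> :: real where "\<delta> = h * cos \<alpha> / 4"

lemma cos_pos: "0 < cos \<alpha>" and sin_pos: "0 < sin \<alpha>"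
  using \<alpha> by (auto intro: cos_gt_zero sin_gt_zero2)

lemma \<delta>_pos: "0 < \<delta>" using cos_pos h by (simp add: \<delta>_def)

text \<open>With \<beta> the angle from the bisector, the two inequalities hidden in the absolute
  value are sin (\<alpha> - \<beta>) > 0 and sin (\<alpha> + \<beta>) > 0. Conversely \<beta> is the
  arctangent of the slope.\<close>

lemma sector_eq: "\<Omega> = {x. \<bar>x2 x\<bar> * cos \<alpha> < x1 x * sin \<alpha> \<and> norm x < h}"
proof (intro equalityI subsetI)
  fix x assume "x \<in> \<Omega>"
  then obtain \<theta> r where x: "x = polar \<theta> r" "\<theta>0 - \<alpha> < \<theta>" "\<theta> < \<theta>0 + \<alpha>" "0 < r" "r < h"
    by (auto simp: \<Omega>_def sector_def)
  define \<beta> where "\<beta> = \<theta> - \<theta>0"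
  have \<beta>: "-\<alpha> < \<beta>" "\<beta> < \<alpha>" and x': "x = polar (\<theta>0 + \<beta>) r" using x by (auto simp: \<beta>_def)
  have "sin (\<alpha> - \<beta>) > 0" "sin (\<alpha> + \<beta>) > 0" using \<beta> \<alpha> by (auto intro!: sin_gt_zero)
  then have "r * (sin \<alpha> * cos \<beta> - cos \<alpha> * sin \<beta>) > 0" "r * (sin \<alpha> * cos \<beta> + cos \<alpha> * sin \<beta>) > 0"
    using x(4) by (simp_all add: sin_diff sin_add)
  then have "\<bar>x2 x\<bar> * cos \<alpha> < x1 x * sin \<alpha>"
    using x(4) unfolding x' along_polar across_polar by (auto simp: abs_if algebra_simps)
  moreover have "norm x < h" using x by (simp add: norm_polar)
  ultimately show "x \<in> {x. \<bar>x2 x\<bar> * cos \<alpha> < x1 x * sin \<alpha> \<and> norm x < h}" by simp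
next
  fix x assume "x \<in> {x. \<bar>x2 x\<bar> * cos \<alpha> < x1 x * sin \<alpha> \<and> norm x < h}"
  then have x: "\<bar>x2 x\<bar> * cos \<alpha> < x1 x * sin \<alpha>" "norm x < h" by auto
  have "0 \<le> \<bar>x2 x\<bar> * cos \<alpha>" using cos_pos by simp
  then have "0 < x1 x * sin \<alpha>" using x(1) by linarith
  then have x1: "0 < x1 x" using sin_pos by (simp add: zero_less_mult_iff)
  define y where "y = x2 x / x1 x"
  define \<beta> where "\<beta> = arctan y"
  have "\<bar>y\<bar> < tan \<alpha>" using x(1) x1 cos_pos by (simp add: y_def tan_def field_simps)
  then have "\<bar>\<beta>\<bar> < \<alpha>"
    using arctan_less_iff[of y "tan \<alpha>"] arctan_less_iff[of "-y" "tan \<alpha>"] arctan_tan[of \<alpha>] \<alpha>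
    by (auto simp: \<beta>_def abs_less_iff arctan_minus)
  define r where "r = x1 x * sqrt (1 + y\<^sup>2)"
  have sq: "sqrt (1 + y\<^sup>2) > 0" by (simp add: add_pos_nonneg)
  have "x = polar (\<theta>0 + \<beta>) r"
    by (rule vec_2_eqI_coords[of \<theta>0], unfold along_polar across_polar)
      (use sq x1 in \<open>auto simp: r_def \<beta>_def cos_arctan sin_arctan y_def\<close>)
  moreover have "0 < r" using sq x1 by (simp add: r_def)
  moreover have "r < h" using x(2) \<open>0 < r\<close> \<open>x = polar (\<theta>0 + \<beta>) r\<close> by (simp add: norm_polar)
  ultimately show "x \<in> \<Omega>"
    using \<open>\<bar>\<beta>\<bar> < \<alpha>\<close> unfolding \<Omega>_def sector_def by (intro CollectI exI[of _ "\<theta>0 + \<beta>"] exI[of _ r]) auto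
qed

lemma x1_pos: "x \<in> \<Omega> \<Longrightarrow> 0 < x1 x"
  using sin_pos cos_pos unfolding sector_eq
  by (smt (verit, ccfv_threshold) abs_ge_zero mem_Collect_eq mult_nonneg_nonneg zero_less_mult_iff)

lemma linear_coords: "bounded_linear x1" "bounded_linear x2"
  unfolding along_def[abs_def] across_def[abs_def] by (rule bounded_linear_inner_left)+

lemma continuous_coords: "continuous_on S x1" "continuous_on S x2"
  by (rule linear_continuous_on[OF linear_coords(1)], rule linear_continuous_on[OF linear_coords(2)])

lemma open_\<Omega>: "open \<Omega>"
proof -
  have "\<Omega> = {x. \<bar>x2 x\<bar> * cos \<alpha> < x1 x * sin \<alpha>} \<inter> {x. norm x < h}" unfolding sector_eq by auto
  also have "open \<dots>"
    by (intro open_Int open_Collect_less continuous_intros continuous_coords)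
  finally show ?thesis .
qed

lemma bounded_\<Omega>: "bounded \<Omega>"
  unfolding sector_eq bounded_iff by (auto intro!: exI[of _ h])

lemma lmeasurable_\<Omega>: "\<Omega> \<in> lmeasurable"
  using bounded_\<Omega> open_\<Omega> by (simp add: bounded_set_imp_lmeasurable)

lemma norm_le_x1:
  assumes "\<bar>x2 x\<bar> * cos \<alpha> \<le> x1 x * sin \<alpha>" "0 \<le> x1 x"
  shows "norm x * cos \<alpha> \<le> x1 x"
proof -
  have "(\<bar>x2 x\<bar> * cos \<alpha>)\<^sup>2 \<le> (x1 x * sin \<alpha>)\<^sup>2"
    using assms cos_pos by (intro power_mono) auto
  then have le: "(x2 x)\<^sup>2 * (cos \<alpha>)\<^sup>2 \<le> (x1 x)\<^sup>2 * (sin \<alpha>)\<^sup>2"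
    by (simp only: power_mult_distrib power2_abs)
  have "(norm x * cos \<alpha>)\<^sup>2 = (x1 x)\<^sup>2 * (cos \<alpha>)\<^sup>2 + (x2 x)\<^sup>2 * (cos \<alpha>)\<^sup>2"
    by (simp only: power_mult_distrib norm_coords[of x \<theta>0] distrib_right)
  also have "\<dots> \<le> (x1 x)\<^sup>2 * (cos \<alpha>)\<^sup>2 + (x1 x)\<^sup>2 * (sin \<alpha>)\<^sup>2" using le by (rule add_left_mono)
  also have "\<dots> = (x1 x)\<^sup>2 * ((sin \<alpha>)\<^sup>2 + (cos \<alpha>)\<^sup>2)" by (simp only: distrib_left add.commute)
  also have "\<dots> = (x1 x)\<^sup>2" by simp
  finally have "(norm x * cos \<alpha>)\<^sup>2 \<le> (x1 x)\<^sup>2" .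
  then show ?thesis using assms(2) by (rule power2_le_imp_le)
qed

text \<open>Where the bisector coordinate is at least \<epsilon>, points of the opposite side
  satisfy \<sigma> x2 cos \<alpha> = - x1 sin \<alpha> <= - \<epsilon> sin \<alpha>. The threshold
  is half of that bound, so this set avoids the opposite side as well as the vertex.\<close>

definition K :: "real \<Rightarrow> real \<Rightarrow> (real^2) set" where
  "K \<epsilon> \<sigma> = {x. \<epsilon> \<le> x1 x \<and> x1 x \<le> 2 * \<delta> \<and> - (\<epsilon> * sin \<alpha>) / 2 \<le> \<sigma> * x2 x * cos \<alpha>}"

lemma side_neighborhood_K:
  assumes \<sigma>: "\<sigma> \<in> {1, -1}" and \<epsilon>: "\<epsilon> > 0"
  shows "side_neighborhood \<Omega> (K \<epsilon> \<sigma>) (\<theta>0 + \<sigma> * \<alpha>) \<sigma> h"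
proof
  show "\<sigma>\<^sup>2 = 1" using \<sigma> by auto
  show "\<Omega> \<subseteq> {x. x \<bullet> side_normal \<sigma> (\<theta>0 + \<sigma> * \<alpha>) < 0}"
  proof
    fix x assume "x \<in> \<Omega>"
    moreover have "\<sigma> * x2 x \<le> \<bar>x2 x\<bar>" using \<sigma> by auto
    then have "\<sigma> * x2 x * cos \<alpha> \<le> \<bar>x2 x\<bar> * cos \<alpha>" using cos_pos by (intro mult_right_mono) auto
    ultimately show "x \<in> {x. x \<bullet> side_normal \<sigma> (\<theta>0 + \<sigma> * \<alpha>) < 0}"
      unfolding inner_side_normal[OF \<sigma>] sector_eq by (simp add: mult_ac)
  qed
  have "K \<epsilon> \<sigma> = {x. \<epsilon> \<le> x1 x} \<inter> {x. x1 x \<le> 2 * \<delta>} \<inter> {x. - (\<epsilon> * sin \<alpha>) / 2 \<le> \<sigma> * x2 x * cos \<alpha>}"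
    unfolding K_def by auto
  also have "closed \<dots>"
    by (intro closed_Int closed_Collect_le continuous_intros continuous_coords)
  finally show "closed (K \<epsilon> \<sigma>)" .
  show "K \<epsilon> \<sigma> \<inter> {x. x \<bullet> side_normal \<sigma> (\<theta>0 + \<sigma> * \<alpha>) < 0} \<subseteq> \<Omega>"
  proof
    fix x assume x: "x \<in> K \<epsilon> \<sigma> \<inter> {x. x \<bullet> side_normal \<sigma> (\<theta>0 + \<sigma> * \<alpha>) < 0}"
    then have a: "\<sigma> * cos \<alpha> * x2 x < sin \<alpha> * x1 x" and b: "\<epsilon> \<le> x1 x" "x1 x \<le> 2 * \<delta>"
      "- (\<epsilon> * sin \<alpha>) / 2 \<le> \<sigma> * x2 x * cos \<alpha>"
      by (auto simp: inner_side_normal[OF \<sigma>] K_def)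
    have "\<epsilon> * sin \<alpha> \<le> x1 x * sin \<alpha>" using b(1) sin_pos by simp
    moreover have "\<epsilon> * sin \<alpha> > 0" using \<epsilon> sin_pos by simp
    ultimately have "- (\<sigma> * x2 x * cos \<alpha>) < x1 x * sin \<alpha>" using b(3) by (simp add: field_simps)
    with a have ab: "\<bar>x2 x\<bar> * cos \<alpha> < x1 x * sin \<alpha>"
      using \<sigma> by (auto simp: abs_if algebra_simps)
    have "norm x * cos \<alpha> \<le> x1 x" using ab b(1) \<epsilon> by (intro norm_le_x1) auto
    also have "\<dots> < h * cos \<alpha>" using b(2) mult_pos_pos[OF h cos_pos] by (simp add: \<delta>_def)
    finally have "norm x < h" using cos_pos by simp
    then show "x \<in> \<Omega>" using ab by (simp add: sector_eq)
  qed
  show "K \<epsilon> \<sigma> \<inter> {x. x \<bullet> side_normal \<sigma> (\<theta>0 + \<sigma> * \<alpha>) = 0} \<subseteq> side (\<theta>0 + \<sigma> * \<alpha>) h"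
  proof
    fix x assume x: "x \<in> K \<epsilon> \<sigma> \<inter> {x. x \<bullet> side_normal \<sigma> (\<theta>0 + \<sigma> * \<alpha>) = 0}"
    then have a: "\<sigma> * cos \<alpha> * x2 x = sin \<alpha> * x1 x" and b: "\<epsilon> \<le> x1 x" "x1 x \<le> 2 * \<delta>"
      by (auto simp: inner_side_normal[OF \<sigma>] K_def)
    define r where "r = x1 x / cos \<alpha>"
    have "x = polar (\<theta>0 + \<sigma> * \<alpha>) r"
      by (rule vec_2_eqI_coords[of \<theta>0], unfold along_polar across_polar)
        (use a \<sigma> cos_pos in \<open>auto simp: r_def field_simps\<close>)
    moreover have "0 < r" "r < h" using b \<epsilon> cos_pos h by (auto simp: r_def \<delta>_def field_simps)
    ultimately show "x \<in> side (\<theta>0 + \<sigma> * \<alpha>) h" by (auto simp: side_def)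
  qed
qed (rule open_\<Omega> bounded_\<Omega>)+

text \<open>All cutoffs are functions of the coordinates along and across the bisector: on the sector the
  former is comparable to the distance from the vertex, and where it is at least \<open>\<epsilon>\<close> the latter
  separates the two sides.\<close>

definition weight :: "(real \<Rightarrow> real) \<Rightarrow> real \<Rightarrow> real \<Rightarrow> real^2 \<Rightarrow> real" where
  "weight k \<epsilon> \<sigma> x = k (x1 x) * step (\<sigma> * cos \<alpha> / (\<epsilon> * sin \<alpha>) * x2 x + 1 / 2)"

lemma smooth_weight: "smooth k \<Longrightarrow> smooth (weight k \<epsilon> \<sigma>)"
proof -
  assume k: "smooth k"
  have "bounded_linear (\<lambda>x. \<sigma> * cos \<alpha> / (\<epsilon> * sin \<alpha>) * x2 x)"
    by (rule bounded_linear_const_mult[OF linear_coords(2)])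
  from smooth_comp_linear[OF smooth_step this, of "1/2"] smooth_comp_linear[OF k linear_coords(1), of 0]
  show ?thesis unfolding weight_def[abs_def] by (auto intro: smooth_mult)
qed

lemma weight_eq_0:
  assumes "\<epsilon> > 0" "\<And>t. t < \<epsilon> \<or> t > 2 * \<delta> \<Longrightarrow> k t = 0" "x \<notin> K \<epsilon> \<sigma>"
  shows "weight k \<epsilon> \<sigma> x = 0"
proof -
  consider "x1 x < \<epsilon> \<or> x1 x > 2 * \<delta>" | "\<sigma> * x2 x * cos \<alpha> < - (\<epsilon> * sin \<alpha>) / 2"
    using assms(3) by (fastforce simp: K_def)
  then show ?thesis
  proof cases
    case 2
    then have "\<sigma> * cos \<alpha> / (\<epsilon> * sin \<alpha>) * x2 x + 1 / 2 \<le> 0"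
      using assms(1) sin_pos by (simp add: field_simps)
    then show ?thesis by (simp add: weight_def step_eq_0)
  qed (use assms(2) in \<open>simp add: weight_def\<close>)
qed

text \<open>The arguments of \<open>step\<close> in the two weights lie symmetrically about 1/2, so
  by the reflection formula the transverse factors form a partition of unity.\<close>

lemma weight_sum: "weight k \<epsilon> 1 x + weight k \<epsilon> (-1) x = k (x1 x)"
proof -
  have "step (- z + 1 / 2) = 1 - step (z + 1 / 2)" for z :: real
    using step_reflect[of "z + 1 / 2"] by (simp add: algebra_simps)
  from this[of "cos \<alpha> / (\<epsilon> * sin \<alpha>) * x2 x"] show ?thesis
    unfolding weight_def distrib_left[symmetric] by simp
qed

text \<open>Where \<open>k\<close> can be nonzero on the side \<sigma>, the argument of
  \<open>step\<close> is at least 3/2, so the transverse factor is already 1.\<close>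

lemma weight_polar:
  assumes \<sigma>: "\<sigma> \<in> {1, -1}" and \<epsilon>: "\<epsilon> > 0" and k: "\<And>t. t < \<epsilon> \<or> t > 2 * \<delta> \<Longrightarrow> k t = 0"
  shows "weight k \<epsilon> \<sigma> (polar (\<theta>0 + \<sigma> * \<alpha>) r) = k (r * cos \<alpha>)"
proof (cases "r * cos \<alpha> < \<epsilon>")
  case True
  then show ?thesis using k \<sigma> unfolding weight_def along_polar by auto
next
  case False
  then have "r * cos \<alpha> / \<epsilon> \<ge> 1" using \<epsilon> by simp
  moreover have "\<sigma> * cos \<alpha> / (\<epsilon> * sin \<alpha>) * (r * sin (\<sigma> * \<alpha>)) = r * cos \<alpha> / \<epsilon>"
    using \<sigma> sin_pos \<epsilon> by (auto simp: field_simps)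
  moreover have "cos (\<sigma> * \<alpha>) = cos \<alpha>" using \<sigma> by auto
  ultimately show ?thesis unfolding weight_def along_polar across_polar by (simp add: step_eq_1)
qed

text \<open>Each transverse factor has slope of order 1/\<epsilon> on a strip of width of order
  \<epsilon>, where square integrability gives no uniform bound. In the sum these slopes cancel and
  the gradient points along the bisector.\<close>

lemma partial_weight_sum:
  assumes "smooth k" "\<And>t. (k has_field_derivative k' t) (at t)"
  shows "partial i (weight k \<epsilon> 1) x + partial i (weight k \<epsilon> (-1)) x = k' (x1 x) * polar \<theta>0 1 $ i"
proof -
  have D: "(weight k \<epsilon> \<sigma> has_derivative frechet_derivative (weight k \<epsilon> \<sigma>) (at x)) (at x)" for \<sigma>
    by (rule smooth_has_derivative[OF smooth_weight[OF assms(1)]])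
  have eq: "(\<lambda>x. weight k \<epsilon> 1 x + weight k \<epsilon> (-1) x) = (\<lambda>x. k (x1 x))" using weight_sum by blast
  have "((\<lambda>x. k (x1 x)) has_derivative (\<lambda>v. x1 v * k' (x1 x))) (at x)"
    using has_derivative_compose[OF bounded_linear_imp_has_derivative[OF linear_coords(1)]
        assms(2)[unfolded has_field_derivative_def]] by (simp add: mult.commute)
  from has_derivative_unique[OF this has_derivative_add[OF D[of 1] D[of "-1"], unfolded eq]]
  have "x1 (axis i 1) * k' (x1 x) = partial i (weight k \<epsilon> 1) x + partial i (weight k \<epsilon> (-1)) x"
    unfolding partial_def by (rule fun_cong)
  moreover have "x1 (axis i 1) = polar \<theta>0 1 $ i"
    by (simp add: along_def inner_axis')
  ultimately show ?thesis by (simp add: mult.commute)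
qed

end

section \<open>Green's formula for fields that do not vanish at the vertex\<close>

text \<open>The interior integrand of Green's second formula with the gradient of the cutoff
  replaced by a fixed vector \<open>d\<close>: after the cancellation only multiples of the bisector
  direction occur.\<close>

definition interior_density :: "real \<Rightarrow> real \<Rightarrow> (real^2 \<Rightarrow> complex^2) \<Rightarrow> (real^2 \<Rightarrow> complex^2) \<Rightarrow>
    (real^2 \<Rightarrow> complex^2^2) \<Rightarrow> real^2 \<Rightarrow> real^2 \<Rightarrow> complex" where
  "interior_density lam mu u0 u D d x = (\<Sum>k\<in>UNIV. \<Sum>i\<in>UNIV.
     (stress lam mu (D x) $ k $ i * u0 x $ k - u x $ k * stress lam mu (jacobian u0 x) $ k $ i) * of_real (d $ i))"

definition boundary_density :: "real \<Rightarrow> real \<Rightarrow> (real^2 \<Rightarrow> complex^2) \<Rightarrow> (real^2 \<Rightarrow> complex^2) \<Rightarrow>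
    (real^2 \<Rightarrow> complex^2) \<Rightarrow> real^2 \<Rightarrow> real^2 \<Rightarrow> complex" where
  "boundary_density lam mu u0 f g \<nu> x = scalar_product (g x) (u0 x) -
     (\<Sum>k\<in>UNIV. \<Sum>i\<in>UNIV. f x $ k * stress lam mu (jacobian u0 x) $ k $ i * of_real (\<nu> $ i))"

text \<open>\<open>D\<close> is a separate argument, so that \<open>u\<close> can be shifted by a
  constant while the weak Jacobian, which is fixed by choice, stays the same.\<close>

definition trace_approx :: "(real^2) set \<Rightarrow> real \<Rightarrow> real \<Rightarrow> (real^2 \<Rightarrow> complex^2) \<Rightarrow> (real^2 \<Rightarrow> complex^2^2) \<Rightarrow>
    (real^2 \<Rightarrow> complex^2) \<Rightarrow> bool" where
  "trace_approx \<Omega> \<theta> h u D f \<longleftrightarrow> (\<exists>U. (\<forall>n::nat. smooth (U n)) \<and>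
        (\<lambda>n. L2_sq \<Omega> (\<lambda>x. U n x - u x)) \<longlonglongrightarrow> 0 \<and>
        (\<lambda>n. L2_sq \<Omega> (\<lambda>x. jacobian (U n) x - D x)) \<longlonglongrightarrow> 0 \<and>
        (\<lambda>n. L2_sq {0<..<h} (\<lambda>r. U n (polar \<theta> r) - f (polar \<theta> r))) \<longlonglongrightarrow> 0)"

lemma smooth_stress_jacobian:
  assumes "smooth u0"
  shows "smooth (\<lambda>x. stress lam mu (jacobian u0 x) $ k $ i)"
proof -
  have sJ: "smooth (\<lambda>x. jacobian u0 x $ k $ i)" for k i
    unfolding jacobian_def by (simp add: partial_nth[OF assms] smooth_partial smooth_vec_nth[OF assms])
  have "smooth (\<lambda>x. of_real lam * (jacobian u0 x $ 1 $ 1 + jacobian u0 x $ 2 $ 2))"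
    "smooth (\<lambda>x. of_real mu * (jacobian u0 x $ k $ i + jacobian u0 x $ i $ k))"
    by (intro smooth_mult smooth_const smooth_add sJ)+
  then show ?thesis unfolding stress_nth by (cases "k = i") (auto intro: smooth_add smooth_const)
qed

lemma L2_interior_density:
  assumes "u \<in> L2 S" "D \<in> L2 S" "smooth u0" "bounded S"
  shows "(\<lambda>x. interior_density lam mu u0 u D d x) \<in> L2 S"
proof -
  have c: "continuous_on UNIV (\<lambda>x. u0 x $ k * of_real (d $ i))"
    "continuous_on UNIV (\<lambda>x. stress lam mu (jacobian u0 x) $ k $ i * of_real (d $ i))" for k i
    by (intro smooth_continuous smooth_mult smooth_const smooth_vec_nth smooth_stress_jacobian assms)+
  have "(\<lambda>x. (stress lam mu (D x) $ k $ i * u0 x $ k - u x $ k * stress lam mu (jacobian u0 x) $ k $ i) * of_real (d $ i)) \<in> L2 S" for k i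
  proof -
    have "(\<lambda>x. stress lam mu (D x) $ k $ i * (u0 x $ k * of_real (d $ i))) \<in> L2 S"
      "(\<lambda>x. u x $ k * (stress lam mu (jacobian u0 x) $ k $ i * of_real (d $ i))) \<in> L2 S"
      by (intro L2_mult_continuous L2_stress L2_nth assms c)+
    from L2_diff[OF this] show ?thesis by (simp add: left_diff_distrib mult.assoc)
  qed
  then show ?thesis unfolding interior_density_def sum_2 by (intro L2_add)
qed

context convex_sector
begin

text \<open>The derivative of the cutoff at the vertex is of size \<open>n\<close> on a set of area \<open>O(1 / n\<^sup>2)\<close>, so its
  contribution vanishes because \<open>M\<close> is square integrable.\<close>

lemma cutoff_limit:
  fixes M :: "real^2 \<Rightarrow> complex" and N :: "real \<Rightarrow> real \<Rightarrow> complex" and \<eta> \<eta>' :: "real \<Rightarrow> real"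
  assumes M: "M \<in> L2 \<Omega>" and N: "\<And>\<sigma>. \<sigma> \<in> {1, -1} \<Longrightarrow> integrable (lebesgue_on {0<..<h}) (N \<sigma>)"
    and id: "\<And>k k' \<epsilon>. \<epsilon> > 0 \<Longrightarrow> smooth k \<Longrightarrow> (\<And>t. (k has_field_derivative k' t) (at t)) \<Longrightarrow>
        (\<And>t. t < \<epsilon> \<or> t > 2 * \<delta> \<Longrightarrow> k t = 0) \<Longrightarrow>
      (LINT x|lebesgue_on \<Omega>. M x * of_real (k' (x1 x))) =
      (\<Sum>\<sigma>\<in>{1, -1}. LINT r|lebesgue_on {0<..<h}. N \<sigma> r * of_real (k (r * cos \<alpha>)))"
    and \<eta>: "smooth \<eta>" "\<And>t. (\<eta> has_field_derivative \<eta>' t) (at t)" "continuous_on UNIV \<eta>'"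
      "\<And>t. t > 2 * \<delta> \<Longrightarrow> \<eta> t = 0"
  shows "(LINT x|lebesgue_on \<Omega>. M x * of_real (\<eta>' (x1 x))) =
    (\<Sum>\<sigma>\<in>{1, -1}. LINT r|lebesgue_on {0<..<h}. N \<sigma> r * of_real (\<eta> (r * cos \<alpha>)))"
proof -
  let ?I = "\<lambda>p. LINT x|lebesgue_on \<Omega>. M x * of_real (p (x1 x))"
  let ?J = "\<lambda>\<sigma> p. LINT r|lebesgue_on {0<..<h}. N \<sigma> r * of_real (p (r * cos \<alpha>))"
  note S = bounded_\<Omega> lmeasurable_\<Omega>
  \<comment> \<open>\<open>a n\<close> is 0 up to 1/(n + 1) and 1 from 2/(n + 1) on;
    \<open>b n\<close> is its derivative.\<close>
  define a where "a n t = step (real (Suc n) * t + (-1))" for n t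
  define b where "b n t = real (Suc n) * step' (real (Suc n) * t + (-1))" for n t
  have sa: "smooth (a n)" for n
    unfolding a_def by (intro smooth_comp_linear smooth_step bounded_linear_mult_right)
  have sb: "smooth (b n)" for n
    unfolding b_def by (intro smooth_mult smooth_const smooth_comp_linear smooth_step' bounded_linear_mult_right)
  have der: "((\<lambda>t. a n t * \<eta> t) has_field_derivative (b n t * \<eta> t + a n t * \<eta>' t)) (at t)" for n t
    unfolding a_def b_def
    by (auto intro!: derivative_eq_intros DERIV_chain2[OF step_DERIV] \<eta>(2))
  have cx1: "continuous_on UNIV (\<lambda>x. p (x1 x))" if "continuous_on UNIV p" for p :: "real \<Rightarrow> real"
    by (rule continuous_on_compose2[OF that continuous_coords(1)]) simp
  have a1: "eventually (\<lambda>n. a n t = 1) sequentially" if "t > 0" for t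
  proof -
    obtain m :: nat where m: "real m * t > 2" using reals_Archimedean3[OF \<open>t > 0\<close>] by blast
    show ?thesis using eventually_ge_at_top[of m]
    proof (rule eventually_mono)
      fix n assume "m \<le> n"
      then have "real m * t \<le> real (Suc n) * t" using that by (intro mult_right_mono) auto
      then show "a n t = 1" using m unfolding a_def by (intro step_eq_1) linarith
    qed
  qed
  have abs_a: "\<bar>a n t\<bar> \<le> 1" for n t
    using step_nonneg step_le_1 by (auto simp: a_def abs_le_iff intro: order_trans[of _ 0])
  have id_n: "(?I (\<lambda>t. b n t * \<eta> t + a n t * \<eta>' t)) =
      (\<Sum>\<sigma>\<in>{1, -1}. ?J \<sigma> (\<lambda>t. a n t * \<eta> t))" for n
  \<comment> \<open>The identity is used with \<epsilon> = 1/(n + 1), below which \<open>a n\<close>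
    vanishes.\<close>
  proof (rule id[OF _ smooth_mult[OF sa \<eta>(1)] der])
    show "inverse (real (Suc n)) > 0" by simp
    fix t assume "t < inverse (real (Suc n)) \<or> t > 2 * \<delta>"
    then show "a n t * \<eta> t = 0"
    proof
      assume "t < inverse (real (Suc n))"
      then have "real (Suc n) * t < 1" by (simp add: field_simps)
      then show ?thesis by (simp add: a_def step_eq_0)
    qed (simp add: \<eta>(4))
  qed
  have lhs1: "(\<lambda>n. ?I (\<lambda>t. a n t * \<eta>' t)) \<longlonglongrightarrow>
      (?I \<eta>')"
  proof (rule integral_dominated_convergence[where w="\<lambda>x. norm (M x * of_real (\<eta>' (x1 x)))"])
    show "(\<lambda>x. M x * of_real (\<eta>' (x1 x))) \<in> borel_measurable (lebesgue_on \<Omega>)"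
      "integrable (lebesgue_on \<Omega>) (\<lambda>x. norm (M x * of_real (\<eta>' (x1 x))))"
      using L2_mult_integrable[OF M S continuous_on_of_real[OF cx1[OF \<eta>(3)]]] by auto
    show "(\<lambda>x. M x * of_real (a n (x1 x) * \<eta>' (x1 x))) \<in> borel_measurable (lebesgue_on \<Omega>)" for n
      by (rule borel_measurable_integrable, rule L2_mult_integrable[OF M S])
        (intro continuous_on_of_real cx1 continuous_on_mult smooth_continuous[OF sa] \<eta>(3))
    show "AE x in lebesgue_on \<Omega>. (\<lambda>n. M x * of_real (a n (x1 x) * \<eta>' (x1 x))) \<longlonglongrightarrow> M x * of_real (\<eta>' (x1 x))"
    proof (rule AE_I2)
      fix x assume "x \<in> space (lebesgue_on \<Omega>)"
      then have "x1 x > 0" using x1_pos by simp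
      show "(\<lambda>n. M x * of_real (a n (x1 x) * \<eta>' (x1 x))) \<longlonglongrightarrow> M x * of_real (\<eta>' (x1 x))"
        by (rule tendsto_eventually) (use a1[OF \<open>x1 x > 0\<close>] in \<open>rule eventually_mono, simp\<close>)
    qed
    show "AE x in lebesgue_on \<Omega>. norm (M x * of_real (a n (x1 x) * \<eta>' (x1 x))) \<le> norm (M x * of_real (\<eta>' (x1 x)))" for n
      using abs_a by (intro AE_I2) (simp add: norm_mult abs_mult mult_left_le_one_le mult_left_mono)
  qed
  have rhs: "(\<lambda>n. ?J \<sigma> (\<lambda>t. a n t * \<eta> t)) \<longlonglongrightarrow>
     ?J \<sigma> \<eta>" if \<sigma>: "\<sigma> \<in> {1, -1}" for \<sigma>
  proof -
    have cr: "continuous_on UNIV (\<lambda>r. complex_of_real (p (r * cos \<alpha>)))" if "continuous_on UNIV p" for p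
      by (intro continuous_on_of_real continuous_on_compose2[OF that] continuous_intros) simp
    have mr: "(\<lambda>r. N \<sigma> r * of_real (p (r * cos \<alpha>))) \<in> borel_measurable (lebesgue_on {0<..<h})"
      if "continuous_on UNIV p" for p
      using borel_measurable_integrable[OF N[OF \<sigma>]] measurable_lebesgue_on_continuous[OF cr[OF that]] by simp
    have c\<eta>: "continuous_on UNIV \<eta>" by (rule smooth_continuous[OF \<eta>(1)])
    obtain B where B: "\<And>r. r \<in> {0<..<h} \<Longrightarrow> norm (complex_of_real (\<eta> (r * cos \<alpha>))) \<le> B"
      using bounded_on_continuous[OF cr[OF c\<eta>], of "{0<..<h}"] by (metis bounded_Ioo)
    show ?thesis
    proof (rule integral_dominated_convergence[where w="\<lambda>r. norm (N \<sigma> r) * B"])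
      show "integrable (lebesgue_on {0<..<h}) (\<lambda>r. norm (N \<sigma> r) * B)" using N[OF \<sigma>] by simp
      show "AE r in lebesgue_on {0<..<h}. (\<lambda>n. N \<sigma> r * of_real (a n (r * cos \<alpha>) * \<eta> (r * cos \<alpha>)))
         \<longlonglongrightarrow> N \<sigma> r * of_real (\<eta> (r * cos \<alpha>))"
      proof (rule AE_I2)
        fix r assume "r \<in> space (lebesgue_on {0<..<h})"
        then have "r * cos \<alpha> > 0" using cos_pos by simp
        show "(\<lambda>n. N \<sigma> r * of_real (a n (r * cos \<alpha>) * \<eta> (r * cos \<alpha>))) \<longlonglongrightarrow> N \<sigma> r * of_real (\<eta> (r * cos \<alpha>))"
          by (rule tendsto_eventually) (use a1[OF \<open>r * cos \<alpha> > 0\<close>] in \<open>rule eventually_mono, simp\<close>)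
      qed
      show "AE r in lebesgue_on {0<..<h}. norm (N \<sigma> r * of_real (a n (r * cos \<alpha>) * \<eta> (r * cos \<alpha>))) \<le> norm (N \<sigma> r) * B" for n
      proof (rule AE_I2)
        fix r assume "r \<in> space (lebesgue_on {0<..<h})"
        then have "\<bar>\<eta> (r * cos \<alpha>)\<bar> \<le> B" using B by simp
        then have "\<bar>a n (r * cos \<alpha>)\<bar> * \<bar>\<eta> (r * cos \<alpha>)\<bar> \<le> 1 * B"
          using abs_a by (intro mult_mono) auto
        then show "norm (N \<sigma> r * of_real (a n (r * cos \<alpha>) * \<eta> (r * cos \<alpha>))) \<le> norm (N \<sigma> r) * B"
          unfolding norm_mult norm_of_real abs_mult by (intro mult_left_mono) auto
      qed
    qed (use mr[OF c\<eta>] mr[OF continuous_on_mult[OF smooth_continuous[OF sa] c\<eta>]] in auto)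
  qed
  have lhs2: "(\<lambda>n. ?I (\<lambda>t. b n t * \<eta> t)) \<longlonglongrightarrow> 0"
  proof -
    obtain B where B: "B > 0" "\<And>t. \<bar>step' t\<bar> \<le> B" using step'_bounded by blast
    obtain C where C: "C > 0" "\<And>x. x \<in> \<Omega> \<Longrightarrow> norm (\<eta> (x1 x)) \<le> C"
      using bounded_on_continuous[OF cx1[OF smooth_continuous[OF \<eta>(1)]] bounded_\<Omega>] by blast
    \<comment> \<open>On the rest of the sector the factor \<open>b n\<close> is zero. By comparison
      with the distance from the vertex, \<open>A n\<close> lies in a ball of radius 2 / ((n + 1)
      cos \<alpha>); \<open>V\<close> is the area of that ball times (n + 1)^2.\<close>
    define A where "A n = \<Omega> \<inter> {x. real (Suc n) * x1 x \<le> 2}" for n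
    define V where "V = unit_ball_vol (real DIM(real^2)) * (2 / cos \<alpha>)\<^sup>2"
    have V: "V \<ge> 0" by (simp add: V_def)
    have A_sets: "A n \<in> sets lebesgue" for n
    proof -
      have "closed {x. real (Suc n) * x1 x \<le> 2}"
        by (intro closed_Collect_le continuous_intros continuous_coords)
      then show ?thesis unfolding A_def using open_\<Omega> by (intro sets.Int) auto
    qed
    have A_meas: "measure lebesgue (A n) * (real (Suc n))\<^sup>2 \<le> V" for n
    proof -
      have sub: "A n \<subseteq> cball 0 (2 / cos \<alpha> / real (Suc n))"
      proof
        fix x assume x: "x \<in> A n"
        then have "x \<in> \<Omega>" "real (Suc n) * x1 x \<le> 2" by (auto simp: A_def)
        have "norm x * cos \<alpha> \<le> x1 x"
          using \<open>x \<in> \<Omega>\<close> x1_pos[OF \<open>x \<in> \<Omega>\<close>] by (intro norm_le_x1) (auto simp: sector_eq)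
        then have "real (Suc n) * (norm x * cos \<alpha>) \<le> real (Suc n) * x1 x" by (intro mult_left_mono) auto
        with \<open>real (Suc n) * x1 x \<le> 2\<close> have "real (Suc n) * (norm x * cos \<alpha>) \<le> 2" by linarith
        then show "x \<in> cball 0 (2 / cos \<alpha> / real (Suc n))"
          using cos_pos by (simp add: pos_le_divide_eq mult_ac del: of_nat_Suc)
      qed
      have "measure lebesgue (A n) \<le> measure lebesgue (cball (0::real^2) (2 / cos \<alpha> / real (Suc n)))"
        by (rule measure_mono_fmeasurable[OF sub A_sets]) simp
      also have "\<dots> = unit_ball_vol (real DIM(real^2)) * (2 / cos \<alpha> / real (Suc n)) ^ DIM(real^2)"
        using content_cball[of "2 / cos \<alpha> / real (Suc n)" "0 :: real^2"] cos_pos by simp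
      also have "\<dots> = V / (real (Suc n))\<^sup>2"
        by (simp add: V_def power_divide power2_eq_square del: of_nat_Suc)
      finally show ?thesis by (simp add: field_simps del: of_nat_Suc)
    qed
    \<comment> \<open>The squared L2 mass of \<open>M\<close> on the shrinking sets. Size n on area
      1/n^2 only gives a bounded contribution; that this mass tends to 0 turns it into a null
      sequence.\<close>
    define J where "J n = (LINT x|lebesgue_on \<Omega>. indicator (A n) x * (norm (M x))\<^sup>2)" for n
    have M2: "integrable (lebesgue_on \<Omega>) (\<lambda>x. (norm (M x))\<^sup>2)" "M \<in> borel_measurable (lebesgue_on \<Omega>)"
      using M by (auto simp: L2_def)
    have A_sets': "A n \<in> sets (lebesgue_on \<Omega>)" for n
      using A_sets open_\<Omega> by (subst sets_restrict_space_iff) (auto simp: A_def)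
    have J: "J \<longlonglongrightarrow> 0"
    proof -
      have "(\<lambda>n. LINT x|lebesgue_on \<Omega>. indicator (A n) x * (norm (M x))\<^sup>2) \<longlonglongrightarrow> (LINT x|lebesgue_on \<Omega>. 0)"
      proof (rule integral_dominated_convergence[where w="\<lambda>x. (norm (M x))\<^sup>2"])
        show "AE x in lebesgue_on \<Omega>. (\<lambda>n. indicator (A n) x * (norm (M x))\<^sup>2) \<longlonglongrightarrow> 0"
        proof (rule AE_I2)
          fix x assume "x \<in> space (lebesgue_on \<Omega>)"
          then have "x1 x > 0" using x1_pos by simp
          then obtain m :: nat where m: "real m * x1 x > 2" using reals_Archimedean3 by blast
          have "eventually (\<lambda>n. indicator (A n) x * (norm (M x))\<^sup>2 = 0) sequentially"
            using eventually_ge_at_top[of m]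
          proof (rule eventually_mono)
            fix n assume "m \<le> n"
            then have "real m * x1 x \<le> real (Suc n) * x1 x" using \<open>x1 x > 0\<close> by (intro mult_right_mono) auto
            then show "indicator (A n) x * (norm (M x))\<^sup>2 = 0" using m by (auto simp: A_def)
          qed
          then show "(\<lambda>n. indicator (A n) x * (norm (M x))\<^sup>2) \<longlonglongrightarrow> 0" by (rule tendsto_eventually)
        qed
        show "AE x in lebesgue_on \<Omega>. norm (indicator (A n) x * (norm (M x))\<^sup>2) \<le> (norm (M x))\<^sup>2" for n
          by (intro AE_I2) (auto split: split_indicator)
      qed (use M2 A_sets' in auto)
      then show ?thesis by (simp add: J_def[abs_def])
    qed
    have bound: "norm (?I (\<lambda>t. b n t * \<eta> t)) \<le> B * C * (t * V + J n / t)"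
      if t: "t > 0" for n t
    proof -
      define m where "m = real (Suc n)"
      have m: "m > 0" by (simp add: m_def)
      have finA: "measure lebesgue (A n) = (LINT x|lebesgue_on \<Omega>. indicator (A n) x)"
      proof -
        have "A n \<inter> space (lebesgue_on \<Omega>) = A n" by (auto simp: A_def)
        then show ?thesis using A_sets' open_\<Omega> by (simp add: measure_restrict_space A_def)
      qed
      have intA: "integrable (lebesgue_on \<Omega>) (indicator (A n) :: real^2 \<Rightarrow> real)"
        using A_sets' finite_measure.emeasure_finite[OF finite_measure_lebesgue_on[OF lmeasurable_\<Omega>]]
        by (intro integrable_real_indicator) (auto simp: less_top)
      have intAM: "integrable (lebesgue_on \<Omega>) (\<lambda>x. indicator (A n) x * (norm (M x))\<^sup>2)"
        using integrable_mult_indicator[OF A_sets' M2(1)] by simp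
      have "norm (?I (\<lambda>t. b n t * \<eta> t))
        \<le> (LINT x|lebesgue_on \<Omega>. B * C * (t * m\<^sup>2 * indicator (A n) x + indicator (A n) x * (norm (M x))\<^sup>2 / t))"
      proof (rule Bochner_Integration.integral_norm_bound_integral)
        show "integrable (lebesgue_on \<Omega>) (\<lambda>x. M x * of_real (b n (x1 x) * \<eta> (x1 x)))"
          by (rule L2_mult_integrable[OF M S])
            (intro continuous_on_of_real cx1 continuous_on_mult smooth_continuous sb \<eta>(1))
        show "integrable (lebesgue_on \<Omega>) (\<lambda>x. B * C * (t * m\<^sup>2 * indicator (A n) x + indicator (A n) x * (norm (M x))\<^sup>2 / t))"
          using intA intAM by simp
        fix x assume "x \<in> space (lebesgue_on \<Omega>)"
        then have x: "x \<in> \<Omega>" by simp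
        show "norm (M x * of_real (b n (x1 x) * \<eta> (x1 x))) \<le> B * C * (t * m\<^sup>2 * indicator (A n) x + indicator (A n) x * (norm (M x))\<^sup>2 / t)"
        proof (cases "x \<in> A n")
          case False
          then have "m * x1 x > 2" using x by (auto simp: A_def m_def)
          then have "b n (x1 x) = 0" unfolding b_def m_def[symmetric] using step'_eq_0[of "m * x1 x + -1"] by simp
          then show ?thesis using False by simp
        next
          case True
          \<comment> \<open>Young's inequality is used with weight \<open>t * m\<close>: after
            multiplication by \<open>m\<close>, the first term integrates over \<open>A n\<close> to
            at most \<open>t * V\<close>, uniformly in \<open>n\<close>.\<close>
          have "norm (M x) \<le> t * m + (norm (M x))\<^sup>2 / (t * m)"
            using abs_le_add_square[of "t * m" "norm (M x)"] t m by simp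
          then have "m * norm (M x) \<le> m * (t * m + (norm (M x))\<^sup>2 / (t * m))"
            using m by (intro mult_left_mono) auto
          also have "\<dots> = t * m\<^sup>2 + (norm (M x))\<^sup>2 / t"
            using m t by (simp add: field_simps power2_eq_square)
          finally have mM: "m * norm (M x) \<le> t * m\<^sup>2 + (norm (M x))\<^sup>2 / t" .
          have "norm (M x * of_real (b n (x1 x) * \<eta> (x1 x))) = (\<bar>step' (m * x1 x + -1)\<bar> * \<bar>\<eta> (x1 x)\<bar>) * (m * norm (M x))"
            using m unfolding b_def m_def[symmetric] norm_mult norm_of_real abs_mult by simp
          also have "\<dots> \<le> (B * C) * (t * m\<^sup>2 + (norm (M x))\<^sup>2 / t)"
            using mM B C(1) C(2)[OF x] m by (intro mult_mono) (auto intro!: mult_nonneg_nonneg)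
          finally show ?thesis using True by simp
        qed
      qed
      also have "\<dots> = B * C * (t * (measure lebesgue (A n) * m\<^sup>2) + J n / t)"
        using intA intAM unfolding J_def finA by (simp add: mult_ac)
      also have "\<dots> \<le> B * C * (t * V + J n / t)"
        using A_meas[of n] B C t by (intro mult_left_mono add_right_mono) (auto simp: m_def)
      finally show ?thesis .
    qed
    show ?thesis
    proof (rule tendstoI)
      fix e :: real assume e: "e > 0"
      define t where "t = e / (2 * (B * C) * (V + 1))"
      have BC: "B * C > 0" using B C by simp
      have t: "t > 0" using e BC V by (simp add: t_def)
      have "eventually (\<lambda>n. J n < t * e / (2 * (B * C))) sequentially"
        using J t e BC by (intro order_tendstoD(2)) auto
      then show "eventually (\<lambda>n. dist (?I (\<lambda>t. b n t * \<eta> t)) 0 < e) sequentially"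
      proof (rule eventually_mono)
        fix n assume n: "J n < t * e / (2 * (B * C))"
        have "B * C * (t * V) \<le> B * C * (t * (V + 1))"
          by (intro mult_left_mono less_imp_le[OF BC] less_imp_le[OF t]) simp
        also have "\<dots> = e / 2" using V B(1) C(1) by (simp add: t_def)
        finally have 1: "B * C * (t * V) \<le> e / 2" .
        have "J n * (2 * (B * C)) < t * e" using n BC by (simp add: pos_less_divide_eq)
        then have 2: "B * C * (J n / t) < e / 2" using t by (simp add: field_simps)
        show "dist (?I (\<lambda>t. b n t * \<eta> t)) 0 < e"
          using bound[OF t, of n] 1 2 unfolding distrib_left dist_norm diff_0_right by linarith
      qed
    qed
  qed
  have split: "(?I (\<lambda>t. b n t * \<eta> t + a n t * \<eta>' t)) =
      (?I (\<lambda>t. b n t * \<eta> t)) +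
      (?I (\<lambda>t. a n t * \<eta>' t))" for n
    unfolding of_real_add distrib_left
    by (intro Bochner_Integration.integral_add L2_mult_integrable[OF M S] continuous_on_of_real cx1
        continuous_on_mult smooth_continuous sa sb \<eta>)
  have "(\<lambda>n. \<Sum>\<sigma>\<in>{1, -1}. ?J \<sigma> (\<lambda>t. a n t * \<eta> t)) \<longlonglongrightarrow>
     (?I \<eta>')"
    unfolding id_n[symmetric] split using tendsto_add[OF lhs2 lhs1] by simp
  moreover have "(\<lambda>n. \<Sum>\<sigma>\<in>{1, -1}. ?J \<sigma> (\<lambda>t. a n t * \<eta> t)) \<longlonglongrightarrow>
     (\<Sum>\<sigma>\<in>{1, -1}. ?J \<sigma> \<eta>)"
    by (intro tendsto_sum rhs)
  ultimately show ?thesis by (rule LIMSEQ_unique)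
qed

end

text \<open>The data are indexed by \<sigma>, 1 for the upper and -1 for the lower side. Tractions
  are expressed through \<open>Dv\<close> and \<open>Dw\<close>, while the trace concerns
  \<open>D\<close>; \<open>weak\<close> is the link between them.\<close>

locale sector_data = convex_sector +
  fixes lam mu :: real and u :: "real^2 \<Rightarrow> complex^2" and Dv Dw D :: "real^2 \<Rightarrow> complex^2^2"
    and f g :: "real \<Rightarrow> real^2 \<Rightarrow> complex^2"
  assumes L2: "u \<in> L2 \<Omega>" "Dv \<in> L2 \<Omega>" "Dw \<in> L2 \<Omega>" "D \<in> L2 \<Omega>"
    and L2_f: "\<And>\<sigma>. \<sigma> \<in> {1, -1} \<Longrightarrow> (\<lambda>r. f \<sigma> (polar (\<theta>0 + \<sigma> * \<alpha>) r)) \<in> L2 {0<..<h}"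
    and L2_g: "\<And>\<sigma>. \<sigma> \<in> {1, -1} \<Longrightarrow> (\<lambda>r. g \<sigma> (polar (\<theta>0 + \<sigma> * \<alpha>) r)) \<in> L2 {0<..<h}"
    and tr: "\<And>\<sigma>. \<sigma> \<in> {1, -1} \<Longrightarrow> trace_approx \<Omega> (\<theta>0 + \<sigma> * \<alpha>) h u D (f \<sigma>)"
    and weak: "\<And>k i \<phi>. test_function \<Omega> \<phi> \<Longrightarrow>
      (LINT x|lebesgue_on \<Omega>. \<phi> x *\<^sub>R ((Dv x - Dw x - D x) $ k $ i)) = 0"
    and trac: "\<And>\<sigma> \<phi>. \<sigma> \<in> {1, -1} \<Longrightarrow> boundary_test_function \<Omega> (side (\<theta>0 + \<sigma> * \<alpha>) h) \<phi> \<Longrightarrow>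
      (LINT x|lebesgue_on \<Omega>. contraction (stress lam mu (Dv x)) (jacobian \<phi> x)) -
      (LINT x|lebesgue_on \<Omega>. contraction (stress lam mu (Dw x)) (jacobian \<phi> x)) = side_pairing (\<theta>0 + \<sigma> * \<alpha>) h (g \<sigma>) \<phi>"
begin

text \<open>Adding the one-sided identities for the two weights of the same \<open>k\<close> leaves
  in the interior a cutoff in the bisector coordinate alone, while on each side its own weight
  reduces to \<open>k\<close>.\<close>

lemma sector_identity:
  fixes u0 :: "real^2 \<Rightarrow> complex^2" and k k' :: "real \<Rightarrow> real"
  assumes u0: "smooth u0"
    and div0: "\<And>k x. (\<Sum>i\<in>UNIV. partial i (\<lambda>x. stress lam mu (jacobian u0 x) $ k $ i) x) = 0"
    and k: "smooth k" "\<And>t. (k has_field_derivative k' t) (at t)" and \<epsilon>: "\<epsilon> > 0"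
    and k0: "\<And>t. t < \<epsilon> \<or> t > 2 * \<delta> \<Longrightarrow> k t = 0"
  shows "(LINT x|lebesgue_on \<Omega>. interior_density lam mu u0 u D (polar \<theta>0 1) x * of_real (k' (x1 x))) =
    (\<Sum>\<sigma>\<in>{1, -1}. LINT r|lebesgue_on {0<..<h}.
      boundary_density lam mu u0 (f \<sigma>) (g \<sigma>) (side_normal \<sigma> (\<theta>0 + \<sigma> * \<alpha>)) (polar (\<theta>0 + \<sigma> * \<alpha>) r) * of_real (k (r * cos \<alpha>)))"
proof -
  define I where "I w x = (\<Sum>l\<in>UNIV. \<Sum>i\<in>UNIV.
       (stress lam mu (D x) $ l $ i * u0 x $ l - u x $ l * stress lam mu (jacobian u0 x) $ l $ i) * of_real (partial i w x))"
      for w :: "real^2 \<Rightarrow> real" and x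
  have I: "(LINT x|lebesgue_on \<Omega>. I (weight k \<epsilon> \<sigma>) x) = (LINT r|lebesgue_on {0<..<h}.
      boundary_density lam mu u0 (f \<sigma>) (g \<sigma>) (side_normal \<sigma> (\<theta>0 + \<sigma> * \<alpha>)) (polar (\<theta>0 + \<sigma> * \<alpha>) r) * of_real (k (r * cos \<alpha>)))"
    if sgn: "\<sigma> \<in> {1, -1}" for \<sigma>
  proof -
    interpret side_neighborhood \<Omega> "K \<epsilon> \<sigma>" "\<theta>0 + \<sigma> * \<alpha>" \<sigma> h
      by (rule side_neighborhood_K[OF sgn \<epsilon>])
    obtain U where U: "\<And>n. smooth (U n)"
      "(\<lambda>n. L2_sq \<Omega> (\<lambda>x. U n x - u x)) \<longlonglongrightarrow> 0"
      "(\<lambda>n. L2_sq \<Omega> (\<lambda>x. jacobian (U n) x - D x)) \<longlonglongrightarrow> 0"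
      "(\<lambda>n. L2_sq {0<..<h} (\<lambda>r. U n (polar (\<theta>0 + \<sigma> * \<alpha>) r) - f \<sigma> (polar (\<theta>0 + \<sigma> * \<alpha>) r))) \<longlonglongrightarrow> 0"
      using tr[OF sgn] unfolding trace_approx_def by blast
    have wp: "k (r * cos \<alpha>) = weight k \<epsilon> \<sigma> (polar (\<theta>0 + \<sigma> * \<alpha>) r)" for r
      by (rule weight_polar[OF sgn \<epsilon>, symmetric]) (rule k0)
    show ?thesis
      unfolding I_def boundary_density_def wp
      by (rule side_identity[OF L2 L2_f[OF sgn] L2_g[OF sgn] U])
        (erule weak, erule trac[OF sgn], rule u0, rule div0, rule smooth_weight[OF k(1)],
          rule weight_eq_0[OF \<epsilon> k0])
  qed
  have int: "integrable (lebesgue_on \<Omega>) (I (weight k \<epsilon> \<sigma>))" for \<sigma>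
  proof -
    have c: "continuous_on UNIV (\<lambda>x. u0 x $ l * of_real (partial i (weight k \<epsilon> \<sigma>) x))"
      "continuous_on UNIV (\<lambda>x. stress lam mu (jacobian u0 x) $ l $ i * of_real (partial i (weight k \<epsilon> \<sigma>) x))" for l i
      by (intro smooth_continuous smooth_mult smooth_of_real smooth_partial smooth_weight smooth_vec_nth smooth_stress_jacobian u0 k)+
    have "integrable (lebesgue_on \<Omega>) (\<lambda>x. (stress lam mu (D x) $ l $ i * u0 x $ l - u x $ l * stress lam mu (jacobian u0 x) $ l $ i) * of_real (partial i (weight k \<epsilon> \<sigma>) x))" for l i
    proof -
      have "integrable (lebesgue_on \<Omega>) (\<lambda>x. stress lam mu (D x) $ l $ i * (u0 x $ l * of_real (partial i (weight k \<epsilon> \<sigma>) x)))"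
        "integrable (lebesgue_on \<Omega>) (\<lambda>x. u x $ l * (stress lam mu (jacobian u0 x) $ l $ i * of_real (partial i (weight k \<epsilon> \<sigma>) x)))"
        by (intro L2_mult_integrable L2_stress L2_nth L2 bounded_\<Omega> lmeasurable_\<Omega> c)+
      from Bochner_Integration.integrable_diff[OF this] show ?thesis by (simp add: left_diff_distrib mult.assoc)
    qed
    then show ?thesis unfolding I_def by (intro Bochner_Integration.integrable_sum)
  qed
  have "(\<Sum>\<sigma>\<in>{1, -1}. LINT x|lebesgue_on \<Omega>. I (weight k \<epsilon> \<sigma>) x) = (LINT x|lebesgue_on \<Omega>. I (weight k \<epsilon> 1) x + I (weight k \<epsilon> (-1)) x)"
    using int by simp
  also have "(\<lambda>x. I (weight k \<epsilon> 1) x + I (weight k \<epsilon> (-1)) x) =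
      (\<lambda>x. interior_density lam mu u0 u D (polar \<theta>0 1) x * of_real (k' (x1 x)))"
  proof
    fix x
    have p: "complex_of_real (partial i (weight k \<epsilon> 1) x) + of_real (partial i (weight k \<epsilon> (-1)) x) =
        of_real (k' (x1 x)) * of_real (polar \<theta>0 1 $ i)" for i
      unfolding of_real_add[symmetric] of_real_mult[symmetric] partial_weight_sum[OF k] ..
    show "I (weight k \<epsilon> 1) x + I (weight k \<epsilon> (-1)) x = interior_density lam mu u0 u D (polar \<theta>0 1) x * of_real (k' (x1 x))"
      unfolding I_def interior_density_def sum.distrib[symmetric] distrib_left[symmetric] p sum_distrib_right
      by (simp add: mult_ac)
  qed
  finally show ?thesis using I by simp
qed

end

section \<open>Exponential solutions of the Lame system\<close>

text \<open>For \<tau> = 1 and \<tau> = -1 this is d + i \<tau> d', with d the unit vector at angle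
  \<theta> and d' its counterclockwise rotation, after pulling out the common factor exp (-i \<tau>
  \<theta>). The two vectors are complex conjugates.\<close>

definition zeta :: "real \<Rightarrow> real \<Rightarrow> complex^2" where
  "zeta \<tau> \<theta> = vector [cis (- \<tau> * \<theta>), \<i> * of_real \<tau> * cis (- \<tau> * \<theta>)]"

text \<open>For \<tau> = 1 and \<tau> = -1 this is the bilinear product of \<open>zeta\<close> with
  the point, written so that the real part, which governs the decay, is visible.\<close>

definition phase :: "real \<Rightarrow> real \<Rightarrow> real^2 \<Rightarrow> complex" where
  "phase \<tau> \<theta> x = of_real (along \<theta> x) + \<i> * of_real (\<tau> * across \<theta> x)"

text \<open>The factor \<open>s\<close> beside \<open>c\<close> makes the field a function of the
  scaled point s x, so that on a ray it depends on s r only.\<close>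

definition exp_field :: "real \<Rightarrow> real \<Rightarrow> complex^2 \<Rightarrow> complex \<Rightarrow> real \<Rightarrow> real^2 \<Rightarrow> complex^2" where
  "exp_field \<tau> \<theta> a c s x = (\<chi> k. exp (- of_real s * phase \<tau> \<theta> x) *
     (a $ k + c * of_real s * zeta \<tau> \<theta> $ k * phase (- \<tau>) \<theta> x))"

lemma zeta_nth: "zeta \<tau> \<theta> $ 1 = cis (- \<tau> * \<theta>)" "zeta \<tau> \<theta> $ 2 = \<i> * of_real \<tau> * cis (- \<tau> * \<theta>)"
  by (simp_all add: zeta_def)

lemma zeta_isotropic: "\<tau> \<in> {1, -1} \<Longrightarrow> zeta \<tau> \<theta> $ 1 * zeta \<tau> \<theta> $ 1 + zeta \<tau> \<theta> $ 2 * zeta \<tau> \<theta> $ 2 = 0"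
  by (auto simp: zeta_nth algebra_simps)

lemma zeta_conj: "\<tau> \<in> {1, -1} \<Longrightarrow> zeta \<tau> \<theta> $ 1 * zeta (- \<tau>) \<theta> $ 1 + zeta \<tau> \<theta> $ 2 * zeta (- \<tau>) \<theta> $ 2 = 2"
  by (auto simp: zeta_nth algebra_simps cis_mult)

lemma phase_eq:
  assumes "\<tau> \<in> {1, -1}"
  shows "phase \<tau> \<theta> x = of_real (x $ 1) * zeta \<tau> \<theta> $ 1 + of_real (x $ 2) * zeta \<tau> \<theta> $ 2"
  using assms by (auto simp: phase_def along_eq across_eq zeta_nth complex_eq_iff)

lemma bounded_linear_phase: "bounded_linear (phase \<tau> \<theta>)"
proof -
  have "linear (phase \<tau> \<theta>)"
    by (rule linearI) (auto simp: phase_def along_eq across_eq algebra_simps complex_eq_iff)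
  then show ?thesis by (simp add: linear_conv_bounded_linear)
qed

lemma phase_axis: "\<tau> \<in> {1, -1} \<Longrightarrow> phase \<tau> \<theta> (axis i 1) = zeta \<tau> \<theta> $ i"
  using exhaust_2[of i] by (auto simp: phase_eq axis_def)

lemma smooth_exp_affine:
  "smooth (\<lambda>x. exp (- of_real s * phase \<tau> \<theta> x) * (A + B * phase \<tau>' \<theta> x))"
  by (intro smooth_mult smooth_add smooth_const smooth_exp_linear smooth_linear bounded_linear_phase
      bounded_linear_const_mult)

text \<open>The exponential times affine functions of the conjugate phase is a class closed under
  differentiation, so stress and divergence become computations with the two coefficients
  \<open>A\<close> and \<open>B\<close>.\<close>

lemma partial_exp_affine:
  assumes "\<tau> \<in> {1, -1}"
  shows "partial i (\<lambda>x. exp (- of_real s * phase \<tau> \<theta> x) * (A + B * phase (- \<tau>) \<theta> x)) x =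
    exp (- of_real s * phase \<tau> \<theta> x) *
      ((B * zeta (- \<tau>) \<theta> $ i - of_real s * zeta \<tau> \<theta> $ i * A) + (- of_real s * zeta \<tau> \<theta> $ i * B) * phase (- \<tau>) \<theta> x)"
proof -
  have p: "(phase \<tau> \<theta> has_derivative phase \<tau> \<theta>) (at x)" for \<tau>
    by (rule bounded_linear_imp_has_derivative[OF bounded_linear_phase])
  have e: "((\<lambda>x. exp (- of_real s * phase \<tau> \<theta> x)) has_derivative
      (\<lambda>h. exp (- of_real s * phase \<tau> \<theta> x) * (- of_real s * phase \<tau> \<theta> h))) (at x)"
    using has_derivative_compose[OF has_derivative_mult_right[OF p] DERIV_exp[unfolded has_field_derivative_def]] .
  have a: "((\<lambda>x. A + B * phase (- \<tau>) \<theta> x) has_derivative (\<lambda>h. B * phase (- \<tau>) \<theta> h)) (at x)"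
    using has_derivative_add[OF has_derivative_const has_derivative_mult_right[OF p]] by simp
  have m: "- \<tau> \<in> {1, -1}" using assms by auto
  show ?thesis
    unfolding partial_eq[OF has_derivative_mult[OF e a]] phase_axis[OF assms] phase_axis[OF m]
    by (simp add: algebra_simps)
qed

lemma smooth_exp_field: "smooth (exp_field \<tau> \<theta> a c s)"
  by (rule smooth_vec) (simp add: exp_field_def smooth_exp_affine[simplified])

text \<open>The part of the stress of \<open>exp_field\<close> that is linear in \<open>s\<close>, up to the exponential factor.\<close>

definition stress0 :: "real \<Rightarrow> real \<Rightarrow> complex^2 \<Rightarrow> complex^2 \<Rightarrow> complex^2 \<Rightarrow> complex \<Rightarrow> 2 \<Rightarrow> 2 \<Rightarrow> complex" where
  "stress0 lam mu \<zeta> \<xi> a c k i =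
    (if k = i then of_real lam * (2 * c - (\<zeta> $ 1 * a $ 1 + \<zeta> $ 2 * a $ 2)) else 0) +
    of_real mu * (c * (\<xi> $ i * \<zeta> $ k + \<xi> $ k * \<zeta> $ i) - \<zeta> $ i * a $ k - \<zeta> $ k * a $ i)"

text \<open>The term quadratic in \<open>s\<close> has no trace part because \<open>zeta\<close> is
  isotropic. The 2 in the trace part of \<open>stress0\<close> is the product of \<open>zeta\<close>
  with its conjugate.\<close>

lemma stress_exp_field:
  assumes \<tau>: "\<tau> \<in> {1, -1}"
  shows "stress lam mu (jacobian (exp_field \<tau> \<theta> a c s) x) $ k $ i = exp (- of_real s * phase \<tau> \<theta> x) *
    (of_real s * stress0 lam mu (zeta \<tau> \<theta>) (zeta (- \<tau>) \<theta>) a c k i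
      + (- 2 * of_real mu * c * (of_real s)\<^sup>2 * zeta \<tau> \<theta> $ i * zeta \<tau> \<theta> $ k) * phase (- \<tau>) \<theta> x)"
proof -
  define E where "E = exp (- of_real s * phase \<tau> \<theta> x)"
  define \<zeta> where "\<zeta> = zeta \<tau> \<theta>"
  define \<xi> where "\<xi> = zeta (- \<tau>) \<theta>"
  define P where "P = phase (- \<tau>) \<theta> x"
  have J: "jacobian (exp_field \<tau> \<theta> a c s) x $ k $ i = E *
      ((c * of_real s * \<zeta> $ k * \<xi> $ i - of_real s * \<zeta> $ i * a $ k) + (- of_real s * \<zeta> $ i * (c * of_real s * \<zeta> $ k)) * P)"
    for k i
  proof -
    have "jacobian (exp_field \<tau> \<theta> a c s) x $ k $ i = partial i (\<lambda>x. exp_field \<tau> \<theta> a c s x $ k) x"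
      by (simp add: jacobian_def partial_nth[OF smooth_exp_field])
    then show ?thesis
      unfolding exp_field_def vec_lambda_beta partial_exp_affine[OF \<tau>] E_def \<zeta>_def \<xi>_def P_def by simp
  qed
  have 2: "\<zeta> $ 2 * \<zeta> $ 2 = - (\<zeta> $ 1 * \<zeta> $ 1)"
    using zeta_isotropic[OF \<tau>, of \<theta>] by (simp add: \<zeta>_def add_eq_0_iff)
  have 3: "\<zeta> $ 2 * \<xi> $ 2 = 2 - \<zeta> $ 1 * \<xi> $ 1"
    using zeta_conj[OF \<tau>, of \<theta>] by (simp add: \<zeta>_def \<xi>_def algebra_simps)
  have tr: "jacobian (exp_field \<tau> \<theta> a c s) x $ 1 $ 1 + jacobian (exp_field \<tau> \<theta> a c s) x $ 2 $ 2 =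
      E * of_real s * (2 * c - (\<zeta> $ 1 * a $ 1 + \<zeta> $ 2 * a $ 2))"
  proof -
    have "jacobian (exp_field \<tau> \<theta> a c s) x $ 1 $ 1 + jacobian (exp_field \<tau> \<theta> a c s) x $ 2 $ 2 =
      E * of_real s * (c * (\<zeta> $ 1 * \<xi> $ 1 + \<zeta> $ 2 * \<xi> $ 2) - (\<zeta> $ 1 * a $ 1 + \<zeta> $ 2 * a $ 2)
        - c * of_real s * P * (\<zeta> $ 1 * \<zeta> $ 1 + \<zeta> $ 2 * \<zeta> $ 2))"
      unfolding J by (simp add: algebra_simps)
    then show ?thesis unfolding 2 3 by simp
  qed
  show ?thesis
    unfolding stress_nth tr unfolding J stress0_def E_def[symmetric] \<zeta>_def[symmetric] \<xi>_def[symmetric] P_def[symmetric]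
    by (simp add: algebra_simps power2_eq_square)
qed

text \<open>Isotropy and the product 2 of \<open>zeta\<close> with its conjugate reduce everything
  to a multiple of component \<open>k\<close> of \<open>zeta\<close>; the hypothesis
  \<open>ac\<close> makes that multiple zero. It holds for \<open>a\<close> equal to
  \<open>zeta\<close> with \<open>c = 0\<close>; for \<open>a\<close> the conjugate of
  \<open>zeta\<close> it amounts to c (lam + 3 mu) = lam + mu, the origin of the constant.\<close>

lemma divergence_free_exp_field:
  assumes \<tau>: "\<tau> \<in> {1, -1}"
    and ac: "of_real (lam + mu) * (zeta \<tau> \<theta> $ 1 * a $ 1 + zeta \<tau> \<theta> $ 2 * a $ 2 - 2 * c) = 4 * of_real mu * c"
  shows "(\<Sum>i\<in>UNIV. partial i (\<lambda>x. stress lam mu (jacobian (exp_field \<tau> \<theta> a c s) x) $ k $ i) x) = 0"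
proof -
  define E where "E = exp (- of_real s * phase \<tau> \<theta> x)"
  define \<zeta> where "\<zeta> = zeta \<tau> \<theta>"
  define \<xi> where "\<xi> = zeta (- \<tau>) \<theta>"
  define P where "P = phase (- \<tau>) \<theta> x"
  define S where "S = complex_of_real s"
  have 2: "\<zeta> $ 2 * \<zeta> $ 2 = - (\<zeta> $ 1 * \<zeta> $ 1)"
    using zeta_isotropic[OF \<tau>, of \<theta>] by (simp add: \<zeta>_def add_eq_0_iff)
  have 3: "\<zeta> $ 2 * \<xi> $ 2 = 2 - \<zeta> $ 1 * \<xi> $ 1"
    using zeta_conj[OF \<tau>, of \<theta>] by (simp add: \<zeta>_def \<xi>_def algebra_simps)
  let ?A = "stress0 lam mu \<zeta> \<xi> a c"
  let ?B = "\<lambda>k i. - 2 * of_real mu * c * S\<^sup>2 * \<zeta> $ i * \<zeta> $ k"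
  have "(\<Sum>i\<in>UNIV. partial i (\<lambda>x. stress lam mu (jacobian (exp_field \<tau> \<theta> a c s) x) $ k $ i) x) =
    (\<Sum>i\<in>UNIV. E * ((?B k i * \<xi> $ i - S * \<zeta> $ i * (S * ?A k i)) + (- S * \<zeta> $ i * ?B k i) * P))"
    unfolding stress_exp_field[OF \<tau>] partial_exp_affine[OF \<tau>] E_def \<zeta>_def \<xi>_def P_def S_def by simp
  also have "\<dots> = E * (\<Sum>i\<in>UNIV. ?B k i * \<xi> $ i) - E * S\<^sup>2 * (\<Sum>i\<in>UNIV. \<zeta> $ i * ?A k i) - E * S * P * (\<Sum>i\<in>UNIV. \<zeta> $ i * ?B k i)"
    by (simp add: sum_2 algebra_simps power2_eq_square)
  also have "(\<Sum>i\<in>UNIV. \<zeta> $ i * ?B k i) = - 2 * of_real mu * c * S\<^sup>2 * \<zeta> $ k * (\<zeta> $ 1 * \<zeta> $ 1 + \<zeta> $ 2 * \<zeta> $ 2)"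
    by (simp add: sum_2 algebra_simps)
  also have "\<dots> = 0" unfolding 2 by simp
  also have "(\<Sum>i\<in>UNIV. ?B k i * \<xi> $ i) = - 2 * of_real mu * c * S\<^sup>2 * \<zeta> $ k * (\<zeta> $ 1 * \<xi> $ 1 + \<zeta> $ 2 * \<xi> $ 2)"
    by (simp add: sum_2 algebra_simps)
  also have "\<dots> = - 4 * of_real mu * c * S\<^sup>2 * \<zeta> $ k" unfolding 3 by simp
  also have "(\<Sum>i\<in>UNIV. \<zeta> $ i * ?A k i) =
      \<zeta> $ k * of_real lam * (2 * c - (\<zeta> $ 1 * a $ 1 + \<zeta> $ 2 * a $ 2)) +
      of_real mu * (c * \<zeta> $ k * (\<zeta> $ 1 * \<xi> $ 1 + \<zeta> $ 2 * \<xi> $ 2) + c * \<xi> $ k * (\<zeta> $ 1 * \<zeta> $ 1 + \<zeta> $ 2 * \<zeta> $ 2)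
        - a $ k * (\<zeta> $ 1 * \<zeta> $ 1 + \<zeta> $ 2 * \<zeta> $ 2) - \<zeta> $ k * (\<zeta> $ 1 * a $ 1 + \<zeta> $ 2 * a $ 2))"
    using exhaust_2[of k] by (auto simp: stress0_def sum_2 algebra_simps)
  also have "\<dots> = - \<zeta> $ k * (of_real (lam + mu) * (\<zeta> $ 1 * a $ 1 + \<zeta> $ 2 * a $ 2 - 2 * c))"
    unfolding 2 3 by (simp add: algebra_simps)
  also have "\<dots> = - 4 * of_real mu * c * \<zeta> $ k"
    unfolding ac[folded \<zeta>_def] by simp
  finally show ?thesis by (simp add: algebra_simps)
qed

section \<open>Laplace-type asymptotics\<close>

text \<open>Apply y <= exp y with y = b t / p and raise to the power \<open>p\<close>.\<close>

lemma power_le_exp: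
  assumes "b > 0" "t \<ge> 0"
  shows "t ^ p \<le> (real p / b) ^ p * exp (b * t)"
proof (cases "p = 0")
  case False
  define y where "y = b * t / real p"
  have y: "y \<ge> 0" using assms by (simp add: y_def)
  have "y \<le> exp y" using exp_ge_add_one_self[of y] by linarith
  then have "y ^ p \<le> exp y ^ p" using y by (rule power_mono)
  also have "\<dots> = exp (b * t)" using False by (simp add: y_def flip: exp_of_nat_mult)
  finally have "(real p / b) ^ p * y ^ p \<le> (real p / b) ^ p * exp (b * t)"
    using assms by (intro mult_left_mono) auto
  moreover have "(real p / b) ^ p * y ^ p = t ^ p"
    using assms False by (simp add: y_def flip: power_mult_distrib)
  ultimately show ?thesis by simp
qed (use assms in simp)

lemma integrable_bounded_lebesgue_on:
  fixes f :: "'a::euclidean_space \<Rightarrow> 'b::euclidean_space"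
  assumes "f \<in> borel_measurable (lebesgue_on S)" "S \<in> lmeasurable" "\<And>x. x \<in> S \<Longrightarrow> norm (f x) \<le> B"
  shows "integrable (lebesgue_on S) f"
proof -
  interpret finite_measure "lebesgue_on S"
    using assms(2) by (rule finite_measure_lebesgue_on)
  show ?thesis using assms by (intro integrable_const_bound[where B=B] AE_I2) auto
qed

lemma integrable_continuous_lebesgue_on:
  fixes f :: "'a::euclidean_space \<Rightarrow> 'b::euclidean_space"
  assumes "continuous_on UNIV f" "bounded S" "S \<in> lmeasurable"
  shows "integrable (lebesgue_on S) f"
proof -
  obtain B where "\<And>x. x \<in> S \<Longrightarrow> norm (f x) \<le> B"
    using bounded_on_continuous[OF assms(1,2)] by blast
  then show ?thesis
    using integrable_bounded_lebesgue_on measurable_lebesgue_on_continuous assms by blast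
qed

lemma integral_derivative_Ioo:
  fixes F f :: "real \<Rightarrow> 'a::euclidean_space"
  assumes "0 \<le> h" "\<And>r. (F has_vector_derivative f r) (at r)" "continuous_on UNIV f"
  shows "(LINT r|lebesgue_on {0<..<h}. f r) = F h - F 0"
proof -
  have "integrable (lebesgue_on {0<..<h}) f"
    by (rule integrable_continuous_lebesgue_on[OF assms(3)]) auto
  then have "(LINT r|lebesgue_on {0<..<h}. f r) = integral {0<..<h} f"
    by (intro lebesgue_integral_eq_integral) auto
  also have "\<dots> = integral {0..h} f" by (simp add: integral_open_interval_real)
  also have "\<dots> = F h - F 0"
    using assms by (intro integral_unique fundamental_theorem_of_calculus)
      (auto intro: has_vector_derivative_at_within)
  finally show ?thesis .
qed

lemma exp_decay_tendsto_0:
  assumes "b > 0"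
  shows "(\<lambda>n. real n ^ p * exp (- (real n * b))) \<longlonglongrightarrow> 0"
proof -
  have "((\<lambda>x. x ^ p / exp x) \<longlongrightarrow> 0) (at_top :: real filter)" by (rule tendsto_power_div_exp_0)
  moreover have "filterlim (\<lambda>n. real n * b) at_top sequentially"
    using filterlim_at_top_mult_tendsto_pos[OF tendsto_const assms filterlim_real_sequentially] by simp
  ultimately have "(\<lambda>n. (real n * b) ^ p / exp (real n * b)) \<longlonglongrightarrow> 0"
    by (rule filterlim_compose)
  from tendsto_mult[OF tendsto_const[of "inverse b ^ p"] this] show ?thesis
    using assms by (simp add: exp_minus field_simps power_mult_distrib power_divide power_inverse)
qed

text \<open>Half of the decay rate absorbs the power, the other half remains.\<close>

lemma norm_power_exp_le:
  assumes "Re z = 2 * b" "b > 0" "t \<ge> 0"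
  shows "norm (of_real (t ^ p) * exp (- of_real t * z)) \<le> (real p / b) ^ p * exp (- (b * t))"
proof -
  have "norm (of_real (t ^ p) * exp (- of_real t * z)) = t ^ p * exp (- (t * (2 * b)))"
    using assms by (simp add: norm_mult norm_exp_eq_Re norm_power)
  also have "\<dots> \<le> ((real p / b) ^ p * exp (b * t)) * exp (- (t * (2 * b)))"
    using power_le_exp[OF assms(2,3)] by (intro mult_right_mono) auto
  also have "\<dots> = (real p / b) ^ p * exp (- (b * t))"
    by (simp add: mult.assoc flip: exp_add)
  finally show ?thesis .
qed

text \<open>The kernels n (n r)^p exp (- n r z) have uniformly bounded L1 norm and concentrate at 0:
  near 0 the function \<open>H\<close> is small, and beyond a fixed distance the kernel is
  exponentially small.\<close>

lemma laplace_limit_0: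
  fixes H :: "real \<Rightarrow> complex"
  assumes z: "Re z > 0" and h: "h > 0"
    and H: "H \<in> borel_measurable (lebesgue_on {0<..<h})" "\<And>r. r \<in> {0<..<h} \<Longrightarrow> norm (H r) \<le> B"
    and lim: "(H \<longlongrightarrow> 0) (at_right 0)"
  shows "(\<lambda>n. of_nat n * (LINT r|lebesgue_on {0<..<h}. H r * (of_real ((real n * r) ^ p) * exp (- of_real (real n * r) * z)))) \<longlonglongrightarrow> 0"
proof (rule tendstoI)
  let ?K = "\<lambda>n r. complex_of_real ((real n * r) ^ p) * exp (- of_real (real n * r) * z)"
  let ?I = "\<lambda>n. of_nat n * (LINT r|lebesgue_on {0<..<h}. H r * ?K n r)"
  fix e :: real assume e: "e > 0"
  define b where "b = Re z / 2"
  have b: "b > 0" "Re z = 2 * b" using z by (auto simp: b_def)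
  define C where "C = (real p / b) ^ p"
  have C: "C \<ge> 0" using b by (simp add: C_def)
  have B: "B \<ge> 0" using order_trans[OF norm_ge_zero H(2)[of "h / 2"]] h by simp
  \<comment> \<open>Makes the contribution from near 0, at most d C / b, no larger than e/2.\<close>
  define d where "d = e * b / (2 * (C + 1))"
  have d: "d > 0" using e b C by (simp add: d_def)
  have "eventually (\<lambda>r. norm (H r) < d) (at_right 0)"
    using tendstoD[OF lim d] by simp
  then obtain \<rho> where \<rho>: "\<rho> > 0" "\<And>r. 0 < r \<Longrightarrow> r < \<rho> \<Longrightarrow> norm (H r) < d"
    unfolding eventually_at_right_field by blast
  have bound: "norm (?I n)
    \<le> d * C / b + h * B * C * (real n ^ 1 * exp (- (real n * (b * \<rho>))))" for n
  proof (cases "n = 0")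
    case True
    then show ?thesis using d C b by simp
  next
    case False
    then have n: "real n > 0" by simp
    define E where "E r = real n * exp (- (b * (real n * r)))" for r
    have E_int: "(LINT r|lebesgue_on {0<..<h}. E r) = (1 - exp (- (b * (real n * h)))) / b"
    proof -
      have "((\<lambda>r. - exp (- (b * (real n * r))) / b) has_vector_derivative E r) (at r)" for r
        using b unfolding E_def has_real_derivative_iff_has_vector_derivative[symmetric]
        by (auto intro!: derivative_eq_intros)
      from integral_derivative_Ioo[OF less_imp_le[OF h] this] show ?thesis
        by (simp add: E_def continuous_intros diff_divide_distrib)
    qed
    have cE: "continuous_on UNIV E" unfolding E_def by (intro continuous_intros)
    have iE: "integrable (lebesgue_on {0<..<h}) E"
      by (rule integrable_continuous_lebesgue_on[OF cE]) auto
    have "norm (?I n) =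
      norm (LINT r|lebesgue_on {0<..<h}. of_nat n * (H r * ?K n r))"
      by simp
    also have "\<dots> \<le> (LINT r|lebesgue_on {0<..<h}. d * C * E r + B * C * (real n * exp (- (b * (real n * \<rho>)))))"
    proof (rule Bochner_Integration.integral_norm_bound_integral)
      have c: "continuous_on UNIV (\<lambda>r. ?K n r)"
        by (intro continuous_intros)
      obtain B' where B': "\<And>r. r \<in> {0<..<h} \<Longrightarrow> norm (?K n r) \<le> B'"
        using bounded_on_continuous[OF c bounded_Ioo[of 0 h]] by blast
      have m: "(\<lambda>r. H r * (?K n r)) \<in> borel_measurable (lebesgue_on {0<..<h})"
        by (intro borel_measurable_times H(1) measurable_lebesgue_on_continuous[OF c])
      have "integrable (lebesgue_on {0<..<h}) (\<lambda>r. H r * ?K n r)"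
        using B' H(2) B by (intro integrable_bounded_lebesgue_on[OF m, of "B * B'"]) (auto simp: norm_mult[of "H _"] intro!: mult_mono)
      then show "integrable (lebesgue_on {0<..<h}) (\<lambda>r. of_nat n * (H r * ?K n r))"
        by (rule integrable_mult_right)
      show "integrable (lebesgue_on {0<..<h}) (\<lambda>r. d * C * E r + B * C * (real n * exp (- (b * (real n * \<rho>)))))"
        by (rule integrable_continuous_lebesgue_on) (use cE in \<open>auto intro!: continuous_intros\<close>)
      fix r assume "r \<in> space (lebesgue_on {0<..<h})"
      then have r: "0 < r" "r < h" by auto
      have "norm (of_nat n * (H r * ?K n r)) =
         norm (H r) * (real n * norm (?K n r))"
        by (simp add: norm_mult)
      also have "\<dots> \<le> norm (H r) * (real n * (C * exp (- (b * (real n * r)))))"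
        using norm_power_exp_le[OF b(2,1), of "real n * r" p] r n unfolding C_def by (intro mult_left_mono) auto
      also have "\<dots> = norm (H r) * (C * E r)" by (simp add: E_def)
      also have "\<dots> \<le> d * C * E r + B * C * (real n * exp (- (b * (real n * \<rho>))))"
      proof (cases "r < \<rho>")
        case True
        then have "norm (H r) * (C * E r) \<le> d * (C * E r)"
          using \<rho>(2)[OF r(1)] C n by (intro mult_right_mono) (auto simp: E_def)
        moreover have "0 \<le> B * C * (real n * exp (- (b * (real n * \<rho>))))" using B C by simp
        ultimately show ?thesis by simp
      next
        case False
        then have "b * (real n * \<rho>) \<le> b * (real n * r)" using b n by (intro mult_left_mono) auto
        then have "E r \<le> real n * exp (- (b * (real n * \<rho>)))" using n by (simp add: E_def)
        then have "norm (H r) * (C * E r) \<le> B * (C * (real n * exp (- (b * (real n * \<rho>)))))"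
          using H(2)[of r] r B C n by (intro mult_mono) (auto simp: E_def)
        moreover have "0 \<le> d * C * E r" using d C n by (simp add: E_def)
        ultimately show ?thesis by simp
      qed
      finally show "norm (of_nat n * (H r * ?K n r))
        \<le> d * C * E r + B * C * (real n * exp (- (b * (real n * \<rho>))))" .
    qed
    also have "\<dots> = d * C * ((1 - exp (- (b * (real n * h)))) / b) + h * (B * C * (real n * exp (- (b * (real n * \<rho>)))))"
    proof -
      have "integrable (lebesgue_on {0<..<h}) (\<lambda>r. B * C * (real n * exp (- (b * (real n * \<rho>)))))"
        by (rule integrable_continuous_lebesgue_on) auto
      from Bochner_Integration.integral_add[OF integrable_mult_right[OF iE, of "d * C"] this] show ?thesis
        using h by (simp add: E_int measure_restrict_space)
    qed
    also have "\<dots> \<le> d * C * (1 / b) + h * B * C * (real n ^ 1 * exp (- (real n * (b * \<rho>))))"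
      using d C b by (intro add_mono mult_left_mono divide_right_mono) (auto simp: mult_ac)
    finally show ?thesis by simp
  qed
  have "(\<lambda>n. h * B * C * (real n ^ 1 * exp (- (real n * (b * \<rho>))))) \<longlonglongrightarrow> h * B * C * 0"
    by (intro tendsto_mult tendsto_const exp_decay_tendsto_0) (use b \<rho> in auto)
  then have "eventually (\<lambda>n. h * B * C * (real n ^ 1 * exp (- (real n * (b * \<rho>)))) < e / 2) sequentially"
    using e by (intro order_tendstoD(2)) auto
  then show "eventually (\<lambda>n. dist (?I n) 0 < e) sequentially"
  proof (rule eventually_mono)
    fix n assume n: "h * B * C * (real n ^ 1 * exp (- (real n * (b * \<rho>)))) < e / 2"
    have "d * C / b \<le> d * (C + 1) / b" using d b by (intro divide_right_mono mult_left_mono) auto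
    also have "\<dots> = e / 2"
    proof -
      have "C + 1 \<noteq> 0" "b \<noteq> 0" using C b by auto
      moreover have "x * y / (2 * w) * w / y = x / 2" if "w \<noteq> 0" "y \<noteq> 0" for x y w :: real
        using that by simp
      ultimately show ?thesis unfolding d_def by blast
    qed
    finally show "dist (?I n) 0 < e"
      using bound[of n] n unfolding dist_norm diff_0_right by linarith
  qed
qed

lemma tendsto_exp_minus_0:
  assumes "Re z > 0" "h > 0"
  shows "(\<lambda>n. exp (- of_real (real n * h) * z)) \<longlonglongrightarrow> 0"
    and "(\<lambda>n. of_real (real n * h) * exp (- of_real (real n * h) * z)) \<longlonglongrightarrow> 0"
proof -
  have b: "Re z * h > 0" using assms by simp
  have "norm (exp (- of_real (real n * h) * z)) = real n ^ 0 * exp (- (real n * (Re z * h)))" for n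
    by (simp add: norm_exp_eq_Re mult_ac)
  then show "(\<lambda>n. exp (- of_real (real n * h) * z)) \<longlonglongrightarrow> 0"
    using exp_decay_tendsto_0[OF b, of 0] by - (rule tendsto_norm_zero_cancel, simp only:)
  have "norm (of_real (real n * h) * exp (- of_real (real n * h) * z)) = h * (real n ^ 1 * exp (- (real n * (Re z * h))))" for n
    using assms by (simp add: norm_mult norm_exp_eq_Re mult_ac)
  moreover have "(\<lambda>n. h * (real n ^ 1 * exp (- (real n * (Re z * h))))) \<longlonglongrightarrow> h * 0"
    by (intro tendsto_mult tendsto_const exp_decay_tendsto_0 b)
  ultimately show "(\<lambda>n. of_real (real n * h) * exp (- of_real (real n * h) * z)) \<longlonglongrightarrow> 0"
    by - (rule tendsto_norm_zero_cancel, simp only: mult_zero_right)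
qed

text \<open>After subtraction of \<open>H0\<close>, a case already settled, the integral of the
  kernel is explicit. It tends to p! / z^(p+1), and for p <= 1 the factorial is 1.\<close>

lemma laplace_limit:
  fixes H :: "real \<Rightarrow> complex"
  assumes z: "Re z > 0" and h: "h > 0"
    and H: "H \<in> borel_measurable (lebesgue_on {0<..<h})" "\<And>r. r \<in> {0<..<h} \<Longrightarrow> norm (H r) \<le> B"
    and lim: "(H \<longlongrightarrow> H0) (at_right 0)" and p: "p \<le> 1"
  shows "(\<lambda>n. of_nat n * (LINT r|lebesgue_on {0<..<h}. H r * (of_real ((real n * r) ^ p) * exp (- of_real (real n * r) * z)))) \<longlonglongrightarrow> H0 / z ^ Suc p"
proof -
  define K where "K n r = complex_of_real ((real n * r) ^ p) * exp (- of_real (real n * r) * z)" for n r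
  have z0: "z \<noteq> 0" using z by auto
  have cK: "continuous_on UNIV (K n)" for n
    unfolding K_def by (intro continuous_intros)
  have lim': "((\<lambda>r. H r - H0) \<longlongrightarrow> 0) (at_right 0)" using lim by (simp add: LIM_zero)
  have H': "(\<lambda>r. H r - H0) \<in> borel_measurable (lebesgue_on {0<..<h})"
    "norm (H r - H0) \<le> B + norm H0" if "r \<in> {0<..<h}" for r
    using H norm_triangle_ineq4[of "H r" H0] that by (auto intro: order_trans)
  have L0: "(\<lambda>n. of_nat n * (LINT r|lebesgue_on {0<..<h}. (H r - H0) * K n r)) \<longlonglongrightarrow> 0"
    unfolding K_def using H'[of "h / 2"] h by (intro laplace_limit_0[OF z h _ H'(2) lim']) auto
  have iH: "integrable (lebesgue_on {0<..<h}) (\<lambda>r. (H r - H0) * K n r)" for n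
  proof -
    obtain B' where B': "\<And>r. r \<in> {0<..<h} \<Longrightarrow> norm (K n r) \<le> B'"
      using bounded_on_continuous[OF cK, of "{0<..<h}"] by (metis bounded_Ioo)
    show ?thesis
    proof (rule integrable_bounded_lebesgue_on)
      show "(\<lambda>r. (H r - H0) * K n r) \<in> borel_measurable (lebesgue_on {0<..<h})"
        using H(1) measurable_lebesgue_on_continuous[OF cK] by simp
      fix r assume r: "r \<in> {0<..<h}"
      show "norm ((H r - H0) * K n r) \<le> (B + norm H0) * B'"
        unfolding norm_mult using H'(2)[OF r] B'[OF r] order_trans[OF norm_ge_zero H'(2)[OF r]]
        by (intro mult_mono) auto
    qed simp
  qed
  have iK: "integrable (lebesgue_on {0<..<h}) (K n)" for n
    by (rule integrable_continuous_lebesgue_on[OF cK]) auto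
  have "(\<lambda>n. of_nat n * (LINT r|lebesgue_on {0<..<h}. K n r)) \<longlonglongrightarrow> 1 / z ^ Suc p"
  proof -
    consider "p = 0" | "p = 1" using p by linarith
    then show ?thesis
    proof cases
      case 1
      have "of_nat n * (LINT r|lebesgue_on {0<..<h}. K n r) = (1 - exp (- of_real (real n * h) * z)) / z" for n
      proof -
        have "((\<lambda>r. - exp (- of_real (real n * r) * z) / z) has_vector_derivative of_nat n * K n r) (at r)" for r
        proof -
          have "((\<lambda>w. - exp (- (of_nat n * w) * z) / z) has_field_derivative of_nat n * exp (- (of_nat n * of_real r) * z)) (at (of_real r))"
            using z0 by (auto intro!: derivative_eq_intros)
          from has_vector_derivative_real_field[OF this] show ?thesis by (simp add: K_def 1)
        qed
        from integral_derivative_Ioo[OF less_imp_le[OF h] this] show ?thesis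
          using cK by (simp add: continuous_intros diff_divide_distrib)
      qed
      then show ?thesis
        using tendsto_divide[OF tendsto_diff[OF tendsto_const tendsto_exp_minus_0(1)[OF z h]] tendsto_const z0, of 1] 1 by simp
    next
      case 2
      have "of_nat n * (LINT r|lebesgue_on {0<..<h}. K n r) =
          1 / z\<^sup>2 - of_real (real n * h) * exp (- of_real (real n * h) * z) / z - exp (- of_real (real n * h) * z) / z\<^sup>2" for n
      proof -
        have "((\<lambda>r. - of_real (real n * r) * exp (- of_real (real n * r) * z) / z - exp (- of_real (real n * r) * z) / z\<^sup>2) has_vector_derivative of_nat n * K n r) (at r)" for r
        proof -
          have "((\<lambda>w. - (of_nat n * w) * exp (- (of_nat n * w) * z) / z - exp (- (of_nat n * w) * z) / z\<^sup>2) has_field_derivative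
            of_nat n * (of_nat n * of_real r * exp (- (of_nat n * of_real r) * z))) (at (of_real r))"
            using z0 by (auto intro!: derivative_eq_intros simp: field_simps power2_eq_square)
          from has_vector_derivative_real_field[OF this] show ?thesis by (simp add: K_def 2)
        qed
        from integral_derivative_Ioo[OF less_imp_le[OF h] this] show ?thesis
          using cK by (simp add: continuous_intros)
      qed
      moreover have "(\<lambda>n. 1 / z\<^sup>2 - of_real (real n * h) * exp (- of_real (real n * h) * z) / z - exp (- of_real (real n * h) * z) / z\<^sup>2) \<longlonglongrightarrow> 1 / z\<^sup>2 - 0 / z - 0 / z\<^sup>2"
        using z0 by (intro tendsto_intros tendsto_exp_minus_0[OF z h]) auto
      ultimately show ?thesis using 2 by (simp add: power2_eq_square)
    qed
  qed
  from tendsto_add[OF L0 tendsto_mult[OF tendsto_const[of H0] this]]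
  have "(\<lambda>n. of_nat n * (LINT r|lebesgue_on {0<..<h}. (H r - H0) * K n r) + H0 * (of_nat n * (LINT r|lebesgue_on {0<..<h}. K n r))) \<longlonglongrightarrow> H0 / z ^ Suc p"
    by simp
  moreover have "of_nat n * (LINT r|lebesgue_on {0<..<h}. (H r - H0) * K n r) + H0 * (of_nat n * (LINT r|lebesgue_on {0<..<h}. K n r))
    = of_nat n * (LINT r|lebesgue_on {0<..<h}. H r * K n r)" for n
  proof -
    have "(LINT r|lebesgue_on {0<..<h}. H r * K n r) = (LINT r|lebesgue_on {0<..<h}. (H r - H0) * K n r + H0 * K n r)"
      by (simp add: algebra_simps)
    also have "\<dots> = (LINT r|lebesgue_on {0<..<h}. (H r - H0) * K n r) + H0 * (LINT r|lebesgue_on {0<..<h}. K n r)"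
      using iH iK by simp
    finally show ?thesis by (simp add: algebra_simps)
  qed
  ultimately show ?thesis unfolding K_def by simp
qed

section \<open>Relations between the values at the vertex\<close>

definition regular_at_0 :: "real \<Rightarrow> (real \<Rightarrow> complex) \<Rightarrow> complex \<Rightarrow> bool" where
  "regular_at_0 h H H0 \<longleftrightarrow> H \<in> borel_measurable (lebesgue_on {0<..<h}) \<and>
     (\<exists>B. \<forall>r\<in>{0<..<h}. norm (H r) \<le> B) \<and> (H \<longlongrightarrow> H0) (at_right 0)"

lemma regular_at_0_add:
  assumes "regular_at_0 h H H0" "regular_at_0 h G G0"
  shows "regular_at_0 h (\<lambda>r. H r + G r) (H0 + G0)"
proof -
  obtain B C where "\<forall>r\<in>{0<..<h}. norm (H r) \<le> B" "\<forall>r\<in>{0<..<h}. norm (G r) \<le> C"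
    using assms by (auto simp: regular_at_0_def)
  then have "\<forall>r\<in>{0<..<h}. norm (H r + G r) \<le> B + C" by (auto intro!: norm_triangle_mono)
  then show ?thesis using assms unfolding regular_at_0_def by (auto intro: tendsto_add)
qed

lemma regular_at_0_mult:
  assumes "regular_at_0 h H H0" "regular_at_0 h G G0"
  shows "regular_at_0 h (\<lambda>r. H r * G r) (H0 * G0)"
proof -
  obtain B C where "\<forall>r\<in>{0<..<h}. norm (H r) \<le> B" "\<forall>r\<in>{0<..<h}. norm (G r) \<le> C"
    using assms by (auto simp: regular_at_0_def)
  then have "\<forall>r\<in>{0<..<h}. norm (H r * G r) \<le> B * C"
    by (auto simp: norm_mult intro!: mult_mono intro: order_trans[OF norm_ge_zero])
  then show ?thesis using assms unfolding regular_at_0_def by (auto intro: tendsto_mult)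
qed

lemma regular_at_0_const: "regular_at_0 h (\<lambda>r. c) c"
  by (auto simp: regular_at_0_def)

lemma regular_at_0_sum:
  "(\<And>i. i \<in> I \<Longrightarrow> regular_at_0 h (H i) (H0 i)) \<Longrightarrow> regular_at_0 h (\<lambda>r. \<Sum>i\<in>I. H i r) (\<Sum>i\<in>I. H0 i)"
  by (induction I rule: infinite_finite_induct) (auto intro: regular_at_0_const[of h 0, simplified] regular_at_0_add)

lemma regular_at_0_continuous:
  assumes "continuous_on UNIV H" shows "regular_at_0 h H (H 0)"
proof -
  obtain B where "\<And>r. r \<in> {0<..<h} \<Longrightarrow> norm (H r) \<le> B"
    using bounded_on_continuous[OF assms bounded_Ioo[of 0 h]] by blast
  moreover have "(H \<longlongrightarrow> H 0) (at_right 0)"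
    using assms by (auto simp: continuous_on_def intro: tendsto_within_subset)
  ultimately show ?thesis
    using measurable_lebesgue_on_continuous[OF assms] unfolding regular_at_0_def by blast
qed

lemma regular_at_0_integrable: "regular_at_0 h H H0 \<Longrightarrow> integrable (lebesgue_on {0<..<h}) H"
  unfolding regular_at_0_def by (auto intro: integrable_bounded_lebesgue_on)

definition laplace :: "real \<Rightarrow> complex \<Rightarrow> nat \<Rightarrow> (real \<Rightarrow> complex) \<Rightarrow> nat \<Rightarrow> complex" where
  "laplace h z p H n = of_nat n *
    (LINT r|lebesgue_on {0<..<h}. H r * (of_real ((real n * r) ^ p) * exp (- of_real (real n * r) * z)))"

lemma laplace_tendsto:
  assumes "Re z > 0" "h > 0" "regular_at_0 h H H0" "p \<le> 1"
  shows "laplace h z p H \<longlonglongrightarrow> H0 / z ^ Suc p"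
proof -
  obtain B where B: "\<And>r. r \<in> {0<..<h} \<Longrightarrow> norm (H r) \<le> B"
    using assms(3) unfolding regular_at_0_def by blast
  show ?thesis
    unfolding laplace_def
    by (rule laplace_limit[OF assms(1,2) _ B _ assms(4)])
      (use assms(3) in \<open>auto simp: regular_at_0_def\<close>)
qed

lemma laplace_tendsto_0:
  assumes "Re z > 0" "h > 0" "regular_at_0 h H 0"
  shows "laplace h z p H \<longlonglongrightarrow> 0"
proof -
  obtain B where B: "\<And>r. r \<in> {0<..<h} \<Longrightarrow> norm (H r) \<le> B"
    using assms(3) unfolding regular_at_0_def by blast
  show ?thesis
    unfolding laplace_def
    by (rule laplace_limit_0[OF assms(1,2) _ B])
      (use assms(3) in \<open>auto simp: regular_at_0_def\<close>)
qed

lemma laplace_integrable: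
  assumes "regular_at_0 h H H0"
  shows "integrable (lebesgue_on {0<..<h}) (\<lambda>r. H r * (of_real ((real n * r) ^ p) * exp (- of_real (real n * r) * z)))"
  by (rule regular_at_0_integrable, rule regular_at_0_mult[OF assms regular_at_0_continuous])
    (intro continuous_intros)

text \<open>A power of \<open>n\<close> is traded for a division by \<open>r\<close>. This is how a
  displacement of order o(r) makes up for the extra factor \<open>n\<close> that it carries in
  comparison with the traction.\<close>

lemma laplace_divide:
  "of_nat n * laplace h z p H n = laplace h z (Suc p) (\<lambda>r. H r / of_real r) n"
proof -
  have "(LINT r|lebesgue_on {0<..<h}. of_nat n * (H r * (of_real ((real n * r) ^ p) * exp (- of_real (real n * r) * z)))) =
    (LINT r|lebesgue_on {0<..<h}. H r / of_real r * (of_real ((real n * r) ^ Suc p) * exp (- of_real (real n * r) * z)))"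
    by (intro Bochner_Integration.integral_cong) auto
  then show ?thesis unfolding laplace_def by simp
qed

section \<open>Green's formula with exponential fields\<close>

context sector_data
begin

text \<open>Equal to 1 up to \<delta> and to 0 from 2 \<delta> on, so its derivative lives away from
  the vertex and the cutoff itself away from the arc.\<close>

definition \<eta> :: "real \<Rightarrow> real" where "\<eta> t = step (- (1 / \<delta>) * t + 2)"
definition \<eta>' :: "real \<Rightarrow> real" where "\<eta>' t = - (1 / \<delta>) * step' (- (1 / \<delta>) * t + 2)"

lemma smooth_\<eta>: "smooth \<eta>" "smooth \<eta>'"
  unfolding \<eta>_def[abs_def] \<eta>'_def[abs_def]
  by (intro smooth_mult smooth_const smooth_comp_linear smooth_step smooth_step' bounded_linear_mult_right)+

lemma \<eta>_DERIV: "(\<eta> has_field_derivative \<eta>' t) (at t)"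
proof -
  have "((\<lambda>t. - (1 / \<delta>) * t + 2) has_field_derivative - (1 / \<delta>)) (at t)"
    using \<delta>_pos by (auto intro!: derivative_eq_intros)
  from DERIV_chain2[OF step_DERIV this] show ?thesis
    unfolding \<eta>_def[abs_def] \<eta>'_def by (simp only: mult.commute)
qed

lemma \<eta>_0: "\<eta> 0 = 1" by (simp add: \<eta>_def step_eq_1)

lemma \<eta>_eq_0: "t > 2 * \<delta> \<Longrightarrow> \<eta> t = 0"
  using \<delta>_pos by (auto simp: \<eta>_def field_simps intro!: step_eq_0)

lemma \<eta>'_eq_0: "t < \<delta> \<Longrightarrow> \<eta>' t = 0"
  using \<delta>_pos by (auto simp: \<eta>'_def field_simps intro!: step'_eq_0)

lemma \<eta>'_bounded: obtains B where "B > 0" "\<And>t. \<bar>\<eta>' t\<bar> \<le> B"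
proof -
  obtain B where B: "B > 0" "\<And>t. \<bar>step' t\<bar> \<le> B" using step'_bounded by blast
  have "\<bar>\<eta>' t\<bar> \<le> B / \<delta>" for t
    using B(2)[of "- (1 / \<delta>) * t + 2"] \<delta>_pos by (simp add: \<eta>'_def abs_mult divide_right_mono)
  then show ?thesis using that[of "B / \<delta>"] B(1) \<delta>_pos by simp
qed

abbreviation "pt \<sigma> \<equiv> polar (\<theta>0 + \<sigma> * \<alpha>)"

abbreviation "side_density u0 \<sigma> r \<equiv>
  boundary_density lam mu u0 (f \<sigma>) (g \<sigma>) (side_normal \<sigma> (\<theta>0 + \<sigma> * \<alpha>)) (pt \<sigma> r)"

lemma regular_\<eta>: "regular_at_0 h (\<lambda>r. of_real (\<eta> (r * cos \<alpha>))) 1"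
proof -
  have "continuous_on UNIV (\<lambda>r. complex_of_real (\<eta> (r * cos \<alpha>)))"
    by (intro continuous_on_of_real continuous_on_compose2[OF smooth_continuous[OF smooth_\<eta>(1)]] continuous_intros) simp
  from regular_at_0_continuous[OF this] show ?thesis by (simp add: \<eta>_0)
qed

lemma exp_field_identity:
  assumes \<tau>: "\<tau> \<in> {1, -1}"
    and ac: "of_real (lam + mu) * (zeta \<tau> \<theta>0 $ 1 * a $ 1 + zeta \<tau> \<theta>0 $ 2 * a $ 2 - 2 * c) = 4 * of_real mu * c"
  shows "(LINT x|lebesgue_on \<Omega>. interior_density lam mu (exp_field \<tau> \<theta>0 a c s) u D (polar \<theta>0 1) x * of_real (\<eta>' (x1 x))) =
    (\<Sum>\<sigma>\<in>{1, -1}. LINT r|lebesgue_on {0<..<h}.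
      side_density (exp_field \<tau> \<theta>0 a c s) \<sigma> r * of_real (\<eta> (r * cos \<alpha>)))"
proof (rule cutoff_limit[OF _ _ _ smooth_\<eta>(1) \<eta>_DERIV smooth_continuous[OF smooth_\<eta>(2)] \<eta>_eq_0])
  let ?u0 = "exp_field \<tau> \<theta>0 a c s"
  note su0 = smooth_exp_field[of \<tau> \<theta>0 a c s]
  show "interior_density lam mu ?u0 u D (polar \<theta>0 1) \<in> L2 \<Omega>"
    by (rule L2_interior_density[OF L2(1,4) su0 bounded_\<Omega>])
  show "integrable (lebesgue_on {0<..<h}) (\<lambda>r. side_density ?u0 \<sigma> r)"
    if \<sigma>: "\<sigma> \<in> {1, -1}" for \<sigma>
  proof -
    have cp: "continuous_on UNIV (polar (\<theta>0 + \<sigma> * \<alpha>))"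
      unfolding polar_def by (intro continuous_on_vector_2 continuous_intros)
    have c: "continuous_on UNIV (\<lambda>r. ?u0 (polar (\<theta>0 + \<sigma> * \<alpha>) r) $ k)"
      "continuous_on UNIV (\<lambda>r. stress lam mu (jacobian ?u0 (polar (\<theta>0 + \<sigma> * \<alpha>) r)) $ k $ i * of_real (side_normal \<sigma> (\<theta>0 + \<sigma> * \<alpha>) $ i))" for k i
      using continuous_on_compose2[OF smooth_continuous[OF smooth_vec_nth[OF su0]] cp]
        continuous_on_compose2[OF smooth_continuous[OF smooth_stress_jacobian[OF su0]] cp]
      by (auto intro: continuous_on_mult continuous_on_const)
    have I: "bounded {0<..<h}" "{0<..<h} \<in> lmeasurable" by auto
    show ?thesis
      unfolding boundary_density_def scalar_product_def mult.assoc
      by (intro Bochner_Integration.integrable_diff Bochner_Integration.integrable_sum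
          L2_mult_integrable[OF L2_nth[OF L2_g[OF \<sigma>]] I c(1)] L2_mult_integrable[OF L2_nth[OF L2_f[OF \<sigma>]] I c(2)])
  qed
  fix k k' \<epsilon> assume k: "\<epsilon> > 0" "smooth k" "\<And>t. (k has_field_derivative k' t) (at t)"
    "\<And>t. t < \<epsilon> \<or> t > 2 * \<delta> \<Longrightarrow> k t = 0"
  show "(LINT x|lebesgue_on \<Omega>. interior_density lam mu ?u0 u D (polar \<theta>0 1) x * of_real (k' (x1 x))) =
    (\<Sum>\<sigma>\<in>{1, -1}. LINT r|lebesgue_on {0<..<h}.
      side_density ?u0 \<sigma> r * of_real (k (r * cos \<alpha>)))"
    by (rule sector_identity[OF su0 divergence_free_exp_field[OF \<tau> ac] k(2,3,1)]) (rule k(4))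
qed

text \<open>Where the derivative of the cutoff is nonzero, the bisector coordinate is at least
  \<delta>, so the exponential is at most exp (- n \<delta>), which beats every power of
  \<open>n\<close>.\<close>

lemma interior_decay:
  assumes m: "m \<in> L2 \<Omega>"
  shows "(\<lambda>n. of_nat n ^ p * (LINT x|lebesgue_on \<Omega>. exp (- of_nat n * phase \<tau> \<theta>0 x) * m x * of_real (\<eta>' (x1 x)))) \<longlonglongrightarrow> 0"
proof -
  let ?F = "\<lambda>n x. exp (- of_nat n * phase \<tau> \<theta>0 x) * m x * of_real (\<eta>' (x1 x))"
  obtain B where B: "B > 0" "\<And>t. \<bar>\<eta>' t\<bar> \<le> B" using \<eta>'_bounded by blast
  define A where "A = (LINT x|lebesgue_on \<Omega>. norm (m x))"
  have im: "integrable (lebesgue_on \<Omega>) m" by (rule L2_integrable[OF m bounded_\<Omega> lmeasurable_\<Omega>])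
  have bound: "norm (of_nat n ^ p * (LINT x|lebesgue_on \<Omega>. ?F n x))
      \<le> A * B * (real n ^ p * exp (- (real n * \<delta>)))" for n
  proof -
    have "norm (LINT x|lebesgue_on \<Omega>. ?F n x)
      \<le> (LINT x|lebesgue_on \<Omega>. norm (m x) * (B * exp (- (real n * \<delta>))))"
    proof (rule Bochner_Integration.integral_norm_bound_integral)
      have "continuous_on UNIV (\<lambda>x. exp (- of_nat n * phase \<tau> \<theta>0 x) * of_real (\<eta>' (x1 x)))"
        by (intro continuous_intros continuous_on_of_real linear_continuous_on bounded_linear_phase
            continuous_on_compose2[OF smooth_continuous[OF smooth_\<eta>(2)] continuous_coords(1)]) simp
      from L2_mult_integrable[OF m bounded_\<Omega> lmeasurable_\<Omega> this]
      show "integrable (lebesgue_on \<Omega>) (\<lambda>x. ?F n x)"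
        by (simp add: mult_ac)
      show "integrable (lebesgue_on \<Omega>) (\<lambda>x. norm (m x) * (B * exp (- (real n * \<delta>))))"
        using im by simp
      fix x
      have n: "norm (exp (- of_nat n * phase \<tau> \<theta>0 x)) = exp (- (real n * x1 x))"
        by (simp add: norm_exp_eq_Re phase_def)
      show "norm (?F n x) \<le> norm (m x) * (B * exp (- (real n * \<delta>)))"
      proof (cases "x1 x < \<delta>")
        case True
        then show ?thesis using \<eta>'_eq_0 B by simp
      next
        case False
        have "norm (?F n x) =
          norm (m x) * (\<bar>\<eta>' (x1 x)\<bar> * exp (- (real n * x1 x)))"
          unfolding norm_mult n by simp
        also have "\<dots> \<le> norm (m x) * (B * exp (- (real n * \<delta>)))"
          using B False by (intro mult_left_mono mult_mono) (auto intro: mult_left_mono)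
        finally show ?thesis .
      qed
    qed
    also have "\<dots> = A * (B * exp (- (real n * \<delta>)))" by (simp add: A_def)
    finally have "real n ^ p * norm (LINT x|lebesgue_on \<Omega>. ?F n x)
       \<le> real n ^ p * (A * (B * exp (- (real n * \<delta>))))" by (intro mult_left_mono) auto
    then show ?thesis unfolding norm_mult norm_power norm_of_nat by (simp only: mult_ac)
  qed
  have lim: "(\<lambda>n. A * B * (real n ^ p * exp (- (real n * \<delta>)))) \<longlonglongrightarrow> 0"
    using tendsto_mult[OF tendsto_const[of "A * B"] exp_decay_tendsto_0[OF \<delta>_pos, of p]]
    by (simp only: mult_zero_right)
  show ?thesis
    by (rule Lim_null_comparison[OF always_eventually lim]) (intro allI bound)
qed

text \<open>Up to the exponential, the density is a quadratic polynomial in \<open>n\<close> with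
  the square integrable coefficients \<open>m0\<close>, \<open>m1\<close>, \<open>m2\<close>; the
  exponential decay outweighs these powers and the further factor with exponent
  \<open>j\<close>.\<close>

lemma interior_tendsto_0:
  assumes \<tau>: "\<tau> \<in> {1, -1}"
  shows "(\<lambda>n. of_nat n ^ j * (LINT x|lebesgue_on \<Omega>. interior_density lam mu (exp_field \<tau> \<theta>0 a c (real n)) u D (polar \<theta>0 1) x * of_real (\<eta>' (x1 x)))) \<longlonglongrightarrow> 0"
proof -
  define d where "d i = complex_of_real (polar \<theta>0 1 $ i)" for i
  define \<zeta> where "\<zeta> = zeta \<tau> \<theta>0"
  define P where "P = phase (- \<tau>) \<theta>0"
  define A0 where "A0 = stress0 lam mu \<zeta> (zeta (- \<tau>) \<theta>0) a c"
  define m0 where "m0 x = (\<Sum>k\<in>UNIV. \<Sum>i\<in>UNIV. stress lam mu (D x) $ k $ i * (a $ k * d i))" for x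
  define m1 where "m1 x = (\<Sum>k\<in>UNIV. \<Sum>i\<in>UNIV. stress lam mu (D x) $ k $ i * (c * \<zeta> $ k * P x * d i) - u x $ k * (A0 k i * d i))" for x
  define m2 where "m2 x = (\<Sum>k\<in>UNIV. \<Sum>i\<in>UNIV. u x $ k * (2 * of_real mu * c * \<zeta> $ i * \<zeta> $ k * P x * d i))" for x
  have cP: "continuous_on UNIV P" unfolding P_def by (rule linear_continuous_on[OF bounded_linear_phase])
  have L2m: "m0 \<in> L2 \<Omega>" "m1 \<in> L2 \<Omega>" "m2 \<in> L2 \<Omega>"
    unfolding m0_def[abs_def] m1_def[abs_def] m2_def[abs_def] sum_2
    by (intro L2_add L2_diff L2_mult_continuous L2_stress L2_nth L2 bounded_\<Omega> continuous_intros cP)+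
  have eq: "interior_density lam mu (exp_field \<tau> \<theta>0 a c (real n)) u D (polar \<theta>0 1) x * of_real (\<eta>' (x1 x)) =
     exp (- of_nat n * phase \<tau> \<theta>0 x) * m0 x * of_real (\<eta>' (x1 x)) +
     (of_nat n * (exp (- of_nat n * phase \<tau> \<theta>0 x) * m1 x * of_real (\<eta>' (x1 x))) +
     of_nat n ^ 2 * (exp (- of_nat n * phase \<tau> \<theta>0 x) * m2 x * of_real (\<eta>' (x1 x))))" for n x
    unfolding interior_density_def stress_exp_field[OF \<tau>] m0_def m1_def m2_def exp_field_def vec_lambda_beta
      \<zeta>_def[symmetric] A0_def[symmetric] P_def[symmetric] d_def[symmetric] sum_2
    by (simp add: algebra_simps power2_eq_square)
  have int: "integrable (lebesgue_on \<Omega>) (\<lambda>x. exp (- of_nat n * phase \<tau> \<theta>0 x) * m x * of_real (\<eta>' (x1 x)))"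
    if "m \<in> L2 \<Omega>" for m n
  proof -
    have "continuous_on UNIV (\<lambda>x. exp (- of_nat n * phase \<tau> \<theta>0 x) * of_real (\<eta>' (x1 x)))"
      by (intro continuous_intros continuous_on_of_real linear_continuous_on bounded_linear_phase
          continuous_on_compose2[OF smooth_continuous[OF smooth_\<eta>(2)] continuous_coords(1)]) simp
    from L2_mult_integrable[OF that bounded_\<Omega> lmeasurable_\<Omega> this] show ?thesis by (simp add: mult_ac)
  qed
  define J where "J m n = (LINT x|lebesgue_on \<Omega>. exp (- of_nat n * phase \<tau> \<theta>0 x) * m x * of_real (\<eta>' (x1 x)))" for m n
  have "of_nat n ^ j * (LINT x|lebesgue_on \<Omega>. interior_density lam mu (exp_field \<tau> \<theta>0 a c (real n)) u D (polar \<theta>0 1) x * of_real (\<eta>' (x1 x))) =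
    of_nat n ^ j * J m0 n + (of_nat n ^ (Suc j) * J m1 n + of_nat n ^ (j + 2) * J m2 n)" for n
  proof -
    have "(LINT x|lebesgue_on \<Omega>. interior_density lam mu (exp_field \<tau> \<theta>0 a c (real n)) u D (polar \<theta>0 1) x * of_real (\<eta>' (x1 x))) =
      J m0 n + (of_nat n * J m1 n + of_nat n ^ 2 * J m2 n)"
      unfolding eq J_def using int[OF L2m(1), of n] int[OF L2m(2), of n] int[OF L2m(3), of n] by simp
    then show ?thesis by (simp only:) (simp add: algebra_simps power_add power2_eq_square)
  qed
  moreover have "(\<lambda>n. of_nat n ^ j * J m0 n + (of_nat n ^ (Suc j) * J m1 n + of_nat n ^ (j + 2) * J m2 n)) \<longlonglongrightarrow> 0 + (0 + 0)"
    unfolding J_def by (intro tendsto_add interior_decay L2m)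
  ultimately show ?thesis by simp
qed

end

lemma phase_polar: "\<tau> \<in> {1, -1} \<Longrightarrow> phase \<tau> \<theta> (polar (\<theta> + \<beta>) r) = of_real r * cis (\<tau> * \<beta>)"
  unfolding phase_def along_polar across_polar by (auto simp: complex_eq_iff)

text \<open>The normal is the bisector direction turned by \<sigma> (\<alpha> + pi / 2), so
  \<open>phase_polar\<close> evaluates the product as a unimodular number with that angle.\<close>

lemma zeta_dot_side_normal:
  assumes "\<tau> \<in> {1, -1}" "\<sigma> \<in> {1, -1}"
  shows "of_real (side_normal \<sigma> (\<theta> + \<sigma> * \<alpha>) $ 1) * zeta \<tau> \<theta> $ 1 + of_real (side_normal \<sigma> (\<theta> + \<sigma> * \<alpha>) $ 2) * zeta \<tau> \<theta> $ 2
    = \<i> * of_real (\<tau> * \<sigma>) * cis (\<tau> * \<sigma> * \<alpha>)"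
proof -
  have "side_normal \<sigma> (\<theta> + \<sigma> * \<alpha>) = polar (\<theta> + (\<sigma> * \<alpha> + \<sigma> * (pi / 2))) 1"
    using assms(2) by (auto simp: side_normal_def polar_def add.assoc[symmetric] sin_add cos_add sin_diff cos_diff
        simp del: minus_add_distrib)
  then have "of_real (side_normal \<sigma> (\<theta> + \<sigma> * \<alpha>) $ 1) * zeta \<tau> \<theta> $ 1 + of_real (side_normal \<sigma> (\<theta> + \<sigma> * \<alpha>) $ 2) * zeta \<tau> \<theta> $ 2
      = cis (\<tau> * (\<sigma> * \<alpha> + \<sigma> * (pi / 2)))"
    using phase_polar[OF assms(1)] by (simp flip: phase_eq[OF assms(1)])
  also have "\<dots> = cis (\<tau> * \<sigma> * \<alpha>) * cis (\<tau> * \<sigma> * (pi / 2))"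
    by (simp add: cis_mult algebra_simps)
  also have "cis (\<tau> * \<sigma> * (pi / 2)) = \<i> * of_real (\<tau> * \<sigma>)"
    using assms by (auto simp: complex_eq_iff)
  finally show ?thesis by (simp add: mult_ac)
qed

text \<open>The two isotropic vectors, for \<tau> = 1 and \<tau> = -1, are linearly
  independent.\<close>

lemma zeta_separates:
  fixes x :: "complex^2"
  assumes "\<And>\<tau>. \<tau> \<in> {1, -1} \<Longrightarrow> x $ 1 * zeta \<tau> \<theta> $ 1 + x $ 2 * zeta \<tau> \<theta> $ 2 = 0"
  shows "x = 0"
proof -
  have "cis (- \<tau> * \<theta>) * (x $ 1 + \<i> * of_real \<tau> * x $ 2) = 0" if "\<tau> \<in> {1, -1}" for \<tau>
    using assms[OF that] by (simp add: zeta_nth algebra_simps)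
  then have "x $ 1 + \<i> * x $ 2 = 0" "x $ 1 - \<i> * x $ 2 = 0"
    by (force, force)
  then have "x $ 1 = 0" "\<i> * x $ 2 = 0" by (auto simp: complex_eq_iff)
  then show ?thesis by (simp add: vec_eq_iff forall_2)
qed

section \<open>Leading terms of the boundary integrals\<close>

context sector_data
begin

definition pair :: "complex^2 \<Rightarrow> complex^2 \<Rightarrow> complex" where
  "pair x y = x $ 1 * y $ 1 + x $ 2 * y $ 2"

text \<open>The pairing of a displacement \<open>x\<close> with the traction of a constant stress
  \<open>A\<close> on the side \<sigma>.\<close>

definition f_coeff :: "(2 \<Rightarrow> 2 \<Rightarrow> complex) \<Rightarrow> real \<Rightarrow> complex^2 \<Rightarrow> complex" where
  "f_coeff A \<sigma> x = (\<Sum>k\<in>UNIV. \<Sum>i\<in>UNIV. x $ k * A k i * of_real (side_normal \<sigma> (\<theta>0 + \<sigma> * \<alpha>) $ i))"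

text \<open>On a side the phases are r times unimodular constants, so the field depends on s r
  alone. In the terms with \<open>f\<close> the differentiation has brought out one more factor
  \<open>s\<close>.\<close>

lemma boundary_density_pt:
  assumes \<tau>: "\<tau> \<in> {1, -1}"
  shows "side_density (exp_field \<tau> \<theta>0 a c s) \<sigma> r =
    exp (- of_real (s * r) * cis (\<tau> * \<sigma> * \<alpha>)) *
    (pair (g \<sigma> (pt \<sigma> r)) a + c * cis (- (\<tau> * \<sigma> * \<alpha>)) * of_real (s * r) * pair (g \<sigma> (pt \<sigma> r)) (zeta \<tau> \<theta>0)
     - of_real s * f_coeff (stress0 lam mu (zeta \<tau> \<theta>0) (zeta (- \<tau>) \<theta>0) a c) \<sigma> (f \<sigma> (pt \<sigma> r))
     - of_real s * of_real (s * r) * cis (- (\<tau> * \<sigma> * \<alpha>)) *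
        f_coeff (\<lambda>k i. - 2 * of_real mu * c * zeta \<tau> \<theta>0 $ i * zeta \<tau> \<theta>0 $ k) \<sigma> (f \<sigma> (pt \<sigma> r)))"
proof -
  have m: "- \<tau> \<in> {1, -1}" using \<tau> by auto
  define E where "E = exp (- of_real (s * r) * cis (\<tau> * \<sigma> * \<alpha>))"
  define z' where "z' = cis (- (\<tau> * \<sigma> * \<alpha>))"
  have p: "phase (- \<tau>) \<theta>0 (pt \<sigma> r) = of_real r * z'" "exp (- of_real s * phase \<tau> \<theta>0 (pt \<sigma> r)) = E"
    unfolding phase_polar[OF \<tau>] phase_polar[OF m] E_def z'_def by (simp_all add: mult_ac)
  show ?thesis
    unfolding boundary_density_def scalar_product_def f_coeff_def pair_def stress_exp_field[OF \<tau>] exp_field_def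
      vec_lambda_beta p E_def[symmetric] z'_def[symmetric] sum_2
    by (simp add: algebra_simps power2_eq_square)
qed

lemma regular_pair:
  assumes "\<And>k. regular_at_0 h (\<lambda>r. x r $ k) (X $ k)"
  shows "regular_at_0 h (\<lambda>r. pair (x r) y) (pair X y)"
  unfolding pair_def by (intro regular_at_0_add regular_at_0_mult assms regular_at_0_const)

lemma regular_f_coeff:
  assumes "\<And>k. regular_at_0 h (\<lambda>r. x r $ k) (X $ k)"
  shows "regular_at_0 h (\<lambda>r. f_coeff A \<sigma> (x r)) (f_coeff A \<sigma> X)"
  unfolding f_coeff_def by (intro regular_at_0_sum regular_at_0_mult assms regular_at_0_const)

lemma regular_times_\<eta>:
  "regular_at_0 h H H0 \<Longrightarrow> regular_at_0 h (\<lambda>r. H r * of_real (\<eta> (r * cos \<alpha>))) H0"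
  using regular_at_0_mult[OF _ regular_\<eta>] by fastforce

lemma Re_cis_pos: "\<tau> \<in> {1, -1} \<Longrightarrow> \<sigma> \<in> {1, -1} \<Longrightarrow> Re (cis (\<tau> * \<sigma> * \<alpha>)) > 0"
  using cos_pos by auto

text \<open>Both orders 0 and 1 occur because the field is affine in the conjugate phase. The
  displacement terms keep an uncompensated factor \<open>n\<close>.\<close>

lemma boundary_integral_laplace:
  fixes a :: "complex^2" and c :: complex
  assumes \<tau>: "\<tau> \<in> {1, -1}" and \<sigma>: "\<sigma> \<in> {1, -1}"
    and g: "\<And>k. regular_at_0 h (\<lambda>r. g \<sigma> (pt \<sigma> r) $ k) (G $ k)"
    and f: "\<And>k. regular_at_0 h (\<lambda>r. f \<sigma> (pt \<sigma> r) $ k) (F $ k)"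
  defines "e \<equiv> \<lambda>r. complex_of_real (\<eta> (r * cos \<alpha>))"
  defines "z \<equiv> cis (\<tau> * \<sigma> * \<alpha>)" and "z' \<equiv> cis (- (\<tau> * \<sigma> * \<alpha>))"
  defines "FA \<equiv> f_coeff (stress0 lam mu (zeta \<tau> \<theta>0) (zeta (- \<tau>) \<theta>0) a c) \<sigma>"
  defines "FB \<equiv> f_coeff (\<lambda>k i. - 2 * of_real mu * c * zeta \<tau> \<theta>0 $ i * zeta \<tau> \<theta>0 $ k) \<sigma>"
  shows "of_nat n * (LINT r|lebesgue_on {0<..<h}.
      side_density (exp_field \<tau> \<theta>0 a c (real n)) \<sigma> r * e r) =
    laplace h z 0 (\<lambda>r. pair (g \<sigma> (pt \<sigma> r)) a * e r) n
    + c * z' * laplace h z 1 (\<lambda>r. pair (g \<sigma> (pt \<sigma> r)) (zeta \<tau> \<theta>0) * e r) n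
    - of_nat n * (laplace h z 0 (\<lambda>r. FA (f \<sigma> (pt \<sigma> r)) * e r) n + z' * laplace h z 1 (\<lambda>r. FB (f \<sigma> (pt \<sigma> r)) * e r) n)"
proof -
  define K where "K p r = complex_of_real ((real n * r) ^ p) * exp (- of_real (real n * r) * z)" for p r
  define H1 where "H1 r = pair (g \<sigma> (pt \<sigma> r)) a * e r" for r
  define H2 where "H2 r = pair (g \<sigma> (pt \<sigma> r)) (zeta \<tau> \<theta>0) * e r" for r
  define H3 where "H3 r = FA (f \<sigma> (pt \<sigma> r)) * e r" for r
  define H4 where "H4 r = FB (f \<sigma> (pt \<sigma> r)) * e r" for r
  have i1: "integrable (lebesgue_on {0<..<h}) (\<lambda>r. H1 r * K 0 r)"
    unfolding H1_def K_def e_def by (rule laplace_integrable[OF regular_times_\<eta>[OF regular_pair[OF g]]])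
  have i2: "integrable (lebesgue_on {0<..<h}) (\<lambda>r. H2 r * K 1 r)"
    unfolding H2_def K_def e_def by (rule laplace_integrable[OF regular_times_\<eta>[OF regular_pair[OF g]]])
  have i3: "integrable (lebesgue_on {0<..<h}) (\<lambda>r. H3 r * K 0 r)"
    unfolding H3_def K_def e_def FA_def by (rule laplace_integrable[OF regular_times_\<eta>[OF regular_f_coeff[OF f]]])
  have i4: "integrable (lebesgue_on {0<..<h}) (\<lambda>r. H4 r * K 1 r)"
    unfolding H4_def K_def e_def FB_def by (rule laplace_integrable[OF regular_times_\<eta>[OF regular_f_coeff[OF f]]])
  have eq: "side_density (exp_field \<tau> \<theta>0 a c (real n)) \<sigma> r * e r =
     (H1 r * K 0 r + c * z' * (H2 r * K 1 r)) - (of_nat n * (H3 r * K 0 r) + of_nat n * z' * (H4 r * K 1 r))" for r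
    unfolding boundary_density_pt[OF \<tau>] H1_def H2_def H3_def H4_def K_def FA_def[symmetric] FB_def[symmetric]
      z_def[symmetric] z'_def[symmetric]
    by (simp add: algebra_simps)
  have "(LINT r|lebesgue_on {0<..<h}.
      side_density (exp_field \<tau> \<theta>0 a c (real n)) \<sigma> r * e r) =
    ((LINT r|lebesgue_on {0<..<h}. H1 r * K 0 r) + c * z' * (LINT r|lebesgue_on {0<..<h}. H2 r * K 1 r)) -
    (of_nat n * (LINT r|lebesgue_on {0<..<h}. H3 r * K 0 r) + of_nat n * z' * (LINT r|lebesgue_on {0<..<h}. H4 r * K 1 r))"
    unfolding eq using i1 i2 i3 i4 by simp
  then show ?thesis
    unfolding laplace_def H1_def[symmetric] H2_def[symmetric] H3_def[symmetric] H4_def[symmetric] K_def[symmetric]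
    by (simp only:) (simp add: algebra_simps)
qed

lemma boundary_sum_tendsto_0:
  assumes \<tau>: "\<tau> \<in> {1, -1}"
    and ac: "of_real (lam + mu) * (zeta \<tau> \<theta>0 $ 1 * a $ 1 + zeta \<tau> \<theta>0 $ 2 * a $ 2 - 2 * c) = 4 * of_real mu * c"
  shows "(\<lambda>n. of_nat n ^ j * (\<Sum>\<sigma>\<in>{1, -1}. LINT r|lebesgue_on {0<..<h}.
      side_density (exp_field \<tau> \<theta>0 a c (real n)) \<sigma> r * of_real (\<eta> (r * cos \<alpha>)))) \<longlonglongrightarrow> 0"
  using interior_tendsto_0[OF \<tau>, of j a c] unfolding exp_field_identity[OF \<tau> ac] .

text \<open>The left-hand side is the limit of \<open>n\<close> times the boundary integrals, which
  is zero by the decay of the interior integral. The displacement terms drop out because f / r tends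
  to 0. The Laplace limits give 1/z and 1/z^2 for a unimodular z; together with the conjugate phase
  the latter produces the cube.\<close>

lemma traction_relation:
  assumes \<tau>: "\<tau> \<in> {1, -1}"
    and ac: "of_real (lam + mu) * (zeta \<tau> \<theta>0 $ 1 * a $ 1 + zeta \<tau> \<theta>0 $ 2 * a $ 2 - 2 * c) = 4 * of_real mu * c"
    and g: "\<And>\<sigma> k. \<sigma> \<in> {1, -1} \<Longrightarrow> regular_at_0 h (\<lambda>r. g \<sigma> (pt \<sigma> r) $ k) (G \<sigma> $ k)"
    and f: "\<And>\<sigma> k. \<sigma> \<in> {1, -1} \<Longrightarrow> regular_at_0 h (\<lambda>r. f \<sigma> (pt \<sigma> r) $ k) 0"
    and f': "\<And>\<sigma> k. \<sigma> \<in> {1, -1} \<Longrightarrow> regular_at_0 h (\<lambda>r. f \<sigma> (pt \<sigma> r) $ k / of_real r) 0"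
  shows "(\<Sum>\<sigma>\<in>{1, -1}. pair (G \<sigma>) a * cis (- (\<tau> * \<sigma> * \<alpha>)) + c * pair (G \<sigma>) (zeta \<tau> \<theta>0) * cis (- (\<tau> * \<sigma> * \<alpha>)) ^ 3) = 0"
proof -
  define e where "e r = complex_of_real (\<eta> (r * cos \<alpha>))" for r
  define I where "I \<sigma> n = (LINT r|lebesgue_on {0<..<h}.
      side_density (exp_field \<tau> \<theta>0 a c (real n)) \<sigma> r * e r)" for \<sigma> n
  have "(\<lambda>n. of_nat n * I \<sigma> n) \<longlonglongrightarrow> pair (G \<sigma>) a * cis (- (\<tau> * \<sigma> * \<alpha>)) + c * pair (G \<sigma>) (zeta \<tau> \<theta>0) * cis (- (\<tau> * \<sigma> * \<alpha>)) ^ 3"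
    if \<sigma>: "\<sigma> \<in> {1, -1}" for \<sigma>
  proof -
    define z where "z = cis (\<tau> * \<sigma> * \<alpha>)"
    define z' where "z' = cis (- (\<tau> * \<sigma> * \<alpha>))"
    have z: "Re z > 0" unfolding z_def by (rule Re_cis_pos[OF \<tau> \<sigma>])
    have zz': "z * z' = 1" by (simp add: z_def z'_def cis_mult)
    then have z0: "z \<noteq> 0" by auto
    have inv: "inverse z = z'" using zz' by (rule inverse_unique)
    have L1: "laplace h z 0 (\<lambda>r. pair (g \<sigma> (pt \<sigma> r)) a * e r) \<longlonglongrightarrow> pair (G \<sigma>) a / z ^ Suc 0"
      unfolding e_def by (intro laplace_tendsto[OF z h] regular_times_\<eta> regular_pair g \<sigma>) simp
    have L2: "laplace h z 1 (\<lambda>r. pair (g \<sigma> (pt \<sigma> r)) (zeta \<tau> \<theta>0) * e r) \<longlonglongrightarrow> pair (G \<sigma>) (zeta \<tau> \<theta>0) / z ^ Suc 1"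
      unfolding e_def by (intro laplace_tendsto[OF z h] regular_times_\<eta> regular_pair g \<sigma>) simp
    have L3: "(\<lambda>n. of_nat n * laplace h z p (\<lambda>r. f_coeff A \<sigma> (f \<sigma> (pt \<sigma> r)) * e r) n) \<longlonglongrightarrow> 0" for p A
    proof -
      have "regular_at_0 h (\<lambda>r. f_coeff A \<sigma> (\<chi> k. f \<sigma> (pt \<sigma> r) $ k / of_real r) * e r) (f_coeff A \<sigma> 0)"
        unfolding e_def by (intro regular_times_\<eta> regular_f_coeff) (use f'[OF \<sigma>] in simp)
      moreover have "f_coeff A \<sigma> (\<chi> k. f \<sigma> (pt \<sigma> r) $ k / of_real r) * e r = f_coeff A \<sigma> (f \<sigma> (pt \<sigma> r)) * e r / of_real r" for r
        by (simp add: f_coeff_def sum_2 divide_inverse algebra_simps)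
      moreover have "f_coeff A \<sigma> 0 = 0" by (simp add: f_coeff_def)
      ultimately show ?thesis
        unfolding laplace_divide by (intro laplace_tendsto_0[OF z h]) simp
    qed
    have "of_nat n * I \<sigma> n = laplace h z 0 (\<lambda>r. pair (g \<sigma> (pt \<sigma> r)) a * e r) n
      + c * z' * laplace h z 1 (\<lambda>r. pair (g \<sigma> (pt \<sigma> r)) (zeta \<tau> \<theta>0) * e r) n
      - (of_nat n * laplace h z 0 (\<lambda>r. f_coeff (stress0 lam mu (zeta \<tau> \<theta>0) (zeta (- \<tau>) \<theta>0) a c) \<sigma> (f \<sigma> (pt \<sigma> r)) * e r) n
        + z' * (of_nat n * laplace h z 1 (\<lambda>r. f_coeff (\<lambda>k i. - 2 * of_real mu * c * zeta \<tau> \<theta>0 $ i * zeta \<tau> \<theta>0 $ k) \<sigma> (f \<sigma> (pt \<sigma> r)) * e r) n))" for n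
    proof -
      have f0: "regular_at_0 h (\<lambda>r. f \<sigma> (pt \<sigma> r) $ k) ((0 :: complex^2) $ k)" for k using f[OF \<sigma>] by simp
      show ?thesis
        unfolding I_def e_def z_def z'_def
        by (subst boundary_integral_laplace[OF \<tau> \<sigma> g[OF \<sigma>] f0]) (simp add: algebra_simps)
    qed
    moreover have "(\<lambda>n. laplace h z 0 (\<lambda>r. pair (g \<sigma> (pt \<sigma> r)) a * e r) n
      + c * z' * laplace h z 1 (\<lambda>r. pair (g \<sigma> (pt \<sigma> r)) (zeta \<tau> \<theta>0) * e r) n
      - (of_nat n * laplace h z 0 (\<lambda>r. f_coeff (stress0 lam mu (zeta \<tau> \<theta>0) (zeta (- \<tau>) \<theta>0) a c) \<sigma> (f \<sigma> (pt \<sigma> r)) * e r) n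
        + z' * (of_nat n * laplace h z 1 (\<lambda>r. f_coeff (\<lambda>k i. - 2 * of_real mu * c * zeta \<tau> \<theta>0 $ i * zeta \<tau> \<theta>0 $ k) \<sigma> (f \<sigma> (pt \<sigma> r)) * e r) n)))
      \<longlonglongrightarrow> pair (G \<sigma>) a / z ^ Suc 0 + c * z' * (pair (G \<sigma>) (zeta \<tau> \<theta>0) / z ^ Suc 1) - (0 + z' * 0)"
      by (intro tendsto_add tendsto_diff tendsto_mult tendsto_const L1 L2 L3)
    moreover have "pair (G \<sigma>) a / z ^ Suc 0 + c * z' * (pair (G \<sigma>) (zeta \<tau> \<theta>0) / z ^ Suc 1) - (0 + z' * 0) =
        pair (G \<sigma>) a * z' + c * pair (G \<sigma>) (zeta \<tau> \<theta>0) * z' ^ 3"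
      by (simp add: divide_inverse inv power3_eq_cube)
    ultimately show ?thesis by (simp add: z'_def)
  qed
  then have "(\<lambda>n. \<Sum>\<sigma>\<in>{1, -1}. of_nat n * I \<sigma> n) \<longlonglongrightarrow>
     (\<Sum>\<sigma>\<in>{1, -1}. pair (G \<sigma>) a * cis (- (\<tau> * \<sigma> * \<alpha>)) + c * pair (G \<sigma>) (zeta \<tau> \<theta>0) * cis (- (\<tau> * \<sigma> * \<alpha>)) ^ 3)"
    by (rule tendsto_sum)
  moreover have "(\<lambda>n. \<Sum>\<sigma>\<in>{1, -1}. of_nat n * I \<sigma> n) \<longlonglongrightarrow> 0"
    using boundary_sum_tendsto_0[OF \<tau> ac, of 1] unfolding I_def e_def sum_distrib_left by simp
  ultimately show ?thesis by (rule LIMSEQ_unique)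
qed

text \<open>For \<open>a\<close> equal to \<open>zeta\<close> and \<open>c = 0\<close> the stress is
  a multiple of the dyadic square of \<open>zeta\<close>. Its traction contains the product of
  \<open>zeta\<close> with the normal, a multiple of z, which cancels the 1/z of the Laplace limit.
  The remaining coefficient depends on the side only through the sign \<sigma>, so the sum over the
  sides is a difference.\<close>

lemma displacement_relation:
  assumes \<tau>: "\<tau> \<in> {1, -1}" and mu: "mu \<noteq> 0"
    and g: "\<And>\<sigma> k. \<sigma> \<in> {1, -1} \<Longrightarrow> regular_at_0 h (\<lambda>r. g \<sigma> (pt \<sigma> r) $ k) (G \<sigma> $ k)"
    and f: "\<And>\<sigma> k. \<sigma> \<in> {1, -1} \<Longrightarrow> regular_at_0 h (\<lambda>r. f \<sigma> (pt \<sigma> r) $ k) (F \<sigma> $ k)"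
  shows "pair (F 1) (zeta \<tau> \<theta>0) = pair (F (-1)) (zeta \<tau> \<theta>0)"
proof -
  define \<zeta> where "\<zeta> = zeta \<tau> \<theta>0"
  define A where "A = stress0 lam mu \<zeta> (zeta (- \<tau>) \<theta>0) \<zeta> 0"
  define e where "e r = complex_of_real (\<eta> (r * cos \<alpha>))" for r
  define z where "z \<sigma> = cis (\<tau> * \<sigma> * \<alpha>)" for \<sigma>
  define I where "I \<sigma> n = (LINT r|lebesgue_on {0<..<h}.
      side_density (exp_field \<tau> \<theta>0 \<zeta> 0 (real n)) \<sigma> r * e r)" for \<sigma> n
  define P where "P \<sigma> = laplace h (z \<sigma>) 0 (\<lambda>r. pair (g \<sigma> (pt \<sigma> r)) \<zeta> * e r)" for \<sigma>
  define Q where "Q \<sigma> = laplace h (z \<sigma>) 0 (\<lambda>r. f_coeff A \<sigma> (f \<sigma> (pt \<sigma> r)) * e r)" for \<sigma>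
  have iso: "\<zeta> $ 1 * \<zeta> $ 1 + \<zeta> $ 2 * \<zeta> $ 2 = 0" unfolding \<zeta>_def by (rule zeta_isotropic[OF \<tau>])
  have P: "P \<sigma> \<longlonglongrightarrow> pair (G \<sigma>) \<zeta> / z \<sigma> ^ Suc 0" if "\<sigma> \<in> {1, -1}" for \<sigma>
    unfolding P_def e_def z_def
    by (intro laplace_tendsto[OF Re_cis_pos[OF \<tau> that] h] regular_times_\<eta> regular_pair g that) simp
  have Q: "Q \<sigma> \<longlonglongrightarrow> f_coeff A \<sigma> (F \<sigma>) / z \<sigma> ^ Suc 0" if "\<sigma> \<in> {1, -1}" for \<sigma>
    unfolding Q_def e_def z_def
    by (intro laplace_tendsto[OF Re_cis_pos[OF \<tau> that] h] regular_times_\<eta> regular_f_coeff f that) simp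
  have nI: "of_nat n * I \<sigma> n = P \<sigma> n - of_nat n * Q \<sigma> n" if "\<sigma> \<in> {1, -1}" for \<sigma> n
  proof -
    have "f_coeff (\<lambda>k i. - 2 * of_real mu * 0 * zeta \<tau> \<theta>0 $ i * zeta \<tau> \<theta>0 $ k) \<sigma> x = 0" for x
      by (simp add: f_coeff_def)
    then show ?thesis
      unfolding I_def e_def P_def Q_def z_def A_def \<zeta>_def
      by (subst boundary_integral_laplace[OF \<tau> that g[OF that] f[OF that]]) (simp add: laplace_def)
  qed
  have "(\<lambda>n. \<Sum>\<sigma>\<in>{1, -1}. I \<sigma> n) \<longlonglongrightarrow> 0"
    using boundary_sum_tendsto_0[OF \<tau>, of \<zeta> 0 0] iso unfolding I_def e_def \<zeta>_def by simp
  \<comment> \<open>The traction part \<open>P\<close> converges, so division by \<open>n\<close>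
    makes it vanish; what remains of the null sequence is the displacement part
    \<open>Q\<close>.\<close>
  then have "(\<lambda>n. (\<Sum>\<sigma>\<in>{1, -1}. P \<sigma> n) * inverse (of_nat n) - (\<Sum>\<sigma>\<in>{1, -1}. I \<sigma> n)) \<longlonglongrightarrow>
      (\<Sum>\<sigma>\<in>{1, -1}. pair (G \<sigma>) \<zeta> / z \<sigma> ^ Suc 0) * 0 - 0"
    by (intro tendsto_diff tendsto_mult tendsto_sum P lim_inverse_n)
  moreover have "eventually (\<lambda>n. (\<Sum>\<sigma>\<in>{1, -1}. P \<sigma> n) * inverse (of_nat n) - (\<Sum>\<sigma>\<in>{1, -1}. I \<sigma> n) = (\<Sum>\<sigma>\<in>{1, -1}. Q \<sigma> n)) sequentially"
    using eventually_gt_at_top[of 0]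
  proof (rule eventually_mono)
    fix n :: nat assume n: "0 < n"
    have "I \<sigma> n = P \<sigma> n * inverse (of_nat n) - Q \<sigma> n" if "\<sigma> \<in> {1, -1}" for \<sigma>
      using nI[OF that, of n] n by (simp add: field_simps)
    from this[of 1] this[of "-1"]
    show "(\<Sum>\<sigma>\<in>{1, -1}. P \<sigma> n) * inverse (of_nat n) - (\<Sum>\<sigma>\<in>{1, -1}. I \<sigma> n) = (\<Sum>\<sigma>\<in>{1, -1}. Q \<sigma> n)"
      by (simp add: algebra_simps)
  qed
  ultimately have "(\<lambda>n. \<Sum>\<sigma>\<in>{1, -1}. Q \<sigma> n) \<longlonglongrightarrow> 0"
    by (auto intro: Lim_transform_eventually)
  moreover have "(\<lambda>n. \<Sum>\<sigma>\<in>{1, -1}. Q \<sigma> n) \<longlonglongrightarrow> (\<Sum>\<sigma>\<in>{1, -1}. f_coeff A \<sigma> (F \<sigma>) / z \<sigma> ^ Suc 0)"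
    by (intro tendsto_sum Q)
  ultimately have sum0: "(\<Sum>\<sigma>\<in>{1, -1}. f_coeff A \<sigma> (F \<sigma>) / z \<sigma> ^ Suc 0) = 0"
    using LIMSEQ_unique by blast
  have "f_coeff A \<sigma> (F \<sigma>) / z \<sigma> ^ Suc 0 = - 2 * of_real mu * \<i> * of_real \<tau> * of_real \<sigma> * pair (F \<sigma>) \<zeta>" if \<sigma>: "\<sigma> \<in> {1, -1}" for \<sigma>
  proof -
    have A: "A k i = - 2 * of_real mu * \<zeta> $ k * \<zeta> $ i" for k i
      unfolding A_def stress0_def iso by simp
    have "f_coeff A \<sigma> (F \<sigma>) = - 2 * of_real mu * pair (F \<sigma>) \<zeta> *
      (of_real (side_normal \<sigma> (\<theta>0 + \<sigma> * \<alpha>) $ 1) * \<zeta> $ 1 + of_real (side_normal \<sigma> (\<theta>0 + \<sigma> * \<alpha>) $ 2) * \<zeta> $ 2)"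
      unfolding f_coeff_def A pair_def sum_2 by (simp add: algebra_simps)
    also have "\<dots> = - 2 * of_real mu * pair (F \<sigma>) \<zeta> * (\<i> * of_real (\<tau> * \<sigma>) * z \<sigma>)"
      unfolding \<zeta>_def zeta_dot_side_normal[OF \<tau> \<sigma>] z_def ..
    finally show ?thesis by (simp add: z_def)
  qed
  from sum0 this[of 1] this[of "-1"] have "- 2 * of_real mu * \<i> * of_real \<tau> * (pair (F 1) \<zeta> - pair (F (-1)) \<zeta>) = 0"
    by (simp add: algebra_simps)
  then show ?thesis using mu \<tau> by (auto simp: \<zeta>_def)
qed

lemma vertex_displacement_eq:
  assumes mu: "mu \<noteq> 0"
    and g: "\<And>\<sigma> k. \<sigma> \<in> {1, -1} \<Longrightarrow> regular_at_0 h (\<lambda>r. g \<sigma> (pt \<sigma> r) $ k) (G \<sigma> $ k)"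
    and f: "\<And>\<sigma> k. \<sigma> \<in> {1, -1} \<Longrightarrow> regular_at_0 h (\<lambda>r. f \<sigma> (pt \<sigma> r) $ k) (F \<sigma> $ k)"
  shows "F 1 = F (-1)"
proof -
  have "F 1 - F (-1) = 0"
  proof (rule zeta_separates[of _ \<theta>0])
    fix \<tau> :: real assume "\<tau> \<in> {1, -1}"
    from displacement_relation[OF this mu g f]
    show "(F 1 - F (-1)) $ 1 * zeta \<tau> \<theta>0 $ 1 + (F 1 - F (-1)) $ 2 * zeta \<tau> \<theta>0 $ 2 = 0"
      by (simp add: pair_def algebra_simps)
  qed
  then show ?thesis by simp
qed

text \<open>\<open>A\<close> and \<open>B\<close> are the products of the traction values with the
  two isotropic vectors. The two fields with zero affine part eliminate the values at \<sigma> = 1.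
  The other two give Y + c X = 0 and X + c Y = 0 after division by a multiple of sin (2 \<alpha>),
  and 0 < c < 1 makes this system nonsingular.\<close>

lemma vertex_traction_eq_0:
  assumes mu: "mu > 0" "mu + lam > 0"
    and g: "\<And>\<sigma> k. \<sigma> \<in> {1, -1} \<Longrightarrow> regular_at_0 h (\<lambda>r. g \<sigma> (pt \<sigma> r) $ k) (G \<sigma> $ k)"
    and f: "\<And>\<sigma> k. \<sigma> \<in> {1, -1} \<Longrightarrow> regular_at_0 h (\<lambda>r. f \<sigma> (pt \<sigma> r) $ k) 0"
    and f': "\<And>\<sigma> k. \<sigma> \<in> {1, -1} \<Longrightarrow> regular_at_0 h (\<lambda>r. f \<sigma> (pt \<sigma> r) $ k / of_real r) 0"
    and \<sigma>: "\<sigma> \<in> {1, -1}"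
  shows "G \<sigma> = 0"
proof -
  define c where "c = (lam + mu) / (lam + 3 * mu)"
  have c: "0 < c" "c < 1" using mu by (auto simp: c_def)
  have c_eq: "(lam + mu) * (2 - 2 * c) = 4 * mu * c"
    using mu by (simp add: c_def field_simps)
  define q where "q = cis \<alpha>"
  define q' where "q' = cis (- \<alpha>)"
  have qq: "q * q' = 1" by (simp add: q_def q'_def cis_mult)
  define A where "A \<sigma> = pair (G \<sigma>) (zeta 1 \<theta>0)" for \<sigma>
  define B where "B \<sigma> = pair (G \<sigma>) (zeta (-1) \<theta>0)" for \<sigma>
  have 1: "A 1 * q' + A (-1) * q = 0"
    using traction_relation[of 1 "zeta 1 \<theta>0" 0, OF _ _ g f f'] zeta_isotropic[of 1 \<theta>0]
    by (simp add: A_def q_def q'_def)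
  have 2: "B 1 * q + B (-1) * q' = 0"
    using traction_relation[of "-1" "zeta (-1) \<theta>0" 0, OF _ _ g f f'] zeta_isotropic[of "-1" \<theta>0]
    by (simp add: B_def q_def q'_def)
  have ac: "of_real (lam + mu) * (2 - 2 * complex_of_real c) = 4 * of_real mu * of_real c"
    using arg_cong[OF c_eq, of complex_of_real] by simp
  have 3: "B 1 * q' + of_real c * A 1 * q' ^ 3 + (B (-1) * q + of_real c * A (-1) * q ^ 3) = 0"
  proof -
    have "of_real (lam + mu) * (zeta 1 \<theta>0 $ 1 * zeta (-1) \<theta>0 $ 1 + zeta 1 \<theta>0 $ 2 * zeta (-1) \<theta>0 $ 2 - 2 * of_real c) = 4 * of_real mu * complex_of_real c"
      using zeta_conj[of 1 \<theta>0] ac by simp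
    from traction_relation[OF _ this g f f'] show ?thesis by (simp add: A_def B_def q_def q'_def)
  qed
  have 4: "A 1 * q + of_real c * B 1 * q ^ 3 + (A (-1) * q' + of_real c * B (-1) * q' ^ 3) = 0"
  proof -
    have "of_real (lam + mu) * (zeta (-1) \<theta>0 $ 1 * zeta 1 \<theta>0 $ 1 + zeta (-1) \<theta>0 $ 2 * zeta 1 \<theta>0 $ 2 - 2 * of_real c) = 4 * of_real mu * complex_of_real c"
      using zeta_conj[of "-1" \<theta>0] ac by simp
    from traction_relation[OF _ this g f f'] show ?thesis by (simp add: A_def B_def q_def q'_def)
  qed
  have A1: "A 1 = - A (-1) * q\<^sup>2"
  proof -
    have "A 1 * (q * q') = - A (-1) * q * q" using 1 by (simp add: algebra_simps add_eq_0_iff)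
    then show ?thesis by (simp add: qq power2_eq_square)
  qed
  have B1: "B 1 = - B (-1) * q'\<^sup>2"
  proof -
    have "B 1 * (q * q') = - B (-1) * q' * q'" using 2 by (simp add: algebra_simps add_eq_0_iff)
    then show ?thesis by (simp add: qq power2_eq_square)
  qed
  \<comment> \<open>By the first two relations \<open>X\<close> is also \<open>- A 1 * q'\<close>
    and \<open>Y\<close> is \<open>- B 1 * q\<close>. In these unknowns a common factor splits off
    from each of the remaining equations.\<close>
  define X where "X = A (-1) * q"
  define Y where "Y = B (-1) * q'"
  have AX: "A (-1) = X * q'" and BY: "B (-1) = Y * q"
    using qq by (simp_all add: X_def Y_def mult.assoc mult.commute[of q' q])
  \<comment> \<open>The difference is 2 i sin (2 \<alpha>), and 2 \<alpha> lies strictly between 0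
    and pi.\<close>
  have ne: "q\<^sup>2 - q'\<^sup>2 \<noteq> 0"
  proof -
    have "q\<^sup>2 = cis (2 * \<alpha>)" "q'\<^sup>2 = cis (- (2 * \<alpha>))" by (simp_all add: q_def q'_def power2_eq_square cis_mult)
    moreover have "sin (2 * \<alpha>) > 0" using \<alpha> by (intro sin_gt_zero) auto
    ultimately show ?thesis by (auto simp: complex_eq_iff)
  qed
  have q3: "q' * q ^ 3 = q\<^sup>2" "q * q' ^ 3 = q'\<^sup>2"
    using qq by (simp_all add: power2_eq_square power3_eq_cube) (metis mult.assoc mult.commute mult_1)+
  have "(q\<^sup>2 - q'\<^sup>2) * (Y + of_real c * X) = 0"
  proof -
    have eq: "B 1 * q' + of_real c * A 1 * q' ^ 3 + (B (-1) * q + of_real c * A (-1) * q ^ 3) =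
       Y * (q\<^sup>2 - (q * q') * q'\<^sup>2) + of_real c * X * (q' * q ^ 3 - (q * q')\<^sup>2 * q'\<^sup>2)"
      unfolding A1 B1 AX BY by (simp add: algebra_simps power2_eq_square power3_eq_cube)
    show ?thesis using trans[OF sym[OF eq] 3] unfolding q3 qq by (simp add: algebra_simps)
  qed
  then have YX: "Y = - of_real c * X" using ne by (simp add: add_eq_0_iff2)
  have "(q'\<^sup>2 - q\<^sup>2) * (X + of_real c * Y) = 0"
  proof -
    have eq: "A 1 * q + of_real c * B 1 * q ^ 3 + (A (-1) * q' + of_real c * B (-1) * q' ^ 3) =
       X * (q'\<^sup>2 - (q * q') * q\<^sup>2) + of_real c * Y * (q * q' ^ 3 - (q * q')\<^sup>2 * q\<^sup>2)"
      unfolding A1 B1 AX BY by (simp add: algebra_simps power2_eq_square power3_eq_cube)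
    show ?thesis using trans[OF sym[OF eq] 4] unfolding q3 qq by (simp add: algebra_simps)
  qed
  then have XY: "X + of_real c * Y = 0" using ne by simp
  have "X * of_real (1 - c * c) = 0" using XY unfolding YX by (simp add: algebra_simps)
  moreover have "1 - c * c \<noteq> 0" using c mult_strict_mono[of c 1 c 1] by auto
  ultimately have "X = 0" by (metis mult_eq_0_iff of_real_eq_0_iff)
  then have "Y = 0" by (simp add: YX)
  have "A \<sigma> = 0 \<and> B \<sigma> = 0"
    using \<sigma> A1 B1 AX BY \<open>X = 0\<close> \<open>Y = 0\<close> by auto
  then have "pair (G \<sigma>) (zeta \<tau> \<theta>0) = 0" if "\<tau> \<in> {1, -1}" for \<tau>
    using that by (auto simp: A_def B_def)
  then show ?thesis by (intro zeta_separates[of _ \<theta>0]) (simp add: pair_def)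
qed

end

section \<open>Boundary data and weak Jacobians\<close>

text \<open>A Hoelder function on a bounded interval is uniformly continuous, hence extends
  continuously to the endpoint and is bounded.\<close>

lemma holder_on_Ioo_regular:
  fixes G :: "real \<Rightarrow> complex^2"
  assumes h: "0 < h" and \<beta>: "0 < \<beta>" and G: "holder_on \<beta> {0<..<h} G"
  obtains L where "(G \<longlongrightarrow> L) (at_right 0)" "continuous_on {0<..<h} G" "bounded (G ` {0<..<h})"
proof -
  obtain C0 where C0: "\<And>x y. x \<in> {0<..<h} \<Longrightarrow> y \<in> {0<..<h} \<Longrightarrow> dist (G x) (G y) \<le> C0 * dist x y powr \<beta>"
    using G unfolding holder_on_def by blast
  \<comment> \<open>A positive constant is required to solve C d^\<beta> = e for the modulus of
    continuity.\<close>
  define C where "C = \<bar>C0\<bar> + 1"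
  have C: "C > 0" "dist (G x) (G y) \<le> C * dist x y powr \<beta>" if "x \<in> {0<..<h}" "y \<in> {0<..<h}" for x y
  proof -
    have "C0 * dist x y powr \<beta> \<le> C * dist x y powr \<beta>" by (intro mult_right_mono) (auto simp: C_def)
    then show "dist (G x) (G y) \<le> C * dist x y powr \<beta>" using C0[OF that] by linarith
  qed (simp add: C_def)
  have Cpos: "C > 0" by (simp add: C_def add_pos_nonneg)
  have uc: "uniformly_continuous_on {0<..<h} G"
    unfolding uniformly_continuous_on_def
  proof (intro allI impI)
    fix e :: real assume e: "e > 0"
    define d where "d = (e / C) powr (1 / \<beta>)"
    have "d > 0" using e Cpos by (simp add: d_def)
    moreover have "dist (G y) (G x) < e" if "x \<in> {0<..<h}" "y \<in> {0<..<h}" "dist y x < d" for x y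
    proof -
      have "dist y x powr \<beta> < d powr \<beta>" using that(3) \<beta> by (intro powr_less_mono2) auto
      also have "d powr \<beta> = e / C" using \<beta> e Cpos by (simp add: d_def powr_powr)
      finally have "C * dist y x powr \<beta> < e" using Cpos by (simp add: field_simps)
      then show ?thesis using C(2)[OF that(2,1)] by linarith
    qed
    ultimately show "\<exists>d>0. \<forall>x\<in>{0<..<h}. \<forall>x'\<in>{0<..<h}. dist x' x < d \<longrightarrow> dist (G x') (G x) < e" by blast
  qed
  obtain L where "(G \<longlongrightarrow> L) (at 0 within {0<..<h})"
    by (rule uniformly_continuous_on_extension_at_closure[OF uc, of 0]) (use h in auto)
  moreover have "at_right 0 = at 0 within {0<..<h}"
    by (rule at_within_nhd[of _ "{..<h}"]) (use h in auto)
  ultimately have "(G \<longlongrightarrow> L) (at_right 0)" by simp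
  moreover have "continuous_on {0<..<h} G" by (rule uniformly_continuous_imp_continuous[OF uc])
  moreover have "bounded (G ` {0<..<h})"
    by (rule bounded_uniformly_continuous_image[OF uc]) simp
  ultimately show ?thesis by (rule that)
qed

text \<open>The derivative is Hoelder, hence bounded, so the mean value inequality applies. Phrasing
  the result as Hoelder with exponent 1 lets displacements and tractions share one regularity
  lemma.\<close>

lemma C1_holder_side_lipschitz:
  assumes h: "0 < h" and \<alpha>: "0 < \<alpha>" and f: "f \<in> C1_holder_side \<alpha> \<theta> h"
  shows "holder_on 1 {0<..<h} (\<lambda>r. f (polar \<theta> r))"
proof -
  obtain F' where F': "\<And>r. r \<in> {0<..<h} \<Longrightarrow> ((\<lambda>r. f (polar \<theta> r)) has_vector_derivative F' r) (at r)"
    "holder_on \<alpha> {0<..<h} F'"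
    using f unfolding C1_holder_side_def by blast
  obtain L where "bounded (F' ` {0<..<h})" using holder_on_Ioo_regular[OF h \<alpha> F'(2)] by blast
  then obtain B where B: "\<And>r. r \<in> {0<..<h} \<Longrightarrow> norm (F' r) \<le> B"
    unfolding bounded_iff by blast
  show ?thesis
    unfolding holder_on_def
  proof (intro exI[of _ B] ballI)
    fix x y assume xy: "x \<in> {0<..<h}" "y \<in> {0<..<h}"
    have "norm (f (polar \<theta> x) - f (polar \<theta> y)) \<le> B * norm (x - y)"
    proof (rule differentiable_bound[of "{0<..<h}" "\<lambda>r. f (polar \<theta> r)" "\<lambda>r h. h *\<^sub>R F' r"])
      show "((\<lambda>r. f (polar \<theta> r)) has_derivative (\<lambda>h. h *\<^sub>R F' r)) (at r within {0<..<h})" if "r \<in> {0<..<h}" for r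
        using F'(1)[OF that] unfolding has_vector_derivative_def by (rule has_derivative_at_withinI)
      show "onorm (\<lambda>h. h *\<^sub>R F' r) \<le> B" if "r \<in> {0<..<h}" for r
        by (rule onorm_le) (use mult_right_mono[OF B[OF that] abs_ge_zero] in \<open>simp add: mult.commute\<close>)
    qed (use xy in auto)
    then show "dist (f (polar \<theta> x)) (f (polar \<theta> y)) \<le> B * dist x y powr 1"
      by (simp add: dist_norm)
  qed
qed

lemma C_holder_side_holder:
  assumes "g \<in> C_holder_side \<beta> \<theta> h"
  shows "holder_on \<beta> {0<..<h} (\<lambda>r. g (polar \<theta> r))"
proof -
  obtain C where C: "\<And>x y. x \<in> side \<theta> h \<Longrightarrow> y \<in> side \<theta> h \<Longrightarrow> dist (g x) (g y) \<le> C * dist x y powr \<beta>"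
    using assms unfolding C_holder_side_def holder_on_def by blast
  have "dist (polar \<theta> r) (polar \<theta> s) = dist r s" for r s
  proof -
    have "polar \<theta> r - polar \<theta> s = polar \<theta> (r - s)"
      by (simp add: polar_def vec_eq_iff vector_2_nth algebra_simps)
    then show ?thesis by (simp add: dist_norm norm_polar)
  qed
  then show ?thesis
    unfolding holder_on_def using C by (intro exI[of _ C]) (fastforce simp: side_def)
qed

section \<open>Values and gradients at the vertex\<close>

lemma filterlim_polar_at_right:
  assumes "0 < h"
  shows "filterlim (polar \<theta>) (at 0 within side \<theta> h) (at_right 0)"
  unfolding filterlim_at
proof
  have "eventually (\<lambda>r. r \<in> {0<..<h}) (at_right 0)"
    using assms by (rule eventually_at_right_real)
  then show "eventually (\<lambda>r. polar \<theta> r \<in> side \<theta> h \<and> polar \<theta> r \<noteq> 0) (at_right 0)"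
  proof (rule eventually_mono)
    fix r assume "r \<in> {0<..<h}"
    moreover then have "norm (polar \<theta> r) \<noteq> 0" by (simp add: norm_polar)
    ultimately show "polar \<theta> r \<in> side \<theta> h \<and> polar \<theta> r \<noteq> 0" by (auto simp: side_def)
  qed
  have "((\<lambda>r. norm (polar \<theta> r)) \<longlongrightarrow> 0) (at_right 0)"
    unfolding norm_polar by (intro tendsto_rabs_zero) (simp add: tendsto_ident_at)
  then show "(polar \<theta> \<longlongrightarrow> 0) (at_right 0)" by (rule tendsto_norm_zero_cancel)
qed

text \<open>Every point of the side is \<open>polar \<theta>\<close> of its norm, which converts the
  limit in the parameter into the limit along the side. For \<open>Lim\<close> to pick out this
  value the filter must be proper, and it is, because the parametrization maps
  \<open>at_right 0\<close> into it.\<close>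

lemma vertex_value_eq:
  fixes f :: "real^2 \<Rightarrow> complex^2"
  assumes h: "0 < h" and f: "((\<lambda>r. f (polar \<theta> r)) \<longlongrightarrow> L) (at_right 0)"
  shows "vertex_value \<theta> h f = L"
proof -
  have "filterlim norm (at_right 0) (at (0::real^2) within side \<theta> h)"
    unfolding filterlim_at using h
    by (auto simp: eventually_at_filter side_def norm_polar intro!: tendsto_norm_zero tendsto_ident_at always_eventually)
  from filterlim_compose[OF f this]
  have "((\<lambda>x. f (polar \<theta> (norm x))) \<longlongrightarrow> L) (at 0 within side \<theta> h)" .
  moreover have "eventually (\<lambda>x. f (polar \<theta> (norm x)) = f x) (at 0 within side \<theta> h)"
    by (auto simp: eventually_at_filter side_def norm_polar intro!: always_eventually)
  ultimately have lim: "(f \<longlongrightarrow> L) (at 0 within side \<theta> h)"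
    by (rule Lim_transform_eventually)
  have "at 0 within side \<theta> h \<noteq> bot"
  proof
    assume "at 0 within side \<theta> h = bot"
    with filterlim_polar_at_right[OF h, of \<theta>] have "filtermap (polar \<theta>) (at_right 0) = bot"
      unfolding filterlim_def by (simp only: le_bot)
    then show False by (simp add: filtermap_bot_iff)
  qed
  from tendsto_Lim[OF this lim] show ?thesis by (simp add: vertex_value_def)
qed

text \<open>The expansion bounds the quotient by a multiple of r^\<alpha>, and \<alpha> > 0.\<close>

lemma vertex_gradient_0_tendsto:
  fixes f :: "real^2 \<Rightarrow> complex^2"
  assumes h: "0 < h" and \<alpha>: "0 < \<alpha>" and f: "has_vertex_gradient \<alpha> \<theta> h f 0"
  shows "((\<lambda>r. (f (polar \<theta> r) - vertex_value \<theta> h f) /\<^sub>R r) \<longlongrightarrow> 0) (at_right 0)"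
proof -
  obtain C where C: "eventually (\<lambda>x. norm (f x - vertex_value \<theta> h f) \<le> C * norm x powr (1 + \<alpha>)) (at 0 within side \<theta> h)"
    using f unfolding has_vertex_gradient_def by (auto elim!: landau_o.bigE)
  have "eventually (\<lambda>r. norm (f (polar \<theta> r) - vertex_value \<theta> h f) \<le> C * norm (polar \<theta> r) powr (1 + \<alpha>)) (at_right 0)"
    by (rule eventually_compose_filterlim[OF C filterlim_polar_at_right[OF h]])
  moreover have "eventually (\<lambda>r::real. r > 0) (at_right 0)"
    by (simp add: eventually_at_right_less)
  ultimately have ev: "eventually (\<lambda>r. norm ((f (polar \<theta> r) - vertex_value \<theta> h f) /\<^sub>R r) \<le> C * r powr \<alpha>) (at_right 0)"
  proof eventually_elim
    case (elim r)
    have "norm ((f (polar \<theta> r) - vertex_value \<theta> h f) /\<^sub>R r) = norm (f (polar \<theta> r) - vertex_value \<theta> h f) / r"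
      using elim(2) by (simp add: divide_inverse mult.commute)
    also have "\<dots> \<le> C * r powr (1 + \<alpha>) / r" using elim by (intro divide_right_mono) (auto simp: norm_polar)
    also have "\<dots> = C * r powr \<alpha>" using elim(2) by (simp add: powr_add)
    finally show ?case .
  qed
  have "((\<lambda>r. C * r powr \<alpha>) \<longlongrightarrow> C * (0 powr \<alpha>)) (at_right 0)"
    using \<alpha> by (intro tendsto_mult tendsto_const tendsto_powr2) (auto simp: eventually_at_filter tendsto_ident_at)
  then have "((\<lambda>r. C * r powr \<alpha>) \<longlongrightarrow> 0) (at_right 0)" by simp
  then show ?thesis by (rule Lim_null_comparison[OF ev])
qed

lemma regular_at_0_nth:
  fixes G :: "real \<Rightarrow> complex^2"
  assumes "(G \<longlongrightarrow> L) (at_right 0)" "continuous_on {0<..<h} G" "bounded (G ` {0<..<h})"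
  shows "regular_at_0 h (\<lambda>r. G r $ k) (L $ k)"
proof -
  obtain B where "\<forall>r\<in>{0<..<h}. norm (G r) \<le> B" using assms(3) unfolding bounded_iff by auto
  then have "\<forall>r\<in>{0<..<h}. norm (G r $ k) \<le> B"
    using Finite_Cartesian_Product.norm_nth_le order_trans by blast
  moreover have "(\<lambda>r. G r $ k) \<in> borel_measurable (lebesgue_on {0<..<h})"
    by (rule continuous_imp_measurable_on_sets_lebesgue) (use assms(2) in \<open>auto intro: continuous_intros\<close>)
  ultimately show ?thesis using tendsto_vec_nth[OF assms(1)] by (auto simp: regular_at_0_def)
qed

lemma continuous_bounded_L2:
  fixes G :: "real \<Rightarrow> 'b::euclidean_space"
  assumes "continuous_on {0<..<h} G" "bounded (G ` {0<..<h})"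
  shows "G \<in> L2 {0<..<h}"
proof -
  have m: "G \<in> borel_measurable (lebesgue_on {0<..<h})"
    by (rule continuous_imp_measurable_on_sets_lebesgue[OF assms(1)]) simp
  obtain B where B: "\<forall>r\<in>{0<..<h}. norm (G r) \<le> B" using assms(2) unfolding bounded_iff by auto
  have "integrable (lebesgue_on {0<..<h}) (\<lambda>r. (norm (G r))\<^sup>2)"
    by (rule integrable_bounded_lebesgue_on[where B="B\<^sup>2"]) (use m B in \<open>auto intro: power_mono\<close>)
  then show ?thesis using m by (simp add: L2_def)
qed

text \<open>Near 0 the limit bounds the quotient; from distance \<open>b\<close> on, division costs
  at most a factor 1/b.\<close>

lemma regular_at_0_divide:
  assumes h: "0 < h" and H: "regular_at_0 h H 0" and lim: "((\<lambda>r. H r / of_real r) \<longlongrightarrow> 0) (at_right 0)"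
  shows "regular_at_0 h (\<lambda>r. H r / of_real r) 0"
proof -
  obtain B where B: "\<And>r. r \<in> {0<..<h} \<Longrightarrow> norm (H r) \<le> B"
    using H unfolding regular_at_0_def by blast
  have "eventually (\<lambda>r. norm (H r / of_real r) < 1) (at_right 0)"
    using tendstoD[OF lim zero_less_one] by simp
  then obtain b where b: "b > 0" "\<And>r. 0 < r \<Longrightarrow> r < b \<Longrightarrow> norm (H r / of_real r) < 1"
    unfolding eventually_at_right_field by blast
  have "norm (H r / of_real r) \<le> max 1 (B / b)" if r: "r \<in> {0<..<h}" for r
  proof (cases "r < b")
    case True
    then show ?thesis using b(2)[of r] r by (intro max.coboundedI1) simp
  next
    case False
    have "norm (H r) / r \<le> B / b"
      using B[OF r] False b(1) r order_trans[OF norm_ge_zero B[OF r]] by (intro frac_le) auto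
    then show ?thesis using r by (simp add: norm_divide)
  qed
  moreover have "(\<lambda>r. H r / of_real r) \<in> borel_measurable (lebesgue_on {0<..<h})"
  proof -
    have "(\<lambda>r. complex_of_real r) \<in> borel_measurable (lebesgue_on {0<..<h})"
      by (intro measurable_lebesgue_on_continuous continuous_intros)
    then show ?thesis using H unfolding regular_at_0_def by auto
  qed
  ultimately show ?thesis using lim unfolding regular_at_0_def by blast
qed

section \<open>Weak Jacobians and traces of the difference\<close>

lemma L2_scaleR_integrable:
  fixes u :: "'a::euclidean_space \<Rightarrow> 'b::euclidean_space"
  assumes u: "u \<in> L2 S" and S: "bounded S" "S \<in> lmeasurable" and q: "continuous_on UNIV q"
  shows "integrable (lebesgue_on S) (\<lambda>x. q x *\<^sub>R u x)"
proof (rule Bochner_Integration.integrable_bound)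
  have "q \<in> L2 S" by (rule L2_continuous[OF q S])
  then show "integrable (lebesgue_on S) (\<lambda>x. (norm (u x))\<^sup>2 + (norm (q x))\<^sup>2)"
    "(\<lambda>x. q x *\<^sub>R u x) \<in> borel_measurable (lebesgue_on S)"
    using u by (auto simp: L2_def)
  have ab: "a * b \<le> b\<^sup>2 + a\<^sup>2" for a b :: real
  proof -
    have "2 * a * b \<le> a\<^sup>2 + b\<^sup>2" by (rule sum_squares_bound)
    moreover have "0 \<le> a\<^sup>2 + b\<^sup>2" by simp
    ultimately show ?thesis by linarith
  qed
  show "AE x in lebesgue_on S. norm (q x *\<^sub>R u x) \<le> norm ((norm (u x))\<^sup>2 + (norm (q x))\<^sup>2)"
  proof (rule AE_I2)
    fix x show "norm (q x *\<^sub>R u x) \<le> norm ((norm (u x))\<^sup>2 + (norm (q x))\<^sup>2)"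
      using ab[of "\<bar>q x\<bar>" "norm (u x)"] by (simp add: abs_of_nonneg)
  qed
qed

lemma has_weak_jacobian_weak_jacobian:
  "u \<in> H1 \<Omega> \<Longrightarrow> has_weak_jacobian \<Omega> u (weak_jacobian \<Omega> u)"
  using someI_ex[of "has_weak_jacobian \<Omega> u"] by (simp add: H1_def weak_jacobian_def)

lemma L2_column:
  fixes D :: "'a::euclidean_space \<Rightarrow> complex^2^2"
  assumes "D \<in> L2 S" shows "(\<lambda>x. column i (D x)) \<in> L2 S"
proof -
  have "linear (\<lambda>A::complex^2^2. column i A)"
    by (rule linearI) (auto simp: column_def vec_eq_iff)
  then show ?thesis using L2_bounded_linear[OF _ assms] linear_conv_bounded_linear by blast
qed

text \<open>The three weak Jacobians are chosen independently of each other, so linearity is stated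
  after integration against test functions, where it follows from linearity of the defining
  relation.\<close>

lemma weak_jacobian_diff:
  assumes S: "bounded \<Omega>" "\<Omega> \<in> lmeasurable"
    and H1: "v \<in> H1 \<Omega>" "w \<in> H1 \<Omega>" "(\<lambda>x. v x - w x) \<in> H1 \<Omega>"
    and \<phi>: "test_function \<Omega> \<phi>"
  shows "(LINT x|lebesgue_on \<Omega>. \<phi> x *\<^sub>R ((weak_jacobian \<Omega> v x - weak_jacobian \<Omega> w x - weak_jacobian \<Omega> (\<lambda>x. v x - w x) x) $ k $ i)) = 0"
proof -
  let ?u = "\<lambda>x. v x - w x"
  note J = H1[THEN has_weak_jacobian_weak_jacobian, unfolded has_weak_jacobian_def]
  have L2: "v \<in> L2 \<Omega>" "w \<in> L2 \<Omega>" using H1 by (auto simp: H1_def)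
  have s: "smooth \<phi>" using \<phi> by (simp add: test_function_def)
  have c: "continuous_on UNIV \<phi>" "continuous_on UNIV (partial i \<phi>)"
    using smooth_continuous[OF s] smooth_continuous[OF smooth_partial[OF s]] by auto
  have int: "integrable (lebesgue_on \<Omega>) (\<lambda>x. \<phi> x *\<^sub>R (D x $ k $ i))"
     "(LINT x|lebesgue_on \<Omega>. \<phi> x *\<^sub>R (D x $ k $ i)) = - (LINT x|lebesgue_on \<Omega>. partial i \<phi> x *\<^sub>R u x) $ k"
    if u: "has_weak_jacobian \<Omega> u D" for u D
  proof -
    have D: "D \<in> L2 \<Omega>" using u by (simp add: has_weak_jacobian_def)
    show "integrable (lebesgue_on \<Omega>) (\<lambda>x. \<phi> x *\<^sub>R (D x $ k $ i))"
      by (rule L2_scaleR_integrable[OF L2_nth[OF L2_nth[OF D]] S c(1)])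
    have "(LINT x|lebesgue_on \<Omega>. \<phi> x *\<^sub>R (D x $ k $ i)) = (LINT x|lebesgue_on \<Omega>. (\<phi> x *\<^sub>R column i (D x)) $ k)"
      by (simp add: column_def)
    also have "\<dots> = (LINT x|lebesgue_on \<Omega>. \<phi> x *\<^sub>R column i (D x)) $ k"
      by (rule integral_bounded_linear[OF bounded_linear_vec_nth L2_scaleR_integrable[OF L2_column[OF D] S c(1)]])
    finally show "(LINT x|lebesgue_on \<Omega>. \<phi> x *\<^sub>R (D x $ k $ i)) = - (LINT x|lebesgue_on \<Omega>. partial i \<phi> x *\<^sub>R u x) $ k"
      using u \<phi> by (simp add: has_weak_jacobian_def)
  qed
  note hv = has_weak_jacobian_weak_jacobian[OF H1(1)] and hw = has_weak_jacobian_weak_jacobian[OF H1(2)]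
    and hu = has_weak_jacobian_weak_jacobian[OF H1(3)]
  have "(LINT x|lebesgue_on \<Omega>. \<phi> x *\<^sub>R ((weak_jacobian \<Omega> v x - weak_jacobian \<Omega> w x - weak_jacobian \<Omega> ?u x) $ k $ i)) =
     (LINT x|lebesgue_on \<Omega>. \<phi> x *\<^sub>R (weak_jacobian \<Omega> v x $ k $ i)) - (LINT x|lebesgue_on \<Omega>. \<phi> x *\<^sub>R (weak_jacobian \<Omega> w x $ k $ i))
      - (LINT x|lebesgue_on \<Omega>. \<phi> x *\<^sub>R (weak_jacobian \<Omega> ?u x $ k $ i))"
    using int(1)[OF hv] int(1)[OF hw] int(1)[OF hu] by (simp add: scaleR_diff_right)
  also have "\<dots> = 0"
    unfolding int(2)[OF hv] int(2)[OF hw] int(2)[OF hu]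
    using L2_scaleR_integrable[OF L2(1) S c(2)] L2_scaleR_integrable[OF L2(2) S c(2)]
    by (simp add: scaleR_diff_right)
  finally show ?thesis .
qed

text \<open>The constant is subtracted from the approximants as well, which leaves their Jacobians
  unchanged.\<close>

lemma has_trace_imp_trace_approx:
  assumes "has_trace_on_side \<Omega> \<theta> h u f"
  shows "trace_approx \<Omega> \<theta> h (\<lambda>x. u x - c) (weak_jacobian \<Omega> u) (\<lambda>x. f x - c)"
proof -
  obtain U where U: "\<And>n::nat. smooth (U n)"
    "(\<lambda>n. L2_sq \<Omega> (\<lambda>x. U n x - u x)) \<longlonglongrightarrow> 0"
    "(\<lambda>n. L2_sq \<Omega> (\<lambda>x. jacobian (U n) x - weak_jacobian \<Omega> u x)) \<longlonglongrightarrow> 0"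
    "(\<lambda>n. L2_sq {0<..<h} (\<lambda>r. U n (polar \<theta> r) - f (polar \<theta> r))) \<longlonglongrightarrow> 0"
    using assms unfolding has_trace_on_side_def by blast
  have "partial i (\<lambda>x. U n x - c) x = partial i (U n) x" for i n x
    using partial_eq[OF has_derivative_diff[OF smooth_has_derivative[OF U(1)[of n]] has_derivative_const[of c]]]
    by (simp add: partial_def)
  then have "jacobian (\<lambda>x. U n x - c) = jacobian (U n)" for n
    by (simp add: jacobian_def fun_eq_iff)
  moreover have "smooth (\<lambda>x. U n x - c)" for n
    using smooth_add[OF U(1) smooth_const[of "- c"]] by simp
  ultimately show ?thesis
    unfolding trace_approx_def by (intro exI[of _ "\<lambda>n x. U n x - c"]) (use U in simp)
qed

theorem proposition4p1:
  fixes lam mu \<theta>m \<theta>M h \<alpha>p \<alpha>m \<beta>p \<beta>m :: real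
    and v w fp fm gp gm :: "real^2 \<Rightarrow> complex^2"
  defines "\<Omega> \<equiv> sector \<theta>m \<theta>M h"
  assumes "mu > 0" and "2 * mu + 2 * lam > 0"
    and "\<theta>m \<in> {-pi<..<pi}" and "\<theta>M \<in> {-pi<..<pi}" and "\<theta>M - \<theta>m \<in> {0<..<pi}"
    and "h > 0"
    and "\<alpha>p \<in> {0<..<1}" and "\<alpha>m \<in> {0<..<1}" and "\<beta>p \<in> {0<..<1}" and "\<beta>m \<in> {0<..<1}"
    and "v \<in> H1 \<Omega>" and "w \<in> H1 \<Omega>"
    and "lame_zero lam mu \<Omega> v" and "lame_zero lam mu \<Omega> w"
    and "fp \<in> H_half_side \<theta>M h \<inter> C1_holder_side \<alpha>p \<theta>M h"
    and "fm \<in> H_half_side \<theta>m h \<inter> C1_holder_side \<alpha>m \<theta>m h"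
    and "gp \<in> H_minus_half_side \<theta>M h \<inter> C_holder_side \<beta>p \<theta>M h"
    and "gm \<in> H_minus_half_side \<theta>m h \<inter> C_holder_side \<beta>m \<theta>m h"
    and "has_trace_on_side \<Omega> \<theta>M h (\<lambda>x. v x - w x) fp"
    and "has_trace_on_side \<Omega> \<theta>m h (\<lambda>x. v x - w x) fm"
    and "equal_on_side \<Omega> \<theta>M h
           (\<lambda>\<phi>. traction lam mu \<Omega> v \<phi> - traction lam mu \<Omega> w \<phi>) (side_pairing \<theta>M h gp)"
    and "equal_on_side \<Omega> \<theta>m h
           (\<lambda>\<phi>. traction lam mu \<Omega> v \<phi> - traction lam mu \<Omega> w \<phi>) (side_pairing \<theta>m h gm)"
  shows "vertex_value \<theta>M h fp = vertex_value \<theta>m h fm \<and>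
    (has_vertex_gradient \<alpha>p \<theta>M h fp 0 \<and> has_vertex_gradient \<alpha>m \<theta>m h fm 0 \<longrightarrow>
      vertex_value \<theta>M h gp =
        (vector [vector [complex_of_real (- cos (\<theta>M - \<theta>m)), complex_of_real (- sin (\<theta>M - \<theta>m))],
                 vector [complex_of_real (- sin (\<theta>M - \<theta>m)), complex_of_real (cos (\<theta>M - \<theta>m))]]
          :: complex^2^2) *v vertex_value \<theta>m h gm)"
proof -
  have h: "0 < h" by fact
  define \<theta>0 where "\<theta>0 = (\<theta>M + \<theta>m) / 2"
  define \<alpha> where "\<alpha> = (\<theta>M - \<theta>m) / 2"
  \<comment> \<open>The index \<sigma> = 1 stands for the side at \<theta>M and \<sigma> = -1 for
    the side at \<theta>m.\<close>
  define f where "f \<sigma> = (if \<sigma> = 1 then fp else fm)" for \<sigma> :: real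
  define g where "g \<sigma> = (if \<sigma> = 1 then gp else gm)" for \<sigma> :: real
  define \<theta> where "\<theta> \<sigma> = \<theta>0 + \<sigma> * \<alpha>" for \<sigma> :: real
  define u where "u x = v x - w x" for x
  have \<theta>: "\<theta> 1 = \<theta>M" "\<theta> (-1) = \<theta>m" "\<theta>0 - \<alpha> = \<theta>m" "\<theta>0 + \<alpha> = \<theta>M"
    by (simp_all add: \<theta>_def \<theta>0_def \<alpha>_def field_simps)
  interpret S: convex_sector \<theta>0 \<alpha> h
    using \<open>\<theta>M - \<theta>m \<in> {0<..<pi}\<close> h by unfold_locales (auto simp: \<alpha>_def)
  have \<Omega>: "S.\<Omega> = \<Omega>" unfolding S.\<Omega>_def \<theta> \<Omega>_def ..
  note S = S.bounded_\<Omega>[unfolded \<Omega>] S.lmeasurable_\<Omega>[unfolded \<Omega>]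
  have tr: "has_trace_on_side \<Omega> (\<theta> \<sigma>) h u (f \<sigma>)" if "\<sigma> \<in> {1, -1}" for \<sigma>
    using that assms by (auto simp: f_def \<theta> u_def[abs_def])
  have uH1: "u \<in> H1 \<Omega>" using tr[of 1] by (simp add: has_trace_on_side_def)
  have fh: "holder_on 1 {0<..<h} (\<lambda>r. f \<sigma> (polar (\<theta> \<sigma>) r))" if "\<sigma> \<in> {1, -1}" for \<sigma>
    using that assms C1_holder_side_lipschitz[of h \<alpha>p fp \<theta>M] C1_holder_side_lipschitz[of h \<alpha>m fm \<theta>m]
    by (auto simp: f_def \<theta>)
  have gh: "\<exists>\<beta>>0. holder_on \<beta> {0<..<h} (\<lambda>r. g \<sigma> (polar (\<theta> \<sigma>) r))" if "\<sigma> \<in> {1, -1}" for \<sigma>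
    using that assms C_holder_side_holder[of gp \<beta>p \<theta>M h] C_holder_side_holder[of gm \<beta>m \<theta>m h]
    by (auto simp: g_def \<theta>)
  have f_reg: "((\<lambda>r. f \<sigma> (polar (\<theta> \<sigma>) r)) \<longlongrightarrow> vertex_value (\<theta> \<sigma>) h (f \<sigma>)) (at_right 0) \<and>
      continuous_on {0<..<h} (\<lambda>r. f \<sigma> (polar (\<theta> \<sigma>) r)) \<and> bounded ((\<lambda>r. f \<sigma> (polar (\<theta> \<sigma>) r)) ` {0<..<h})"
    if "\<sigma> \<in> {1, -1}" for \<sigma>
    using holder_on_Ioo_regular[OF h zero_less_one fh[OF that]] vertex_value_eq[OF h, of "f \<sigma>" "\<theta> \<sigma>"] by metis
  have g_reg: "((\<lambda>r. g \<sigma> (polar (\<theta> \<sigma>) r)) \<longlongrightarrow> vertex_value (\<theta> \<sigma>) h (g \<sigma>)) (at_right 0) \<and>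
      continuous_on {0<..<h} (\<lambda>r. g \<sigma> (polar (\<theta> \<sigma>) r)) \<and> bounded ((\<lambda>r. g \<sigma> (polar (\<theta> \<sigma>) r)) ` {0<..<h})"
    if \<sigma>: "\<sigma> \<in> {1, -1}" for \<sigma>
    using gh[OF \<sigma>] holder_on_Ioo_regular[OF h] vertex_value_eq[OF h, of "g \<sigma>" "\<theta> \<sigma>"] by metis
  \<comment> \<open>The shift \<open>c\<close> is kept arbitrary: zero serves the equality of the
    displacements, their common vertex value the statement on tractions.\<close>
  have data: "sector_data \<theta>0 \<alpha> h lam mu (\<lambda>x. u x - c) (weak_jacobian \<Omega> v) (weak_jacobian \<Omega> w) (weak_jacobian \<Omega> u)
      (\<lambda>\<sigma> x. f \<sigma> x - c) g" for c
  proof unfold_locales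
    show "(\<lambda>x. u x - c) \<in> L2 S.\<Omega>"
      unfolding \<Omega> using uH1 by (intro L2_diff[OF _ L2_continuous[OF continuous_on_const S]]) (simp add: H1_def)
    show "weak_jacobian \<Omega> v \<in> L2 S.\<Omega>" "weak_jacobian \<Omega> w \<in> L2 S.\<Omega>" "weak_jacobian \<Omega> u \<in> L2 S.\<Omega>"
      unfolding \<Omega> using assms(12,13) uH1 has_weak_jacobian_weak_jacobian by (auto simp: has_weak_jacobian_def)
    fix \<sigma> :: real assume \<sigma>: "\<sigma> \<in> {1, -1}"
    show "(\<lambda>r. f \<sigma> (polar (\<theta>0 + \<sigma> * \<alpha>) r) - c) \<in> L2 {0<..<h}"
      using tr[OF \<sigma>] by (intro L2_diff[OF _ L2_continuous[OF continuous_on_const]]) (auto simp: has_trace_on_side_def \<theta>_def)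
    show "(\<lambda>r. g \<sigma> (polar (\<theta>0 + \<sigma> * \<alpha>) r)) \<in> L2 {0<..<h}"
      using g_reg[OF \<sigma>] by (intro continuous_bounded_L2) (auto simp: \<theta>_def)
    show "trace_approx S.\<Omega> (\<theta>0 + \<sigma> * \<alpha>) h (\<lambda>x. u x - c) (weak_jacobian \<Omega> u) (\<lambda>x. f \<sigma> x - c)"
      unfolding \<Omega> using has_trace_imp_trace_approx[OF tr[OF \<sigma>]] by (simp add: \<theta>_def)
    fix \<phi> assume "boundary_test_function S.\<Omega> (side (\<theta>0 + \<sigma> * \<alpha>) h) \<phi>"
    then show "(LINT x|lebesgue_on S.\<Omega>. contraction (stress lam mu (weak_jacobian \<Omega> v x)) (jacobian \<phi> x)) -
      (LINT x|lebesgue_on S.\<Omega>. contraction (stress lam mu (weak_jacobian \<Omega> w x)) (jacobian \<phi> x)) = side_pairing (\<theta>0 + \<sigma> * \<alpha>) h (g \<sigma>) \<phi>"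
      using \<sigma> assms(22,23) unfolding \<Omega> equal_on_side_def traction_def \<theta>_def[symmetric] by (auto simp: \<theta> g_def)
  next
    fix k i :: 2 and \<phi> :: "real^2 \<Rightarrow> real" assume "test_function S.\<Omega> \<phi>"
    then show "(LINT x|lebesgue_on S.\<Omega>. \<phi> x *\<^sub>R ((weak_jacobian \<Omega> v x - weak_jacobian \<Omega> w x - weak_jacobian \<Omega> u x) $ k $ i)) = 0"
      unfolding \<Omega> using weak_jacobian_diff[OF S assms(12,13)] uH1 by (simp add: u_def[abs_def])
  qed
  have g_nth: "regular_at_0 h (\<lambda>r. g \<sigma> (polar (\<theta>0 + \<sigma> * \<alpha>) r) $ k) (vertex_value (\<theta> \<sigma>) h (g \<sigma>) $ k)"
    if "\<sigma> \<in> {1, -1}" for \<sigma> k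
    using g_reg[OF that] unfolding \<theta>_def[symmetric] by (intro regular_at_0_nth) auto
  have f_nth: "regular_at_0 h (\<lambda>r. (f \<sigma> (polar (\<theta>0 + \<sigma> * \<alpha>) r) - c) $ k) ((vertex_value (\<theta> \<sigma>) h (f \<sigma>) - c) $ k)"
    if "\<sigma> \<in> {1, -1}" for \<sigma> k c
    using f_reg[OF that] unfolding \<theta>_def[symmetric]
    by (intro regular_at_0_nth tendsto_diff tendsto_const continuous_on_diff continuous_on_const bounded_minus_comp)
      (auto simp: image_constant_conv)
  have eq: "vertex_value (\<theta> 1) h (f 1) = vertex_value (\<theta> (-1)) h (f (-1))"
  proof -
    interpret sector_data \<theta>0 \<alpha> h lam mu "\<lambda>x. u x - 0" "weak_jacobian \<Omega> v" "weak_jacobian \<Omega> w" "weak_jacobian \<Omega> u"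
      "\<lambda>\<sigma> x. f \<sigma> x - 0" g
      by (rule data)
    show ?thesis
      using vertex_displacement_eq[of "\<lambda>\<sigma>. vertex_value (\<theta> \<sigma>) h (g \<sigma>)" "\<lambda>\<sigma>. vertex_value (\<theta> \<sigma>) h (f \<sigma>) - 0",
          OF _ g_nth f_nth] \<open>mu > 0\<close> by simp
  qed
  have g0: "vertex_value (\<theta> \<sigma>) h (g \<sigma>) = 0"
    if grad: "has_vertex_gradient \<alpha>p \<theta>M h fp 0" "has_vertex_gradient \<alpha>m \<theta>m h fm 0" and \<sigma>: "\<sigma> \<in> {1, -1}" for \<sigma>
  proof -
    define c where "c = vertex_value (\<theta> 1) h (f 1)"
    have c: "vertex_value (\<theta> \<sigma>) h (f \<sigma>) = c" if "\<sigma> \<in> {1, -1}" for \<sigma>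
      using that eq by (auto simp: c_def)
    interpret sector_data \<theta>0 \<alpha> h lam mu "\<lambda>x. u x - c" "weak_jacobian \<Omega> v" "weak_jacobian \<Omega> w" "weak_jacobian \<Omega> u"
      "\<lambda>\<sigma> x. f \<sigma> x - c" g
      by (rule data)
    have lim: "((\<lambda>r. (f \<sigma> (polar (\<theta> \<sigma>) r) - c) /\<^sub>R r) \<longlongrightarrow> 0) (at_right 0)" if "\<sigma> \<in> {1, -1}" for \<sigma>
      using that grad vertex_gradient_0_tendsto[OF h, of \<alpha>p \<theta>M fp] vertex_gradient_0_tendsto[OF h, of \<alpha>m \<theta>m fm]
        assms(8,9) c[OF that] by (auto simp: f_def \<theta>)
    have f0: "regular_at_0 h (\<lambda>r. (f \<sigma> (polar (\<theta>0 + \<sigma> * \<alpha>) r) - c) $ k) 0" if "\<sigma> \<in> {1, -1}" for \<sigma> k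
      using f_nth[OF that, of c k] by (simp add: c[OF that])
    have f0': "regular_at_0 h (\<lambda>r. (f \<sigma> (polar (\<theta>0 + \<sigma> * \<alpha>) r) - c) $ k / of_real r) 0" if "\<sigma> \<in> {1, -1}" for \<sigma> k
    proof (rule regular_at_0_divide[OF h f0[OF that]])
      show "((\<lambda>r. (f \<sigma> (polar (\<theta>0 + \<sigma> * \<alpha>) r) - c) $ k / of_real r) \<longlongrightarrow> 0) (at_right 0)"
        using tendsto_vec_nth[OF lim[OF that], of k]
        by (simp add: \<theta>_def scaleR_conv_of_real[where 'a=complex] divide_inverse mult.commute)
    qed
    show ?thesis
      by (rule vertex_traction_eq_0[OF \<open>mu > 0\<close> _ g_nth f0 f0' \<sigma>]) (use assms(3) in simp_all)
  qed
  show ?thesis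
    using eq g0[of 1] g0[of "-1"] by (auto simp: \<theta> f_def g_def)
qed

end
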